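(* For any skew shape $\lambda/\mu$, we have $\omega(g_{\lambda/\mu})=j_{\lambda/\mu}$.
   Context: Young diagrams are in English notation. $\omega$ is the algebra involution of the ring $\mathrm{Sym}$ of symmetric functions with $e_k\mapsto h_k$ (elementary to complete homogeneous). A reverse plane partition $T$ of shape $\lambda/\mu$ is a filling of the boxes with positive integers weakly increasing along rows and down columns. $g_{\lambda/\mu}=\sum_T\prod_ix_i^{T(i)}$ over all reverse plane partitions of shape $\lambda/\mu$, where $T(i)$ is the number of columns of $T$ containing one or more entries equal to $i$. It is a symmetric function. A valued-set tableau $T$ of shape $\lambda/\mu$ is a filling of the boxes of $\lambda/\mu$ with positive integers such that (1) the transpose of the filling is a semistandard tableau (i.e. entries of $T$ strictly increase along rows and weakly increase down columns), together with (2) a decomposition of the shape into a disjoint union $\lambda/\mu=\bigsqcup A_j$ of (nonempty) groups of boxes such that each $A_j$ is connected, completely contained within a single column, and all boxes in $A_j$ contain the same number. $j_{\lambda/\mu}=\sum_Tx^T$ over all valued-set tableaux of shape $\lambda/\mu$, where $x^T=\prod_{i\ge1}x_i^{a_i}$ and $a_i$ is the number of groups $A_j$ which contain the letter $i$. *)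

theory Defs
  imports
    "HOL-Library.Multiset"
    "HOL-Library.FuncSet"
    "HOL-Library.Disjoint_Sets"
    "HOL-Combinatorics.Permutations"
    "HOL-Algebra.Ring"
begin

section \<open>The ring of symmetric functions and the involution omega\<close>

text \<open>
  A formal power series over the integers in the variables x_1, x_2, x_3, ... is represented
  by its coefficient function. A monomial is the finite multiset of the indices of its variables:
  the multiplicity of i is the exponent of x_i. The index 0 is not used, so only coefficients of
  multisets not containing 0 may be nonzero.
\<close>

type_synonym series = "nat multiset \<Rightarrow> int"

text \<open>The coefficient of M in a product is a sum over all ways of splitting M into two factors.\<close>

definition series_mult :: "series \<Rightarrow> series \<Rightarrow> series" where
  "series_mult p q = (\<lambda>M. \<Sum>N | N \<subseteq># M. p N * q (M - N))"

definition series_one :: series where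
  "series_one = (\<lambda>M. if M = {#} then 1 else 0)"

definition symmetric_function :: "series \<Rightarrow> bool" where
  "symmetric_function p \<longleftrightarrow>
     (\<forall>M. 0 \<in># M \<longrightarrow> p M = 0) \<and>
     (\<exists>d. \<forall>M. p M \<noteq> 0 \<longrightarrow> size M \<le> d) \<and>
     (\<forall>\<pi> M. \<pi> permutes {1..} \<longrightarrow> p (image_mset \<pi> M) = p M)"

definition Sym :: "series ring" where
  "Sym = \<lparr>carrier = {p. symmetric_function p}, mult = series_mult, one = series_one,
          zero = (\<lambda>M. 0), add = (\<lambda>p q M. p M + q M)\<rparr>"

definition elementary :: "nat \<Rightarrow> series" where
  "elementary k = (\<lambda>M. if 0 \<notin># M \<and> size M = k \<and> (\<forall>i. count M i \<le> 1) then 1 else 0)"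

definition complete_homogeneous :: "nat \<Rightarrow> series" where
  "complete_homogeneous k = (\<lambda>M. if 0 \<notin># M \<and> size M = k then 1 else 0)"

text \<open>
  Over the integers, algebra homomorphisms are the same as (unital) ring homomorphisms.
  The extensionality condition only fixes the irrelevant values outside the ring, so that the
  description determines a single HOL function.
\<close>

definition omega :: "series \<Rightarrow> series" where
  "omega = (THE f. f \<in> extensional (carrier Sym) \<and> f \<in> ring_hom Sym Sym \<and>
                   (\<forall>p \<in> carrier Sym. f (f p) = p) \<and>
                   (\<forall>k. f (elementary k) = complete_homogeneous k))"

section \<open>Skew shapes\<close>

text \<open>A partition is given by its row lengths, padded by zeros; rows are numbered from 0.\<close>

definition is_partition :: "(nat \<Rightarrow> nat) \<Rightarrow> bool" where
  "is_partition lam \<longleftrightarrow> antimono lam \<and> finite {r. lam r \<noteq> 0}"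

text \<open>The box (r, c) lies in row r, counted from the top, and in column c, counted from the left.\<close>

definition skew_diagram :: "(nat \<Rightarrow> nat) \<Rightarrow> (nat \<Rightarrow> nat) \<Rightarrow> (nat \<times> nat) set" where
  "skew_diagram lam mu = {(r, c). mu r \<le> c \<and> c < lam r}"

definition filling :: "(nat \<times> nat) set \<Rightarrow> (nat \<times> nat \<Rightarrow> nat) \<Rightarrow> bool" where
  "filling D T \<longleftrightarrow> T \<in> D \<rightarrow>\<^sub>E {1..}"

section \<open>Reverse plane partitions\<close>

definition reverse_plane_partition :: "(nat \<times> nat) set \<Rightarrow> (nat \<times> nat \<Rightarrow> nat) \<Rightarrow> bool" where
  "reverse_plane_partition D T \<longleftrightarrow> filling D T \<and>
     (\<forall>r c c'. (r, c) \<in> D \<and> (r, c') \<in> D \<and> c < c' \<longrightarrow> T (r, c) \<le> T (r, c')) \<and>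
     (\<forall>r r' c. (r, c) \<in> D \<and> (r', c) \<in> D \<and> r < r' \<longrightarrow> T (r, c) \<le> T (r', c))"

text \<open>
  The coefficient of a monomial M in a generating function of tableaux is the number of tableaux
  of weight M. This is a finite number since every entry of such a tableau is an element of M.
\<close>

definition g_series :: "(nat \<Rightarrow> nat) \<Rightarrow> (nat \<Rightarrow> nat) \<Rightarrow> series" where
  "g_series lam mu = (\<lambda>M. int (card {T. reverse_plane_partition (skew_diagram lam mu) T \<and>
     (\<forall>i. count M i = card {c. \<exists>r. (r, c) \<in> skew_diagram lam mu \<and> T (r, c) = i})}))"

section \<open>Valued-set tableaux\<close>

text \<open>Two boxes are adjacent if they share an edge.\<close>

definition adjacent :: "((nat \<times> nat) \<times> (nat \<times> nat)) set" where
  "adjacent = {((r, c), (r', c')). (r = r' \<and> (c' = Suc c \<or> c = Suc c')) \<or>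
                                   (c = c' \<and> (r' = Suc r \<or> r = Suc r'))}"

definition connected_boxes :: "(nat \<times> nat) set \<Rightarrow> bool" where
  "connected_boxes A \<longleftrightarrow> (\<forall>a \<in> A. \<forall>b \<in> A. (a, b) \<in> (adjacent \<inter> A \<times> A)\<^sup>*)"

definition valued_set_tableau ::
    "(nat \<times> nat) set \<Rightarrow> (nat \<times> nat \<Rightarrow> nat) \<Rightarrow> (nat \<times> nat) set set \<Rightarrow> bool" where
  "valued_set_tableau D T P \<longleftrightarrow> filling D T \<and>
     (\<forall>r c c'. (r, c) \<in> D \<and> (r, c') \<in> D \<and> c < c' \<longrightarrow> T (r, c) < T (r, c')) \<and>
     (\<forall>r r' c. (r, c) \<in> D \<and> (r', c) \<in> D \<and> r < r' \<longrightarrow> T (r, c) \<le> T (r', c)) \<and>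
     partition_on D P \<and>
     (\<forall>A \<in> P. connected_boxes A \<and> (\<exists>c. \<forall>b \<in> A. snd b = c) \<and> (\<exists>i. \<forall>b \<in> A. T b = i))"

definition j_series :: "(nat \<Rightarrow> nat) \<Rightarrow> (nat \<Rightarrow> nat) \<Rightarrow> series" where
  "j_series lam mu = (\<lambda>M. int (card {(T, P). valued_set_tableau (skew_diagram lam mu) T P \<and>
     (\<forall>i. count M i = card {A \<in> P. \<exists>b \<in> A. T b = i})}))"

end

theory Submission
  imports Defs "HOL-Computational_Algebra.Polynomial"
begin

text \<open>
  A symmetric function is determined by its values on exponent partitions, that is, by a function
  on multisets of positive integers. On such functions let \<open>h\<^sub>k\<close> be the operator that
  adds a part \<open>k\<close> to the argument, and let \<open>e\<^sub>n\<close> be the polynomial in the \<open>h\<^sub>k\<close> given by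
  \<open>\<Sum>\<^sub>k (-1)\<^sup>k h\<^sub>k e\<^sub>n\<^sub>-\<^sub>k = 0\<close>. Replacing every \<open>h\<^sub>k\<close> by \<open>e\<^sub>k\<close> in the coefficients yields
  an explicit ring endomorphism of Sym exchanging elementary and complete homogeneous functions.
  As the elementary functions generate Sym, it is omega.

  Slicing tableaux by their entries, the coefficients of g are the matrix entries of products of
  operators \<open>a\<^sub>k\<close> on functions of shapes, where \<open>a\<^sub>k\<close> is supported on skew shapes with \<open>k\<close> nonempty
  columns; those of j are matrix entries of products of \<open>b\<^sub>k\<close>, where the generating function of
  the \<open>b\<^sub>k\<close> on a vertical strip with \<open>c\<close> nonempty columns and \<open>m\<close> boxes is
  \<open>x\<^sup>c (1 + x)\<^sup>m\<^sup>-\<^sup>c\<close>. Hence the theorem amounts to \<open>\<Sum>\<^sub>k (-1)\<^sup>k a\<^sub>k b\<^sub>n\<^sub>-\<^sub>k = 0\<close> for \<open>n > 0\<close>, and the symmetry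
  of g to the commutation of the \<open>a\<^sub>k\<close>, which follows from that of the \<open>b\<^sub>k\<close>. Both identities are
  checked on generating functions, by summing over the intermediate shape row by row.
\<close>

section \<open>Operators graded by the natural numbers\<close>

text \<open>The construction comes from the Hall inner product. The coefficient of a symmetric
  function at an exponent partition \<nu> is its pairing with the product of the complete
  homogeneous functions of the parts of \<nu>. Adding a part \<open>k\<close> is therefore adjoint
  to multiplication by the complete homogeneous function of degree \<open>k\<close>, and
  \<open>eop\<close> produces the adjoints of multiplication by elementary functions. As the
  involution is an isometry exchanging both families of functions, it exchanges words in the two
  families of operators.

  One principle, \<open>fold_eop_transfer\<close>, does the work: if all words in two families of
  operators have the same values, so do all words in the derived operators. It is applied once
  against a tensor product, for multiplicativity, and once against operators on shapes, for the
  theorem. It assumes no commutation; the recursion for \<open>eop\<close> fixes the order of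
  composition.\<close>

function eop :: "(nat \<Rightarrow> ('i \<Rightarrow> int) \<Rightarrow> 'i \<Rightarrow> int) \<Rightarrow> nat \<Rightarrow> ('i \<Rightarrow> int) \<Rightarrow> 'i \<Rightarrow> int" where
  "eop h n v = (if n = 0 then v else (\<lambda>i. \<Sum>k\<in>{1..n}. (-1) ^ (k - 1) * h k (eop h (n - k) v) i))"
  by auto
termination by (relation "measure (\<lambda>(h, n, v). n)") auto

declare eop.simps [simp del]

lemma eop_0 [simp]: "eop h 0 v = v"
  by (simp add: eop.simps)

lemma eop_pos: "n > 0 \<Longrightarrow> eop h n v = (\<lambda>i. \<Sum>k\<in>{1..n}. (-1) ^ (k - 1) * h k (eop h (n - k) v) i)"
  by (subst eop.simps) simp

locale op_family =
  fixes h :: "nat \<Rightarrow> ('i \<Rightarrow> int) \<Rightarrow> 'i \<Rightarrow> int"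
  assumes op_0 [simp]: "h 0 v = v"
    and op_add: "h k (\<lambda>i. v i + w i) = (\<lambda>i. h k v i + h k w i)"
    and op_scale: "h k (\<lambda>i. c * v i) = (\<lambda>i. c * h k v i)"
begin

lemma op_sum: "h k (\<lambda>i. \<Sum>x\<in>A. c x * v x i) = (\<lambda>i. \<Sum>x\<in>A. c x * h k (v x) i)"
proof (induction A rule: infinite_finite_induct)
  case (insert x A)
  then show ?case by (simp add: op_add op_scale)
qed (use op_scale[of k 0] in simp_all)

lemma fold_op_sum:
  "fold h ks (\<lambda>i. \<Sum>x\<in>A. c x * v x i) = (\<lambda>i. \<Sum>x\<in>A. c x * fold h ks (v x) i)"
  by (induction ks arbitrary: v) (simp_all add: op_sum)

lemma eop_relation:
  assumes "n > 0"
  shows "(\<Sum>k\<le>n. (-1) ^ k * h k (eop h (n - k) v) i) = 0"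
proof -
  have "(\<Sum>k\<le>n. (-1) ^ k * h k (eop h (n - k) v) i)
      = eop h n v i + (\<Sum>k\<in>{1..n}. (-1) ^ k * h k (eop h (n - k) v) i)"
    by (simp add: atMost_atLeast0 sum.atLeast_Suc_atMost)
  also have "(\<Sum>k\<in>{1..n}. (-1) ^ k * h k (eop h (n - k) v) i)
      = (\<Sum>k\<in>{1..n}. - ((-1) ^ (k - 1) * h k (eop h (n - k) v) i))"
    by (intro sum.cong refl) (auto simp: power_eq_if)
  finally show ?thesis
    by (simp add: eop_pos[OF assms] sum_negf)
qed

text \<open>The relation is a recursion: its term for \<open>k = 0\<close> is \<open>e n v\<close>,
  because \<open>h 0\<close> is the identity, and the other terms involve smaller indices of
  \<open>e\<close>. This is how a family given by combinatorics is recognised as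
  \<open>eop h\<close>.\<close>

lemma eop_unique:
  assumes e0: "\<And>v. e 0 v = v"
    and rel: "\<And>n i v. n > 0 \<Longrightarrow> (\<Sum>k\<le>n. (-1) ^ k * h k (e (n - k) v) i) = 0"
  shows "e n v = eop h n v"
proof (induction n rule: less_induct)
  case (less n)
  show ?case
  proof (cases "n = 0")
    case False
    have "e n v i = eop h n v i" for i
    proof -
      have "(\<Sum>k\<le>n. (-1) ^ k * h k (e (n - k) v) i) = (\<Sum>k\<le>n. (-1) ^ k * h k (eop h (n - k) v) i)"
        using rel[of n v i] eop_relation[of n v i] False by simp
      moreover have "(\<Sum>k\<in>{1..n}. (-1) ^ k * h k (e (n - k) v) i)
          = (\<Sum>k\<in>{1..n}. (-1) ^ k * h k (eop h (n - k) v) i)"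
        by (intro sum.cong refl) (use less False in auto)
      ultimately show ?thesis
        by (simp add: atMost_atLeast0 sum.atLeast_Suc_atMost)
    qed
    then show ?thesis by blast
  qed (simp add: e0)
qed

lemma op_family_eop: "op_family (eop h)"
proof
  show "eop h k (\<lambda>i. v i + w i) = (\<lambda>i. eop h k v i + eop h k w i)" for k v w
  proof (induction k rule: less_induct)
    case (less k)
    show ?case
    proof (cases "k = 0")
      case False
      have "h j (eop h (k - j) (\<lambda>i. v i + w i)) i = h j (eop h (k - j) v) i + h j (eop h (k - j) w) i"
        if "j \<in> {1..k}" for i j
        using less[of "k - j"] that by (simp add: op_add)
      then show ?thesis using False
        by (simp add: eop_pos sum.distrib[symmetric] distrib_left)
    qed simp
  qed
  show "eop h k (\<lambda>i. c * v i) = (\<lambda>i. c * eop h k v i)" for k c v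
  proof (induction k rule: less_induct)
    case (less k)
    show ?case
    proof (cases "k = 0")
      case False
      have "h j (eop h (k - j) (\<lambda>i. c * v i)) i = c * h j (eop h (k - j) v) i"
        if "j \<in> {1..k}" for i j
        using less[of "k - j"] that by (simp add: op_scale)
      then show ?thesis using False
        by (simp add: eop_pos sum_distrib_left mult.left_commute)
    qed simp
  qed
qed simp

text \<open>A word in the operators \<open>eop h\<close> expands into words in \<open>h\<close> with
  integer coefficients that are the same for every family. Hence only the values of words in
  \<open>h\<close> matter, and the two index types may be unrelated.\<close>

lemma fold_eop_transfer:
  fixes h' :: "nat \<Rightarrow> ('j \<Rightarrow> int) \<Rightarrow> 'j \<Rightarrow> int"
  assumes "op_family h'" and "\<And>ks. fold h ks v i = fold h' ks w j"
  shows "fold (eop h) ks v i = fold (eop h') ks w j"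
proof -
  interpret h': op_family h' by fact
  \<comment> \<open>Only the operator applied first is converted, and the word in \<open>h\<close>
    after it stays arbitrary. The result is again the hypothesis, now for new vectors, so the
    letters can be converted one by one.\<close>
  have step: "fold h ks (eop h n v) i = fold h' ks (eop h' n w) j"
    if "\<And>ks. fold h ks v i = fold h' ks w j" for n ks v w
    using that
  proof (induction n arbitrary: ks rule: less_induct)
    case (less n)
    show ?case
    proof (cases "n = 0")
      case False
      have "fold h ks (h k (eop h (n - k) v)) i = fold h' ks (h' k (eop h' (n - k) w)) j"
        if "k \<in> {1..n}" for k
        using less(1)[of "n - k" "k # ks"] that less(2) by simp
      then show ?thesis using False
        by (simp add: eop_pos fold_op_sum h'.fold_op_sum)
    qed (use less(2) in simp)
  qed
  show ?thesis using assms(2)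
  proof (induction ks arbitrary: v w)
    case Nil
    show ?case using Nil[of "[]"] by simp
  next
    case (Cons n ks)
    show ?case by (simp add: Cons.IH step[OF Cons.prems])
  qed
qed

lemma op_eop_commute:
  assumes "\<And>k v. g (h k v) = h k (g v)"
    and "\<And>A c (v :: nat \<Rightarrow> _). g (\<lambda>i. \<Sum>x\<in>A. c x * v x i) = (\<lambda>i. \<Sum>x\<in>A. c x * g (v x) i)"
  shows "g (eop h n v) = eop h n (g v)"
proof (induction n rule: less_induct)
  case (less n)
  show ?case
  proof (cases "n = 0")
    case False
    then show ?thesis
      by (simp add: eop_pos assms less)
  qed simp
qed

lemma fold_nonzero:
  assumes comm: "\<And>j k v. h j (h k v) = h k (h j v)"
    and "mset (filter (\<lambda>k. k \<noteq> 0) ks) = mset (filter (\<lambda>k. k \<noteq> 0) ls)"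
  shows "fold h ks v = fold h ls v"
proof -
  have filter: "fold h (filter (\<lambda>k. k \<noteq> 0) ks) v = fold h ks v" for ks v
    by (induction ks arbitrary: v) auto
  have "fold h (filter (\<lambda>k. k \<noteq> 0) ks) = fold h (filter (\<lambda>k. k \<noteq> 0) ls)"
    by (intro fold_multiset_equiv assms(2)) (auto simp: fun_eq_iff comm)
  then show ?thesis using filter by metis
qed

end

lemma eop_commute:
  assumes "op_family h" and comm: "\<And>j k v. h j (h k v) = h k (h j v)"
  shows "eop h m (eop h n v) = eop h n (eop h m v)"
proof -
  interpret h: op_family h by fact
  interpret e: op_family "eop h" by (rule h.op_family_eop)
  have "h k (eop h n v) = eop h n (h k v)" for k n v
    by (intro h.op_eop_commute comm h.op_sum)
  then show ?thesis
    by (intro h.op_eop_commute e.op_sum) simp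
qed

text \<open>The relation can also be solved for its last term, which is \<open>h n w\<close> because
  \<open>eop h 0\<close> is the identity. This expresses \<open>h n\<close> by smaller
  \<open>h k\<close> composed with operators \<open>eop h\<close>, and commutation spreads in two
  inductions: first to the pairs of an \<open>h n\<close> and an \<open>eop h j\<close>, then to the
  pairs within \<open>h\<close>.\<close>

lemma op_commute_if_eop_commute:
  assumes "op_family h" and comm: "\<And>j k v. eop h j (eop h k v) = eop h k (eop h j v)"
  shows "h m (h n v) = h n (h m v)"
proof -
  interpret h: op_family h by fact
  interpret e: op_family "eop h" by (rule h.op_family_eop)
  have last: "h n w i = (-1) ^ (n + 1) * (\<Sum>k<n. (-1) ^ k * h k (eop h (n - k) w) i)" if "n > 0" for n w i
  proof -
    have "(-1) ^ n * h n w i = - (\<Sum>k<n. (-1) ^ k * h k (eop h (n - k) w) i)"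
      using h.eop_relation[OF that, of w i] by (simp add: lessThan_Suc_atMost[symmetric])
    then have "(-1) ^ n * ((-1) ^ n * h n w i)
        = (-1) ^ n * - (\<Sum>k<n. (-1) ^ k * h k (eop h (n - k) w) i)"
      by simp
    then show ?thesis by (simp flip: mult.assoc power_add mult_2)
  qed
  have last': "h n w = (\<lambda>i. \<Sum>k<n. ((-1) ^ (n + 1) * (-1) ^ k) * h k (eop h (n - k) w) i)"
    if "n > 0" for n w
    using last[OF that] by (auto simp: sum_distrib_left mult.assoc)
  have he: "h n (eop h j v) = eop h j (h n v)" for n j v
  proof (induction n arbitrary: v rule: less_induct)
    case (less n)
    show ?case
    proof (cases "n = 0")
      case False
      have "h n (eop h j v) i = eop h j (h n v) i" for i
      proof -
        have "eop h j (h n v) i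
            = eop h j (\<lambda>i. \<Sum>k<n. ((-1) ^ (n + 1) * (-1) ^ k) * h k (eop h (n - k) v) i) i"
          using False by (subst last') auto
        also have "\<dots> = (-1) ^ (n + 1) * (\<Sum>k<n. (-1) ^ k * eop h j (h k (eop h (n - k) v)) i)"
          by (subst e.op_sum) (simp add: sum_distrib_left mult.assoc)
        also have "(\<Sum>k<n. (-1) ^ k * eop h j (h k (eop h (n - k) v)) i)
            = (\<Sum>k<n. (-1) ^ k * h k (eop h (n - k) (eop h j v)) i)"
          by (intro sum.cong refl) (metis less comm lessThan_iff)
        also have "(-1) ^ (n + 1) * \<dots> = h n (eop h j v) i"
          using False by (simp only: last)
        finally show ?thesis by simp
      qed
      then show ?thesis by blast
    qed simp
  qed
  show ?thesis
  proof (induction n arbitrary: v rule: less_induct)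
    case (less n)
    show ?case
    proof (cases "n = 0")
      case False
      have "h m (h n v) i = h n (h m v) i" for i
      proof -
        have "h m (h n v) i
            = h m (\<lambda>i. \<Sum>k<n. ((-1) ^ (n + 1) * (-1) ^ k) * h k (eop h (n - k) v) i) i"
          using False by (subst last') auto
        also have "\<dots> = (-1) ^ (n + 1) * (\<Sum>k<n. (-1) ^ k * h m (h k (eop h (n - k) v)) i)"
          by (subst h.op_sum) (simp add: sum_distrib_left mult.assoc)
        also have "(\<Sum>k<n. (-1) ^ k * h m (h k (eop h (n - k) v)) i)
            = (\<Sum>k<n. (-1) ^ k * h k (eop h (n - k) (h m v)) i)"
          by (intro sum.cong refl) (metis less he lessThan_iff)
        also have "(-1) ^ (n + 1) * \<dots> = h n (h m v) i"
          using False by (simp only: last)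
        finally show ?thesis by simp
      qed
      then show ?thesis by blast
    qed simp
  qed
qed

section \<open>Tensor products of operator families and the coproduct rule\<close>

definition tensor_op ::
    "(nat \<Rightarrow> ('i \<Rightarrow> int) \<Rightarrow> 'i \<Rightarrow> int) \<Rightarrow> nat \<Rightarrow> ('i \<times> 'i \<Rightarrow> int) \<Rightarrow> 'i \<times> 'i \<Rightarrow> int" where
  "tensor_op h k t = (\<lambda>(i, j). \<Sum>a\<le>k. h a (\<lambda>i'. h (k - a) (\<lambda>j'. t (i', j')) j) i)"

definition tensor :: "('i \<Rightarrow> int) \<Rightarrow> ('i \<Rightarrow> int) \<Rightarrow> 'i \<times> 'i \<Rightarrow> int" where
  "tensor v w = (\<lambda>(i, j). v i * w j)"

text \<open>These lists are the exponent vectors of the divisors of a monomial, that is, the ways of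
  splitting it into two factors.\<close>

primrec le_lists :: "nat list \<Rightarrow> nat list set" where
  "le_lists [] = {[]}"
| "le_lists (k # ks) = (\<lambda>(a, as). a # as) ` ({..k} \<times> le_lists ks)"

lemma sum_le_lists_Cons:
  "(\<Sum>as\<in>le_lists (k # ks). f as) = (\<Sum>a\<le>k. \<Sum>as\<in>le_lists ks. f (a # as))"
  by (subst le_lists.simps, subst sum.reindex) (auto simp: inj_on_def sum.cartesian_product intro!: sum.cong)

lemma le_lists_altdef: "le_lists ks = {as. list_all2 (\<le>) as ks}"
proof (induction ks)
  case (Cons k ks)
  then show ?case by (force simp: list_all2_Cons2)
qed auto

text \<open>The coproduct rule is an assumption, instead of fixing \<open>t\<close> to be
  \<open>tensor_op h\<close>, because the same expansion is needed again with derived operators on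
  both sides.\<close>

lemma fold_tensor:
  assumes "op_family t"
    and pure: "\<And>k v w. t k (tensor v w) = (\<lambda>p. \<Sum>a\<le>k. tensor (h a v) (h (k - a) w) p)"
  shows "fold t ks (tensor v w) (i, j)
    = (\<Sum>as\<in>le_lists ks. fold h as v i * fold h (map2 (-) ks as) w j)"
proof -
  interpret t: op_family t by fact
  show ?thesis
  proof (induction ks arbitrary: v w)
    case (Cons k ks)
    have "fold t ks (\<lambda>p. \<Sum>a\<le>k. 1 * tensor (h a v) (h (k - a) w) p) (i, j)
      = (\<Sum>a\<le>k. 1 * fold t ks (tensor (h a v) (h (k - a) w)) (i, j))"
      by (subst t.fold_op_sum) simp
    then show ?case
      by (simp add: pure sum_le_lists_Cons Cons.IH del: le_lists.simps)
  qed (simp add: tensor_def)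
qed

context op_family
begin

lemma tensor_op_tensor:
  "tensor_op h k (tensor v w) = (\<lambda>p. \<Sum>a\<le>k. tensor (h a v) (h (k - a) w) p)"
proof
  fix p :: "'i \<times> 'i"
  have "h a (\<lambda>i'. h b (\<lambda>j'. v i' * w j') j) i = h a v i * h b w j" for a b i j
    using op_scale[of a "h b w j" v] by (simp add: op_scale mult.commute)
  then show "tensor_op h k (tensor v w) p = (\<Sum>a\<le>k. tensor (h a v) (h (k - a) w) p)"
    by (simp add: tensor_op_def tensor_def split: prod.splits)
qed

lemma op_family_tensor_op: "op_family (tensor_op h)"
  by standard (auto simp: tensor_op_def fun_eq_iff op_add op_scale sum.distrib sum_distrib_left)

text \<open>Elementary functions have the same coproduct as complete homogeneous ones. Collecting
  the terms of the alternating sum by the total degree \<open>s\<close> that falls on the first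
  factor turns it into products of an alternating sum of degree \<open>s\<close> for
  \<open>v\<close> and one of degree \<open>n - s\<close> for \<open>w\<close>. One of the two
  degrees is positive, so that factor vanishes by \<open>eop_relation\<close>.\<close>

lemma eop_tensor_op:
  "eop (tensor_op h) n (tensor v w) = (\<lambda>p. \<Sum>a\<le>n. tensor (eop h a v) (eop h (n - a) w) p)"
proof (induction n rule: less_induct)
  case (less n)
  interpret t: op_family "tensor_op h" by (rule op_family_tensor_op)
  show ?case
  proof (cases "n = 0")
    case False
    have "eop (tensor_op h) n (tensor v w) (i, j)
        = (\<Sum>a\<le>n. tensor (eop h a v) (eop h (n - a) w) (i, j))" for i j
    proof -
      define V where "V a b = h a (eop h b v) i" for a b
      define W where "W a b = h a (eop h b w) j" for a b
      define X where "X = (\<lambda>k. \<Sum>b\<le>n - k. \<Sum>a\<le>k. V a b * W (k - a) (n - k - b))"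
      have "tensor_op h k (eop (tensor_op h) (n - k) (tensor v w)) (i, j) = X k" if "k \<in> {1..n}" for k
      proof -
        have "tensor_op h k (eop (tensor_op h) (n - k) (tensor v w))
            = tensor_op h k (\<lambda>p. \<Sum>a\<le>n - k. 1 * tensor (eop h a v) (eop h (n - k - a) w) p)"
          using less[of "n - k"] that by simp
        then have "tensor_op h k (eop (tensor_op h) (n - k) (tensor v w)) (i, j)
            = tensor_op h k (\<lambda>p. \<Sum>a\<le>n - k. 1 * tensor (eop h a v) (eop h (n - k - a) w) p) (i, j)"
          by simp
        also have "\<dots> = X k"
          by (subst t.op_sum, simp only: tensor_op_tensor) (simp add: tensor_def X_def V_def W_def)
        finally show ?thesis .
      qed
      then have lhs: "eop (tensor_op h) n (tensor v w) (i, j) = (\<Sum>k\<in>{1..n}. (-1) ^ (k - 1) * X k)"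
        using False by (simp add: eop_pos)
      have sgn: "(-1) ^ a * ((-1) ^ (b - a) * z) = (-1) ^ b * z" if "a \<le> b" for a b :: nat and z :: int
        using that by (simp add: mult.assoc[symmetric] flip: power_add)
      have "(\<Sum>k\<le>n. (-1) ^ k * X k)
          = (\<Sum>(k, b, a)\<in>Sigma {..n} (\<lambda>k. {..n - k} \<times> {..k}). (-1) ^ k * (V a b * W (k - a) (n - k - b)))"
        by (simp add: X_def sum_distrib_left sum.Sigma case_prod_unfold)
      also have "\<dots> = (\<Sum>(s, a, c)\<in>Sigma {..n} (\<lambda>s. {..s} \<times> {..n - s}).
          ((-1) ^ a * V a (s - a)) * ((-1) ^ c * W c (n - s - c)))"
        by (rule sum.reindex_bij_witness
            [where i = "\<lambda>(s, a, c). (a + c, s - a, a)" and j = "\<lambda>(k, b, a). (a + b, a, k - a)"])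
          (auto simp: sgn mult_ac add_ac)
      also have "\<dots> = (\<Sum>s\<le>n. (\<Sum>a\<le>s. (-1) ^ a * V a (s - a)) * (\<Sum>c\<le>n - s. (-1) ^ c * W c (n - s - c)))"
        by (simp add: sum_product sum.Sigma)
      also have "\<dots> = 0"
      proof (intro sum.neutral ballI)
        fix s assume "s \<in> {..n}"
        show "(\<Sum>a\<le>s. (-1) ^ a * V a (s - a)) * (\<Sum>c\<le>n - s. (-1) ^ c * W c (n - s - c)) = 0"
          using False eop_relation[of s v i] eop_relation[of "n - s" w j]
          by (cases "s = 0") (auto simp: V_def W_def)
      qed
      \<comment> \<open>\<open>X 0\<close> is the claimed right-hand side, since only
        \<open>a = 0\<close> occurs in it.\<close>
      finally have "X 0 = - (\<Sum>k\<in>{1..n}. (-1) ^ k * X k)"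
        by (simp add: atMost_atLeast0 sum.atLeast_Suc_atMost)
      also have "\<dots> = (\<Sum>k\<in>{1..n}. (-1) ^ (k - 1) * X k)"
        unfolding sum_negf[symmetric] by (intro sum.cong refl) (auto simp: power_eq_if)
      finally show ?thesis
        by (subst lhs) (simp add: X_def V_def W_def tensor_def)
    qed
    then show ?thesis by auto
  qed simp
qed

end

section \<open>Symmetric functions and partitions\<close>

definition shape :: "nat multiset \<Rightarrow> nat multiset" where
  "shape M = image_mset (count M) (mset_set (set_mset M))"

definition count_list_upto :: "nat \<Rightarrow> nat multiset \<Rightarrow> nat list" where
  "count_list_upto n M = map (count M) [1..<Suc n]"

definition sym_of :: "(nat multiset \<Rightarrow> int) \<Rightarrow> series" where
  "sym_of F = (\<lambda>M. if 0 \<in># M then 0 else F (shape M))"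

text \<open>For symmetric \<open>p\<close> the chosen monomial is immaterial. A multiset containing
  0 is not an exponent partition and gets the default value 0.\<close>

definition part_fun :: "series \<Rightarrow> nat multiset \<Rightarrow> int" where
  "part_fun p \<nu> = (if 0 \<in># \<nu> then 0 else p (SOME M. 0 \<notin># M \<and> shape M = \<nu>))"

lemma zero_notin_shape [simp]: "0 \<notin># shape M"
  by (auto simp: shape_def simp flip: count_greater_zero_iff)

lemma sum_mset_shape: "sum_mset (shape M) = size M"
  by (simp add: shape_def size_multiset_overloaded_eq sum_unfold_sum_mset)

lemma size_shape: "size (shape M) = card (set_mset M)"
  by (simp add: shape_def)

lemma shape_image:
  assumes "inj f"
  shows "shape (image_mset f M) = shape M"
proof -
  have "count (image_mset f M) (f x) = count M x" for x
  proof -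
    have "f -` {f x} \<inter> set_mset M = {x} \<inter> set_mset M"
      using assms by (auto dest: injD)
    then show ?thesis
      by (cases "x \<in># M") (auto simp: count_image_mset count_eq_zero_iff)
  qed
  moreover have "mset_set (f ` set_mset M) = image_mset f (mset_set (set_mset M))"
    using assms by (simp add: image_mset_mset_set inj_on_subset)
  ultimately show ?thesis
    by (simp add: shape_def multiset.map_comp comp_def)
qed

lemma shape_superset:
  assumes "finite A" "set_mset M \<subseteq> A"
  shows "image_mset (count M) (mset_set A) = shape M + replicate_mset (card (A - set_mset M)) 0"
proof -
  have "mset_set A = mset_set (set_mset M) + mset_set (A - set_mset M)"
    using assms by (metis Diff_disjoint Diff_partition finite_Diff finite_set_mset mset_set_Union)
  moreover have "image_mset (count M) (mset_set (A - set_mset M))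
      = image_mset (\<lambda>_. 0) (mset_set (A - set_mset M))"
    by (intro image_mset_cong) (use assms in \<open>auto simp: count_eq_zero_iff\<close>)
  ultimately show ?thesis
    by (simp add: shape_def image_mset_const_eq)
qed

lemma length_count_list_upto [simp]: "length (count_list_upto n M) = n"
  by (simp add: count_list_upto_def del: upt_Suc)

lemma mset_count_list_upto: "mset (count_list_upto n M) = image_mset (count M) (mset_set {1..n})"
proof -
  have "mset [1..<Suc n] = mset_set {1..n}"
    by (metis atLeastLessThanSuc_atLeastAtMost mset_upt)
  then show ?thesis unfolding count_list_upto_def by (metis mset_map)
qed

lemma mset_filter_count_list_upto:
  assumes "set_mset M \<subseteq> {1..n}"
  shows "mset (filter (\<lambda>k. k \<noteq> 0) (count_list_upto n M)) = shape M"
proof -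
  have "filter_mset (\<lambda>k. k \<noteq> 0) (shape M) = shape M"
    by (auto simp: filter_mset_eq_conv intro!: gr0I)
  then show ?thesis
    by (simp only: mset_filter mset_count_list_upto shape_superset[OF finite_atLeastAtMost assms]
        filter_union_mset) simp
qed

text \<open>On the union of the two supports both exponent functions have the same multiset of
  values, since padding adds equally many zeros to the common exponent partition. A permutation
  matching them there is extended by the identity.\<close>

lemma shape_eq_permutes:
  assumes "0 \<notin># M" "0 \<notin># N" "shape M = shape N"
  obtains \<pi> where "\<pi> permutes {1..}" "image_mset \<pi> M = N"
proof -
  define A where "A = set_mset M \<union> set_mset N"
  have "card (set_mset M) = card (set_mset N)"
    using assms(3) by (metis size_shape)
  moreover have "card (A - set_mset M) = card A - card (set_mset M)"
      "card (A - set_mset N) = card A - card (set_mset N)"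
    by (auto simp: A_def intro!: card_Diff_subset)
  ultimately have "image_mset (count M) (mset_set A) = image_mset (count N) (mset_set A)"
    using assms(3) by (subst (1 2) shape_superset) (auto simp: A_def)
  then obtain \<pi> where \<pi>: "\<pi> permutes A" "\<forall>x\<in>A. count M x = count N (\<pi> x)"
    using image_mset_eq_implies_permutes[of A "count M" "count N"] by (auto simp: A_def)
  have "count M x = count N (\<pi> x)" for x
  proof (cases "x \<in> A")
    case False
    then have "\<pi> x = x" using \<pi>(1) by (simp add: permutes_not_in)
    then show ?thesis using False by (simp add: A_def not_in_iff)
  qed (use \<pi> in auto)
  then have cnt: "count M (inv_into UNIV \<pi> y) = count N y" for y
    using permutes_inverses(1)[OF \<pi>(1)] by metis
  have "image_mset \<pi> M = N"
  proof (rule multiset_eqI)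
    fix y
    have "\<pi> -` {y} = {inv_into UNIV \<pi> y}"
      using permutes_inverses[OF \<pi>(1)] by auto
    then show "count (image_mset \<pi> M) y = count N y"
      by (cases "inv_into UNIV \<pi> y \<in># M") (auto simp: count_image_mset cnt[symmetric] count_eq_zero_iff)
  qed
  moreover have "\<pi> permutes {1..}"
    by (rule permutes_subset[OF \<pi>(1)]) (use assms(1,2) in \<open>auto simp: A_def Suc_le_eq intro!: gr0I\<close>)
  ultimately show ?thesis using that by blast
qed

section \<open>Monomials with prescribed exponents\<close>

definition of_count_list :: "nat list \<Rightarrow> nat multiset" where
  "of_count_list ks = (\<Sum>i<length ks. replicate_mset (ks ! i) (Suc i))"

lemma count_of_count_list:
  "count (of_count_list ks) i = (if 1 \<le> i \<and> i \<le> length ks then ks ! (i - 1) else 0)"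
proof -
  have "count (of_count_list ks) i = (\<Sum>j<length ks. if j = i - 1 \<and> 1 \<le> i then ks ! j else 0)"
    unfolding of_count_list_def count_sum by (intro sum.cong) auto
  also have "\<dots> = (if 1 \<le> i \<and> i \<le> length ks then ks ! (i - 1) else 0)"
    by (cases "1 \<le> i") auto
  finally show ?thesis .
qed

lemma set_of_count_list: "set_mset (of_count_list ks) \<subseteq> {1..length ks}"
  by (auto simp: count_of_count_list simp flip: count_greater_zero_iff split: if_splits)

lemma count_list_upto_of_count_list: "length ks = n \<Longrightarrow> count_list_upto n (of_count_list ks) = ks"
  by (auto simp: count_list_upto_def count_of_count_list intro!: nth_equalityI simp del: upt_Suc)

lemma count_list_upto_inject:
  assumes "count_list_upto n M = count_list_upto n N" "set_mset M \<subseteq> {1..n}" "set_mset N \<subseteq> {1..n}"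
  shows "M = N"
proof (rule multiset_eqI)
  fix x
  show "count M x = count N x"
  proof (cases "x \<in> {1..n}")
    case True
    then show ?thesis using assms(1) by (auto simp: count_list_upto_def simp del: upt_Suc)
  next
    case False
    then show ?thesis using assms(2,3) by (metis not_in_iff subsetD)
  qed
qed

lemma shape_of_count_list: "shape (of_count_list ks) = mset (filter (\<lambda>k. k \<noteq> 0) ks)"
  using mset_filter_count_list_upto[OF set_of_count_list] by (simp add: count_list_upto_of_count_list)

lemma ex_shape:
  assumes "0 \<notin># \<nu>"
  shows "\<exists>M. 0 \<notin># M \<and> shape M = \<nu>"
proof -
  obtain ks where ks: "mset ks = \<nu>" using ex_mset by blast
  then have "filter (\<lambda>k. k \<noteq> 0) ks = ks" using assms by (auto simp: filter_id_conv intro!: gr0I)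
  then show ?thesis
    using ks set_of_count_list[of ks] by (intro exI[of _ "of_count_list ks"]) (auto simp: shape_of_count_list)
qed

lemma part_fun_sym_of: "0 \<notin># \<nu> \<Longrightarrow> part_fun (sym_of F) \<nu> = F \<nu>"
  using someI_ex[OF ex_shape[of \<nu>]] by (auto simp: part_fun_def sym_of_def)

lemma part_fun_shape:
  assumes "symmetric_function p" "0 \<notin># M"
  shows "part_fun p (shape M) = p M"
proof -
  have "0 \<notin># (SOME N. 0 \<notin># N \<and> shape N = shape M) \<and> shape (SOME N. 0 \<notin># N \<and> shape N = shape M) = shape M"
    by (rule someI_ex) (use assms(2) in auto)
  then obtain \<pi> where "\<pi> permutes {1..}" "image_mset \<pi> M = (SOME N. 0 \<notin># N \<and> shape N = shape M)"
    using shape_eq_permutes[OF assms(2)] by metis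
  then show ?thesis
    using assms(1) unfolding part_fun_def symmetric_function_def by (metis zero_notin_shape)
qed

lemma zero_in_image_permutes:
  fixes \<pi> :: "nat \<Rightarrow> nat"
  assumes "\<pi> permutes {1..}"
  shows "0 \<in># image_mset \<pi> M \<longleftrightarrow> 0 \<in># M"
proof -
  have "\<pi> 0 = 0" by (rule permutes_not_in[OF assms]) simp
  then have "0 = \<pi> x \<longleftrightarrow> x = 0" for x using permutes_inj[OF assms] by (metis injD)
  then show ?thesis unfolding set_image_mset image_iff by metis
qed

lemma symmetric_function_sym_of:
  assumes "\<And>\<nu>. F \<nu> \<noteq> 0 \<Longrightarrow> sum_mset \<nu> \<le> d"
  shows "symmetric_function (sym_of F)"
  unfolding symmetric_function_def
proof (intro conjI allI impI exI)
  fix M show "sym_of F M \<noteq> 0 \<Longrightarrow> size M \<le> d"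
    using assms[of "shape M"] by (auto simp: sym_of_def sum_mset_shape split: if_splits)
qed (simp_all add: sym_of_def shape_image permutes_inj zero_in_image_permutes del: One_nat_def set_image_mset)

lemma part_fun_bounded:
  assumes "symmetric_function p"
  obtains d where "\<And>\<nu>. part_fun p \<nu> \<noteq> 0 \<Longrightarrow> sum_mset \<nu> \<le> d"
proof -
  obtain d where d: "\<And>M. p M \<noteq> 0 \<Longrightarrow> size M \<le> d"
    using assms by (auto simp: symmetric_function_def)
  have "sum_mset \<nu> \<le> d" if "part_fun p \<nu> \<noteq> 0" for \<nu>
  proof -
    have "0 \<notin># \<nu>" using that by (auto simp: part_fun_def)
    then obtain M where "0 \<notin># M" "shape M = \<nu>" using ex_shape by blast
    then show ?thesis using that part_fun_shape[OF assms] d sum_mset_shape by metis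
  qed
  then show ?thesis using that by blast
qed

section \<open>The involution on functions of partitions\<close>

definition part_op :: "nat \<Rightarrow> (nat multiset \<Rightarrow> int) \<Rightarrow> nat multiset \<Rightarrow> int" where
  "part_op k F = (\<lambda>\<nu>. if k = 0 then F \<nu> else F (add_mset k \<nu>))"

interpretation part: op_family part_op
  by standard (auto simp: part_op_def)

interpretation epart: op_family "eop part_op"
  by (rule part.op_family_eop)

lemma fold_part_op: "fold part_op ks F \<nu> = F (mset (filter (\<lambda>k. k \<noteq> 0) ks) + \<nu>)"
  by (induction ks arbitrary: F \<nu>) (auto simp: part_op_def)

lemma eop_part_op_commute: "eop part_op m (eop part_op n F) = eop part_op n (eop part_op m F)"
  by (intro eop_commute part.op_family_axioms) (auto simp: part_op_def add_mset_commute)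

text \<open>In terms of the Hall inner product this is the pairing with the product of the
  elementary functions of the parts of \<nu>. Sorting merely picks an order for commuting
  operators.\<close>

definition omega_part :: "(nat multiset \<Rightarrow> int) \<Rightarrow> nat multiset \<Rightarrow> int" where
  "omega_part F \<nu> = fold (eop part_op) (sorted_list_of_multiset \<nu>) F {#}"

lemma omega_part_mset:
  "omega_part F (mset (filter (\<lambda>k. k \<noteq> 0) ks)) = fold (eop part_op) ks F {#}"
  unfolding omega_part_def
  by (subst epart.fold_nonzero[of _ ks]) (auto simp: eop_part_op_commute simp flip: mset_filter)

lemma omega_part_shape:
  "set_mset M \<subseteq> {1..n} \<Longrightarrow> omega_part F (shape M) = fold (eop part_op) (count_list_upto n M) F {#}"
  by (metis omega_part_mset mset_filter_count_list_upto)

lemma omega_part_cong: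
  assumes "\<And>\<nu>. 0 \<notin># \<nu> \<Longrightarrow> F \<nu> = G \<nu>"
  shows "omega_part F = omega_part G"
proof
  fix \<nu>
  show "omega_part F \<nu> = omega_part G \<nu>"
    unfolding omega_part_def
    by (rule part.fold_eop_transfer[OF part.op_family_axioms]) (auto simp: fold_part_op intro!: assms)
qed

lemma omega_part_bounded:
  assumes "\<And>\<nu>. F \<nu> \<noteq> 0 \<Longrightarrow> sum_mset \<nu> \<le> d" "omega_part F \<nu> \<noteq> 0"
  shows "sum_mset \<nu> \<le> d"
proof -
  \<comment> \<open>The bound is an integer because each operator lowers it, possibly below zero,
    and a negative bound says that the function vanishes. A nonzero value at \<open>{#}\<close>
    forces the final bound to be nonnegative.\<close>
  define B :: "int \<Rightarrow> (nat multiset \<Rightarrow> int) \<Rightarrow> bool"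
    where "B = (\<lambda>d F. \<forall>\<nu>. F \<nu> \<noteq> 0 \<longrightarrow> int (sum_mset \<nu>) \<le> d)"
  have part: "B (d - int k) (part_op k F)" if "B d F" for d k F
    using that unfolding B_def part_op_def by (auto split: if_splits)
  have eop: "B (d - int n) (eop part_op n F)" if "B d F" for d n F
    using that
  proof (induction n rule: less_induct)
    case (less n)
    show ?case
    proof (cases "n = 0")
      case False
      have b: "B (d - int (n - k) - int k) (part_op k (eop part_op (n - k) F))" if "k \<in> {1..n}" for k
        by (intro part less.IH less.prems) (use that in auto)
      have "int (sum_mset \<nu>) \<le> d - int n" if "eop part_op n F \<nu> \<noteq> 0" for \<nu>
      proof -
        have "\<exists>k\<in>{1..n}. part_op k (eop part_op (n - k) F) \<nu> \<noteq> 0"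
          by (rule ccontr) (use that False in \<open>simp add: eop_pos\<close>)
        then show ?thesis using b by (fastforce simp: B_def)
      qed
      then show ?thesis by (simp add: B_def)
    qed (use less in simp)
  qed
  have "B (d - int (sum_list ks)) (fold (eop part_op) ks F)" if "B d F" for d ks F
    using that
  proof (induction ks arbitrary: d F)
    case (Cons k ks)
    show ?case using Cons.IH[OF eop[OF Cons.prems, of k]] by (simp add: diff_diff_eq)
  qed simp
  then have "B (int d - int (sum_list (sorted_list_of_multiset \<nu>))) (fold (eop part_op) (sorted_list_of_multiset \<nu>) F)"
    by this (use assms(1) in \<open>unfold B_def of_nat_le_iff, blast\<close>)
  then have "int (sum_list (sorted_list_of_multiset \<nu>)) \<le> int d"
    using assms(2) unfolding B_def omega_part_def by force
  then show ?thesis by (metis mset_sorted_list_of_multiset of_nat_le_iff sum_mset_sum_list)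
qed

definition omega_map :: "series \<Rightarrow> series" where
  "omega_map p = sym_of (omega_part (part_fun p))"

lemma omega_map_sym_of: "omega_map (sym_of F) = sym_of (omega_part F)"
  unfolding omega_map_def by (subst omega_part_cong[of _ F]) (simp_all add: part_fun_sym_of)

lemma symmetric_function_omega_map:
  assumes "symmetric_function p"
  shows "symmetric_function (omega_map p)"
proof -
  obtain d where "\<And>\<nu>. part_fun p \<nu> \<noteq> 0 \<Longrightarrow> sum_mset \<nu> \<le> d"
    using part_fun_bounded[OF assms] by blast
  then have "omega_part (part_fun p) \<nu> \<noteq> 0 \<Longrightarrow> sum_mset \<nu> \<le> d" for \<nu>
    by (rule omega_part_bounded)
  then show ?thesis
    unfolding omega_map_def by (rule symmetric_function_sym_of)
qed

lemma sum_subset_mset_le_lists: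
  assumes "set_mset M \<subseteq> {1..n}"
  shows "(\<Sum>N | N \<subseteq># M. f (count_list_upto n N) (count_list_upto n (M - N)))
    = (\<Sum>as\<in>le_lists (count_list_upto n M). f as (map2 (-) (count_list_upto n M) as))"
proof (rule sum.reindex_bij_witness[where i = of_count_list and j = "count_list_upto n"])
  fix N assume "N \<in> {N. N \<subseteq># M}"
  then have N: "N \<subseteq># M" by simp
  then have "set_mset N \<subseteq> {1..n}" using assms set_mset_mono by blast
  moreover have "set_mset (of_count_list (count_list_upto n N)) \<subseteq> {1..n}"
    using set_of_count_list[of "count_list_upto n N"] by (simp add: length_count_list_upto)
  ultimately show "of_count_list (count_list_upto n N) = N"
    by (intro count_list_upto_inject[of n]) (simp_all add: count_list_upto_of_count_list length_count_list_upto)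
  show "count_list_upto n N \<in> le_lists (count_list_upto n M)"
    using N by (auto simp: le_lists_altdef count_list_upto_def list_all2_conv_all_nth subseteq_mset_def simp del: upt_Suc)
  have "count_list_upto n (M - N) = map2 (-) (count_list_upto n M) (count_list_upto n N)"
    by (auto simp: count_list_upto_def intro!: nth_equalityI simp del: upt_Suc)
  then show "f (count_list_upto n N) (map2 (-) (count_list_upto n M) (count_list_upto n N))
      = f (count_list_upto n N) (count_list_upto n (M - N))" by simp
next
  fix as assume "as \<in> le_lists (count_list_upto n M)"
  then have *: "length as = n" "\<And>i. i < n \<Longrightarrow> as ! i \<le> count M (Suc i)"
    by (auto simp: le_lists_altdef count_list_upto_def list_all2_conv_all_nth simp del: upt_Suc)
  then show "count_list_upto n (of_count_list as) = as"
    by (simp add: count_list_upto_of_count_list)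
  have "as ! (i - 1) \<le> count M i" if "1 \<le> i" "i \<le> n" for i
    using *(2)[of "i - 1"] that by simp
  then show "of_count_list as \<in> {N. N \<subseteq># M}"
    by (auto simp: subseteq_mset_def count_of_count_list *(1))
qed

lemma series_mult_zero:
  assumes "\<And>N. 0 \<in># N \<Longrightarrow> p N = 0" "\<And>N. 0 \<in># N \<Longrightarrow> q N = 0" "0 \<in># M"
  shows "series_mult p q M = 0"
  unfolding series_mult_def
proof (intro sum.neutral ballI)
  fix N assume "N \<in> {N. N \<subseteq># M}"
  then have "0 \<in># N + (M - N)" using assms(3) by simp
  then show "p N * q (M - N) = 0" using assms(1,2) unfolding set_mset_union by auto
qed

text \<open>Multiplication of series means that words in \<open>part_op\<close> on the function of a
  product agree with words in \<open>tensor_op part_op\<close> on a tensor product. The agreement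
  passes to the derived operators, where the coproduct rule for \<open>eop\<close> turns it into the
  product formula for the images.\<close>

lemma omega_map_mult:
  assumes p: "symmetric_function p" and q: "symmetric_function q" and pq: "symmetric_function (series_mult p q)"
  shows "omega_map (series_mult p q) = series_mult (omega_map p) (omega_map q)"
proof
  fix M
  interpret t: op_family "tensor_op part_op" by (rule part.op_family_tensor_op)
  let ?T = "tensor (part_fun p) (part_fun q)"
  \<comment> \<open>With \<open>ks\<close> read as the exponents of a monomial, this is the formula
    for its coefficient in the product.\<close>
  have h: "fold part_op ks (part_fun (series_mult p q)) {#} = fold (tensor_op part_op) ks ?T ({#}, {#})" for ks
  proof -
    define n where "n = length ks"
    define K where "K = of_count_list ks"
    have K: "set_mset K \<subseteq> {1..n}" "0 \<notin># K" "count_list_upto n K = ks"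
      using set_of_count_list[of ks] by (auto simp: K_def n_def count_list_upto_of_count_list)
    have val: "r N = fold part_op (count_list_upto n N) (part_fun r) {#}"
      if "symmetric_function r" "N \<subseteq># K" for r N
    proof -
      have "set_mset N \<subseteq> {1..n}" using that(2) K(1) set_mset_mono by blast
      then have "set_mset N \<subseteq> {1..n}" "0 \<notin># N" by auto
      then show ?thesis
        using part_fun_shape[OF that(1), of N]
        by (subst fold_part_op, subst mset_filter_count_list_upto) auto
    qed
    have "fold part_op ks (part_fun (series_mult p q)) {#} = series_mult p q K"
      using val[OF pq, of K] K(3) by simp
    also have "\<dots> = (\<Sum>N | N \<subseteq># K. fold part_op (count_list_upto n N) (part_fun p) {#}
        * fold part_op (count_list_upto n (K - N)) (part_fun q) {#})"
      unfolding series_mult_def by (intro sum.cong refl arg_cong2[of _ _ _ _ "(*)"] val p q) auto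
    also have "\<dots> = fold (tensor_op part_op) ks ?T ({#}, {#})"
      by (subst sum_subset_mset_le_lists[OF K(1)], subst fold_tensor[OF t.op_family_axioms part.tensor_op_tensor])
        (simp add: K(3))
    finally show ?thesis .
  qed
  show "omega_map (series_mult p q) M = series_mult (omega_map p) (omega_map q) M"
  proof (cases "0 \<in># M")
    case True
    have "\<And>N. 0 \<in># N \<Longrightarrow> omega_map p N = 0" "\<And>N. 0 \<in># N \<Longrightarrow> omega_map q N = 0"
      by (auto simp: omega_map_def sym_of_def)
    from series_mult_zero[OF this True] show ?thesis using True by (simp add: omega_map_def sym_of_def)
  next
    case False
    \<comment> \<open>The inserted 0 covers the constant monomial.\<close>
    define n where "n = Max (insert 0 (set_mset M))"
    have M: "set_mset M \<subseteq> {1..n}"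
      using False by (auto simp: n_def Suc_le_eq intro!: gr0I)
    have val: "omega_map r N = fold (eop part_op) (count_list_upto n N) (part_fun r) {#}" if "N \<subseteq># M" for r N
    proof -
      have "set_mset N \<subseteq> {1..n}" using that M set_mset_mono by blast
      then show ?thesis by (auto simp: omega_map_def sym_of_def omega_part_shape)
    qed
    have "omega_map (series_mult p q) M = fold (eop part_op) (count_list_upto n M) (part_fun (series_mult p q)) {#}"
      by (rule val) simp
    also have "\<dots> = fold (eop (tensor_op part_op)) (count_list_upto n M) ?T ({#}, {#})"
      by (intro part.fold_eop_transfer t.op_family_axioms h)
    also have "\<dots> = (\<Sum>N | N \<subseteq># M. fold (eop part_op) (count_list_upto n N) (part_fun p) {#}
        * fold (eop part_op) (count_list_upto n (M - N)) (part_fun q) {#})"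
      by (subst sum_subset_mset_le_lists[OF M], subst fold_tensor[OF t.op_family_eop part.eop_tensor_op]) simp
    also have "\<dots> = series_mult (omega_map p) (omega_map q) M"
      unfolding series_mult_def by (intro sum.cong refl) (simp add: val)
    finally show ?thesis .
  qed
qed

section \<open>The involution\<close>

text \<open>The exponent partitions of an elementary function. The degree is an integer so that
  lowering it below zero gives the zero function without a case distinction; the same holds for
  \<open>of_size\<close> and complete homogeneous functions.\<close>

definition ones :: "int \<Rightarrow> nat multiset \<Rightarrow> int" where
  "ones k \<nu> = of_bool (int (size \<nu>) = k \<and> (\<forall>x\<in>#\<nu>. x = 1))"

definition of_size :: "int \<Rightarrow> nat multiset \<Rightarrow> int" where
  "of_size k \<nu> = of_bool (int (sum_mset \<nu>) = k)"

lemma sum_mset_ones: "(\<forall>x\<in>#\<nu>. x = (1 :: nat)) \<Longrightarrow> sum_mset \<nu> = size \<nu>"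
  by (induction \<nu>) auto

lemma elementary_eq_sym_of: "elementary k = sym_of (ones (int k))"
proof
  fix M
  have "(\<forall>x\<in>#shape M. x = 1) \<longleftrightarrow> (\<forall>i. count M i \<le> 1)"
  proof
    assume *: "\<forall>x\<in>#shape M. x = 1"
    show "\<forall>i. count M i \<le> 1"
    proof
      fix i show "count M i \<le> 1"
        using * by (cases "i \<in># M") (auto simp: shape_def not_in_iff)
    qed
  next
    assume *: "\<forall>i. count M i \<le> 1"
    show "\<forall>x\<in>#shape M. x = 1"
    proof
      fix x assume "x \<in># shape M"
      then obtain i where "i \<in># M" "x = count M i" by (auto simp: shape_def)
      then show "x = 1" using *[rule_format, of i] using count_greater_zero_iff[of M i] by linarith
    qed
  qed
  then show "elementary k M = sym_of (ones (int k)) M"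
    using sum_mset_shape[of M] sum_mset_ones[of "shape M"]
    unfolding elementary_def sym_of_def ones_def of_nat_eq_iff by auto
qed

lemma complete_homogeneous_eq_sym_of: "complete_homogeneous k = sym_of (of_size (int k))"
  unfolding fun_eq_iff complete_homogeneous_def sym_of_def of_size_def sum_mset_shape by auto

lemma symmetric_function_elementary: "symmetric_function (elementary k)"
  unfolding elementary_eq_sym_of
  by (rule symmetric_function_sym_of[of _ k]) (auto simp: ones_def sum_mset_ones split: if_splits)

lemma elementary_0: "elementary 0 = series_one"
  by (auto simp: elementary_def series_one_def fun_eq_iff)

lemma complete_homogeneous_0: "complete_homogeneous 0 = series_one"
  by (auto simp: complete_homogeneous_def series_one_def fun_eq_iff)

lemma part_op_ones: "part_op j (ones k) = (if j \<le> 1 then ones (k - int j) else (\<lambda>_. 0))"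
  by (auto simp: part_op_def ones_def fun_eq_iff)

text \<open>Only \<open>j = 1\<close> contributes to the recursion, since \<open>part_op j\<close>
  kills these functions for larger \<open>j\<close>.\<close>

lemma eop_ones: "eop part_op n (ones k) = ones (k - int n)"
proof (induction n rule: less_induct)
  case (less n)
  show ?case
  proof (cases "n = 0")
    case False
    have "eop part_op n (ones k) \<nu> = ones (k - int n) \<nu>" for \<nu>
    proof -
      have "(-1) ^ (j - 1) * part_op j (eop part_op (n - j) (ones k)) \<nu>
          = (if j = 1 then ones (k - int n) \<nu> else 0)" if "j \<in> {1..n}" for j
        using less[of "n - j"] that by (auto simp: part_op_ones of_nat_diff)
      then have "eop part_op n (ones k) \<nu> = (\<Sum>j\<in>{1..n}. if j = 1 then ones (k - int n) \<nu> else 0)"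
        using False by (simp add: eop_pos)
      then show ?thesis using False by simp
    qed
    then show ?thesis by blast
  qed simp
qed

lemma part_op_of_size: "part_op j (of_size k) = of_size (k - int j)"
  by (auto simp: part_op_def of_size_def fun_eq_iff simp del: of_nat_sum_mset)

text \<open>Each \<open>part_op j\<close> merely lowers the degree. For \<open>n\<close> at least 2,
  only the terms \<open>j = n\<close> and \<open>j = n - 1\<close> survive the induction hypothesis,
  and they cancel.\<close>

lemma eop_of_size: "eop part_op n (of_size k) = (if n \<le> 1 then of_size (k - int n) else (\<lambda>_. 0))"
proof (induction n rule: less_induct)
  case (less n)
  consider "n = 0" | "n = 1" | "n \<ge> 2" by linarith
  then show ?case
  proof cases
    case 3
    have "eop part_op n (of_size k) \<nu> = 0" for \<nu>
    proof -
      have "(-1) ^ (j - 1) * part_op j (eop part_op (n - j) (of_size k)) \<nu>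
          = (if j = n then (-1) ^ (n - 1) * of_size (k - int n) \<nu> else 0)
          + (if j = n - 1 then (-1) ^ (n - 2) * of_size (k - int n) \<nu> else 0)" if "j \<in> {1..n}" for j
      proof -
        consider "j = n" | "j = n - 1" | "j < n - 1" using \<open>j \<in> {1..n}\<close> by force
        then show ?thesis
        proof cases
          case 2
          then have "n - j = 1" "int (n - j) + int j = int n" "j - 1 = n - 2" using 3 by auto
          then show ?thesis
            using less[of "n - j"] that 2 3 by (simp add: part_op_of_size algebra_simps)
        next
          case 3
          then have "\<not> n - j \<le> 1" by linarith
          then have "eop part_op (n - j) (of_size k) = (\<lambda>_. 0)" using less[of "n - j"] that by simp
          then show ?thesis using 3 by (simp add: part_op_def)
        qed (use that 3 in \<open>simp add: part_op_of_size\<close>)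
      qed
      then have "eop part_op n (of_size k) \<nu>
          = (\<Sum>j\<in>{1..n}. (if j = n then (-1) ^ (n - 1) * of_size (k - int n) \<nu> else 0)
          + (if j = n - 1 then (-1) ^ (n - 2) * of_size (k - int n) \<nu> else 0))"
        using 3 by (simp add: eop_pos)
      also have "\<dots> = (-1) ^ (n - 1) * of_size (k - int n) \<nu> + (-1) ^ (n - 2) * of_size (k - int n) \<nu>"
        using 3 by (simp add: sum.distrib)
      also have "\<dots> = 0"
        using 3 by (cases n; cases "n - 1") auto
      finally show ?thesis .
    qed
    then show ?thesis using 3 by auto
  qed (auto simp: eop_pos part_op_of_size)
qed

lemma omega_map_elementary: "omega_map (elementary k) = complete_homogeneous k"
proof -
  have fold: "fold (eop part_op) ks (ones d) = ones (d - int (sum_list ks))" for ks d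
    by (induction ks arbitrary: d) (auto simp: eop_ones diff_diff_eq)
  have "omega_part (ones k) = of_size k"
  proof
    fix \<nu> :: "nat multiset"
    have "sum_list (sorted_list_of_multiset \<nu>) = sum_mset \<nu>"
      by (metis mset_sorted_list_of_multiset sum_mset_sum_list)
    then show "omega_part (ones k) \<nu> = of_size k \<nu>"
      unfolding omega_part_def fold ones_def of_size_def by auto
  qed
  then show ?thesis
    by (simp add: elementary_eq_sym_of complete_homogeneous_eq_sym_of omega_map_sym_of)
qed

lemma omega_map_complete_homogeneous: "omega_map (complete_homogeneous k) = elementary k"
proof -
  have fold0: "fold (eop part_op) ks (\<lambda>_. 0) = (\<lambda>_. 0)" for ks
    using epart.fold_op_sum[of ks "\<lambda>_. 0" "\<lambda>_. \<lambda>_. 0" "{} :: nat set"] by simp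
  have fold: "fold (eop part_op) ks (of_size d)
      = (if \<forall>k\<in>set ks. k \<le> 1 then of_size (d - int (sum_list ks)) else (\<lambda>_. 0))" for ks d
    by (induction ks arbitrary: d) (auto simp: eop_of_size fold0 diff_diff_eq)
  have "omega_part (of_size k) \<nu> = ones k \<nu>" if "0 \<notin># \<nu>" for \<nu>
  proof -
    have "sum_list (sorted_list_of_multiset \<nu>) = sum_mset \<nu>"
      by (metis mset_sorted_list_of_multiset sum_mset_sum_list)
    moreover have "x \<le> 1 \<longleftrightarrow> x = 1" if "x \<in># \<nu>" for x
      using \<open>0 \<notin># \<nu>\<close> that by (cases x) auto
    then have "(\<forall>x\<in>#\<nu>. x \<le> 1) \<longleftrightarrow> (\<forall>x\<in>#\<nu>. x = 1)" by blast
    ultimately show ?thesis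
      unfolding omega_part_def fold ones_def of_size_def set_sorted_list_of_multiset
      using sum_mset_ones[of \<nu>] by auto
  qed
  then have "sym_of (omega_part (of_size k)) = sym_of (ones k)"
    by (auto simp: sym_of_def)
  then show ?thesis
    by (simp add: elementary_eq_sym_of complete_homogeneous_eq_sym_of omega_map_sym_of)
qed

lemma omega_map_add: "omega_map (\<lambda>M. p M + q M) = (\<lambda>M. omega_map p M + omega_map q M)"
proof -
  have fold: "fold (eop part_op) ks (\<lambda>\<nu>. F \<nu> + G \<nu>)
      = (\<lambda>\<nu>. fold (eop part_op) ks F \<nu> + fold (eop part_op) ks G \<nu>)" for ks F G
    by (induction ks arbitrary: F G) (simp_all add: epart.op_add)
  have "part_fun (\<lambda>M. p M + q M) = (\<lambda>\<nu>. part_fun p \<nu> + part_fun q \<nu>)"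
    by (auto simp: part_fun_def)
  then show ?thesis
    by (auto simp: omega_map_def sym_of_def omega_part_def fold)
qed

section \<open>Closure of Sym under the ring operations\<close>

lemma symmetric_function_add:
  assumes "symmetric_function p" "symmetric_function q"
  shows "symmetric_function (\<lambda>M. p M + q M)"
proof -
  obtain d e where "\<And>M. p M \<noteq> 0 \<Longrightarrow> size M \<le> d" "\<And>M. q M \<noteq> 0 \<Longrightarrow> size M \<le> e"
    using assms by (auto simp: symmetric_function_def)
  then have "\<forall>M. p M + q M \<noteq> 0 \<longrightarrow> size M \<le> max d e"
    by (metis add_0 le_max_iff_disj)
  then show ?thesis using assms unfolding symmetric_function_def by auto
qed

lemma symmetric_function_uminus: "symmetric_function p \<Longrightarrow> symmetric_function (\<lambda>M. - p M)"
  by (auto simp: symmetric_function_def)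

lemma symmetric_function_mult:
  assumes "symmetric_function p" "symmetric_function q"
  shows "symmetric_function (series_mult p q)"
  unfolding symmetric_function_def
proof (intro conjI allI impI)
  fix M :: "nat multiset"
  assume "0 \<in># M"
  then show "series_mult p q M = 0"
    by (intro series_mult_zero) (use assms in \<open>auto simp: symmetric_function_def\<close>)
next
  obtain d e where *: "\<And>M. p M \<noteq> 0 \<Longrightarrow> size M \<le> d" "\<And>M. q M \<noteq> 0 \<Longrightarrow> size M \<le> e"
    using assms by (auto simp: symmetric_function_def)
  have "size M \<le> d + e" if nz: "series_mult p q M \<noteq> 0" for M
  proof -
    obtain N where "N \<subseteq># M" "p N \<noteq> 0" "q (M - N) \<noteq> 0"
      using sum.not_neutral_contains_not_neutral[OF nz[unfolded series_mult_def]] by auto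
    then show ?thesis using *[of N] *(2)[of "M - N"] size_Diff_submset[of N M] size_mset_mono[of N M] by simp
  qed
  then show "\<exists>d. \<forall>M. series_mult p q M \<noteq> 0 \<longrightarrow> size M \<le> d" by blast
next
  fix \<pi> :: "nat \<Rightarrow> nat" and M assume \<pi>: "\<pi> permutes {1..}"
  have p: "p (image_mset \<pi> N) = p N" and q: "q (image_mset \<pi> N) = q N" for N
    using assms \<pi> by (auto simp: symmetric_function_def)
  let ?\<sigma> = "inv_into UNIV \<pi>"
  have \<sigma>: "image_mset ?\<sigma> (image_mset \<pi> N) = N" "image_mset \<pi> (image_mset ?\<sigma> N) = N" for N
    using permutes_inverses[OF \<pi>] by (simp_all add: multiset.map_comp comp_def)
  show "series_mult p q (image_mset \<pi> M) = series_mult p q M"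
    unfolding series_mult_def
  proof (rule sum.reindex_bij_witness[where i = "image_mset \<pi>" and j = "image_mset ?\<sigma>"])
    fix N assume "N \<in> {N. N \<subseteq># image_mset \<pi> M}"
    then have N: "N \<subseteq># image_mset \<pi> M" by simp
    then show "image_mset ?\<sigma> N \<in> {N. N \<subseteq># M}"
      using image_mset_subseteq_mono[OF N, of ?\<sigma>] by (simp only: \<sigma>) simp
    then have "image_mset \<pi> (M - image_mset ?\<sigma> N) = image_mset \<pi> M - N"
      by (subst image_mset_Diff) (auto simp only: \<sigma> mem_Collect_eq)
    then show "p (image_mset ?\<sigma> N) * q (M - image_mset ?\<sigma> N) = p N * q (image_mset \<pi> M - N)"
      using p[of "image_mset ?\<sigma> N"] q[of "M - image_mset ?\<sigma> N"] by (simp only: \<sigma>)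
  qed (auto simp only: \<sigma> mem_Collect_eq intro: image_mset_subseteq_mono)
qed

section \<open>Generation of Sym by the elementary functions\<close>

lemma shape_plus_mset_set:
  assumes "finite S" "set_mset N \<subseteq> S"
  shows "shape (N + mset_set S)
    = image_mset Suc (shape N) + replicate_mset (card S - card (set_mset N)) 1"
proof -
  have set: "set_mset (N + mset_set S) = S" using assms by auto
  have "shape (N + mset_set S) = image_mset (\<lambda>x. Suc (count N x)) (mset_set S)"
    unfolding shape_def set by (intro image_mset_cong) (use assms in auto)
  also have "\<dots> = image_mset Suc (image_mset (count N) (mset_set S))"
    by (simp add: multiset.map_comp comp_def)
  also have "\<dots> = image_mset Suc (shape N) + replicate_mset (card S - card (set_mset N)) 1"
    by (subst shape_superset[OF assms]) (use assms in \<open>simp add: card_Diff_subset\<close>)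
  finally show ?thesis .
qed

lemma finite_subset_mset: "finite {N. N \<subseteq># M}"
proof (induction M)
  case (add x M)
  have "{N. N \<subseteq># add_mset x M} \<subseteq> {N. N \<subseteq># M} \<union> add_mset x ` {N. N \<subseteq># M}"
  proof
    fix N assume N: "N \<in> {N. N \<subseteq># add_mset x M}"
    show "N \<in> {N. N \<subseteq># M} \<union> add_mset x ` {N. N \<subseteq># M}"
    proof (cases "x \<in># N")
      case True
      then obtain K where "N = add_mset x K" by (metis insert_DiffM)
      then show ?thesis using N by auto
    next
      case False
      have "count N y \<le> count M y" for y
        using mset_subset_eq_count[of N "add_mset x M" y] N False by (cases "y = x") (auto simp: not_in_iff)
      then have "N \<subseteq># M" by (rule mset_subset_eqI)
      then show ?thesis by simp
    qed
  qed
  then show ?case using add finite_subset by blast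
qed simp

text \<open>A monomial with exactly \<open>k\<close> variables has only one squarefree divisor of
  degree \<open>k\<close>, the product of all its variables.\<close>

lemma series_mult_elementary_supp:
  assumes "0 \<notin># M" "card (set_mset M) = k"
  shows "series_mult (elementary k) q M = q (M - mset_set (set_mset M))"
proof -
  let ?S = "mset_set (set_mset M)"
  have "?S \<subseteq># M"
    by (auto simp: subseteq_mset_def count_mset_set' Suc_le_eq)
  have uniq: "N = ?S" if "N \<subseteq># M" "elementary k N \<noteq> 0" for N
  proof -
    have N: "size N = k" "\<forall>i. count N i \<le> 1" using that(2) by (auto simp: elementary_def split: if_splits)
    have "N = mset_set (set_mset N)"
    proof (rule multiset_eqI)
      fix x show "count N x = count (mset_set (set_mset N)) x"
        using N(2)[rule_format, of x] by (cases "x \<in># N") (auto simp: count_mset_set' not_in_iff le_Suc_eq simp flip: count_greater_zero_iff)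
    qed
    then have "card (set_mset N) = k" using N(1) by (metis size_mset_set)
    then have "set_mset N = set_mset M"
      using assms(2) set_mset_mono[OF that(1)] by (metis card_subset_eq finite_set_mset)
    then show ?thesis using \<open>N = mset_set (set_mset N)\<close> by simp
  qed
  have "series_mult (elementary k) q M = (\<Sum>N\<in>{?S}. elementary k N * q (M - N))"
    unfolding series_mult_def
    by (rule sum.mono_neutral_right) (use uniq \<open>?S \<subseteq># M\<close> in \<open>auto simp: finite_subset_mset\<close>)
  also have "\<dots> = elementary k ?S * q (M - ?S)"
    by (subst sum.insert) simp_all
  finally have "series_mult (elementary k) q M = elementary k ?S * q (M - ?S)" .
  moreover have "elementary k ?S = 1"
    using assms by (auto simp: elementary_def count_mset_set')
  ultimately show ?thesis by (simp only: mult_1)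
qed

text \<open>
  If every monomial of \<open>p\<close> has at least \<open>k\<close> distinct variables, let \<open>q\<close> collect the monomials with
  exactly \<open>k\<close> of them, each divided by the product of its variables, and extend this symmetrically.
  Then \<open>p - e\<^sub>k q\<close> has only monomials with more than \<open>k\<close> distinct variables.
\<close>

lemma symmetric_function_induct [consumes 1, case_names one uminus add mult elementary]:
  assumes "symmetric_function p"
    and one: "P series_one"
    and uminus: "\<And>p. symmetric_function p \<Longrightarrow> P p \<Longrightarrow> P (\<lambda>M. - p M)"
    and add: "\<And>p q. symmetric_function p \<Longrightarrow> symmetric_function q \<Longrightarrow> P p \<Longrightarrow> P q \<Longrightarrow> P (\<lambda>M. p M + q M)"
    and mult: "\<And>p q. symmetric_function p \<Longrightarrow> symmetric_function q \<Longrightarrow> P p \<Longrightarrow> P q \<Longrightarrow> P (series_mult p q)"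
    and elementary: "\<And>k. P (elementary k)"
  shows "P p"
proof -
  have sym_one: "symmetric_function series_one"
    by (metis symmetric_function_elementary elementary_0)
  have const: "symmetric_function (\<lambda>M. c * series_one M) \<and> P (\<lambda>M. c * series_one M)" for c :: int
  proof (induction c rule: int_induct[where k = 1])
    case base
    show ?case using one sym_one by simp
  next
    case (step1 i)
    then show ?case
      using symmetric_function_add[of _ series_one] add[of _ series_one] one sym_one
      by (simp add: distrib_right)
  next
    case (step2 i)
    then show ?case
      using symmetric_function_add[of _ "\<lambda>M. - series_one M"] add[of _ "\<lambda>M. - series_one M"]
        uminus[OF sym_one one] symmetric_function_uminus[OF sym_one]
      by (simp add: left_diff_distrib)
  qed
  \<comment> \<open>The outer induction is on the degree bound, the inner one on
    \<open>Suc d - k\<close>. The quotient \<open>q\<close> has degree at most \<open>d - k\<close>,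
    which is smaller than \<open>d\<close> only for positive \<open>k\<close>; for
    \<open>k = 0\<close> the constant term is removed instead. For \<open>k > d\<close> nothing is
    left, as a monomial has no more variables than its degree.\<close>
  have main: "P p" if "symmetric_function p" "\<And>M. p M \<noteq> 0 \<Longrightarrow> size M \<le> d \<and> k \<le> card (set_mset M)" for d k p
    using that
  proof (induction d arbitrary: k p rule: less_induct)
    case (less d)
    note IH = less.IH
    show ?case using less.prems
    proof (induction "Suc d - k" arbitrary: k p rule: less_induct)
      case (less k)
      note p = less.prems(1) and supp = less.prems(2)
      have card_le: "card (set_mset M) \<le> size M" for M :: "nat multiset"
      proof -
        have "card (set_mset M) = (\<Sum>x\<in>set_mset M. 1)" by simp
        also have "\<dots> \<le> (\<Sum>x\<in>set_mset M. count M x)" by (intro sum_mono) (simp add: Suc_le_eq)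
        finally show ?thesis by (simp add: size_multiset_overloaded_eq)
      qed
      consider "k > d" | "k = 0" | "k \<ge> 1" "k \<le> d" by linarith
      then show ?case
      proof cases
        case 1
        have "p M = 0" for M
          using supp[of M] card_le[of M] 1 by force
        then have "p = (\<lambda>M. 0)" by blast
        then show ?thesis using const[of 0] by simp
      next
        case 2
        let ?p' = "\<lambda>M. p M + (- p {#}) * series_one M"
        have "symmetric_function ?p'" by (intro symmetric_function_add p) (use const in blast)
        moreover have "size M \<le> d \<and> 1 \<le> card (set_mset M)" if "?p' M \<noteq> 0" for M
        proof -
          have "M \<noteq> {#}" using that by (auto simp: series_one_def)
          moreover have "p M \<noteq> 0" using that calculation by (auto simp: series_one_def)
          ultimately show ?thesis using supp[of M] by (simp add: Suc_le_eq card_gt_0_iff)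
        qed
        ultimately have "P ?p'" by (intro less.hyps[of 1]) (use 2 in auto)
        have "P (\<lambda>M. ?p' M + p {#} * series_one M)"
          by (rule add) (use \<open>symmetric_function ?p'\<close> \<open>P ?p'\<close> const in blast)+
        then show ?thesis by simp
      next
        case 3
        \<comment> \<open>Multiplying back by the \<open>k\<close> variables adds 1 to each
          exponent; the variables that had exponent 0 supply the additional parts 1.\<close>
        define F where "F \<nu> = (if size \<nu> \<le> k
          then part_fun p (image_mset Suc \<nu> + replicate_mset (k - size \<nu>) 1) else 0)" for \<nu>
        have Fd: "sum_mset \<nu> \<le> d - k" if "F \<nu> \<noteq> 0" for \<nu>
        proof -
          let ?\<kappa> = "image_mset Suc \<nu> + replicate_mset (k - size \<nu>) 1"
          have le: "size \<nu> \<le> k" and nz: "part_fun p ?\<kappa> \<noteq> 0"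
            using that by (auto simp: F_def split: if_splits)
          then have "0 \<notin># ?\<kappa>" by (auto simp: part_fun_def)
          then obtain M where M: "0 \<notin># M" "shape M = ?\<kappa>" using ex_shape by blast
          then have "p M \<noteq> 0" using nz part_fun_shape[OF p] by metis
          then have "sum_mset ?\<kappa> \<le> d" using supp[of M] M(2) by (metis sum_mset_shape)
          moreover have "sum_mset (image_mset Suc \<nu>) = sum_mset \<nu> + size \<nu>" by (induction \<nu>) auto
          ultimately show ?thesis using le by (simp add: sum_mset_replicate_mset)
        qed
        define q where "q = sym_of F"
        have q: "symmetric_function q"
          unfolding q_def using Fd by (rule symmetric_function_sym_of)
        have qd: "size M \<le> d - k" if "q M \<noteq> 0" for M
          using Fd[of "shape M"] that by (auto simp: q_def sym_of_def sum_mset_shape split: if_splits)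
        have "P q" by (rule IH[of "d - k" _ 0]) (use q qd 3 in auto)
        let ?eq = "series_mult (elementary k) q"
        have eq: "symmetric_function ?eq" "P ?eq"
          by (auto intro!: symmetric_function_mult symmetric_function_elementary mult elementary q \<open>P q\<close>)
        let ?p' = "\<lambda>M. p M + - ?eq M"
        have p': "symmetric_function ?p'"
          by (intro symmetric_function_add symmetric_function_uminus eq p)
        have "size M \<le> d \<and> Suc k \<le> card (set_mset M)" if nz: "?p' M \<noteq> 0" for M
        proof -
          have M0: "0 \<notin># M" using nz p' by (auto simp: symmetric_function_def)
          have eq_nz: "size M \<le> d \<and> k \<le> card (set_mset M)" if eq_nz: "?eq M \<noteq> 0"
          proof -
            obtain N where N: "N \<subseteq># M" "elementary k N \<noteq> 0" "q (M - N) \<noteq> 0"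
              using sum.not_neutral_contains_not_neutral[OF eq_nz[unfolded series_mult_def]] by auto
            then have "size N = k" "\<forall>x\<in>#shape N. x = 1"
              by (auto simp: elementary_eq_sym_of sym_of_def ones_def elementary_def split: if_splits)
               (auto simp: sum_mset_ones simp flip: sum_mset_shape)
            then have "card (set_mset N) = k" by (metis sum_mset_ones sum_mset_shape size_shape)
            then have "k \<le> card (set_mset M)" using N(1) by (metis card_mono finite_set_mset set_mset_mono)
            moreover have "size M \<le> d"
              using qd[OF N(3)] N(1) 3 \<open>size N = k\<close> size_Diff_submset[of N M] by auto
            ultimately show ?thesis by blast
          qed
          have "size M \<le> d \<and> k \<le> card (set_mset M)"
            using nz supp[of M] eq_nz by fastforce
          moreover have "card (set_mset M) \<noteq> k"
          proof
            assume card: "card (set_mset M) = k"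
            define N where "N = M - mset_set (set_mset M)"
            have "mset_set (set_mset M) \<subseteq># M"
              by (auto simp: subseteq_mset_def count_mset_set' Suc_le_eq)
            then have NM: "N + mset_set (set_mset M) = M" by (simp add: N_def)
            have sub: "set_mset N \<subseteq> set_mset M" by (auto simp: N_def dest: in_diffD)
            have "size (shape N) \<le> k" unfolding size_shape using sub card by (metis card_mono finite_set_mset)
            then have "q N = part_fun p (shape M)"
              using shape_plus_mset_set[OF _ sub] M0 sub card NM
              by (auto simp: q_def sym_of_def F_def size_shape)
            then show False
              using nz series_mult_elementary_supp[OF M0 card, of q] part_fun_shape[OF p M0] N_def by simp
          qed
          ultimately show ?thesis by simp
        qed
        then have "P ?p'" by (intro less.hyps[of "Suc k"] p') (use 3 in auto)
        then have "P (\<lambda>M. ?p' M + ?eq M)" by (rule add[OF p' eq(1) _ eq(2)])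
        then show ?thesis by simp
      qed
    qed
  qed
  obtain d where "\<And>M. p M \<noteq> 0 \<Longrightarrow> size M \<le> d"
    using assms(1) by (auto simp: symmetric_function_def)
  then show ?thesis using main[OF assms(1), of d 0] by auto
qed

lemma Sym_hom_eqI:
  assumes f: "f \<in> ring_hom Sym Sym" and f': "f' \<in> ring_hom Sym Sym"
    and e: "\<And>k. f (elementary k) = f' (elementary k)"
    and p: "p \<in> carrier Sym"
  shows "f p = f' p"
proof -
  have "symmetric_function p" using p by (simp add: Sym_def)
  then show ?thesis
  proof (induction p rule: symmetric_function_induct)
    case one
    show ?case using ring_hom_one[OF f] ring_hom_one[OF f'] by (simp add: Sym_def)
  next
    case (uminus p)
    \<comment> \<open>\<open>ring_hom\<close> speaks of sums, products and one, and
      \<open>Sym\<close> has not been shown to be a ring; compatibility with negation comes from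
      additivity and cancellation of integer coefficients.\<close>
    have neg: "g (\<lambda>M. - p M) M = - g p M" if g: "g \<in> ring_hom Sym Sym" for g M
    proof -
      have add: "g (\<lambda>M. p M + q M) = (\<lambda>M. g p M + g q M)"
        if "symmetric_function p" "symmetric_function q" for p q
        using ring_hom_add[OF g, of p q] that by (simp add: Sym_def)
      have zero: "symmetric_function (\<lambda>M. 0)" by (simp add: symmetric_function_def)
      have "g (\<lambda>M. 0) M = 0" using fun_cong[OF add[OF zero zero], of M] by simp
      then show ?thesis
        using fun_cong[OF add[OF uminus(1) symmetric_function_uminus[OF uminus(1)]], of M] by simp
    qed
    show ?case by (rule ext) (simp only: neg[OF f] neg[OF f'] uminus(2))
  next
    case (add p q)
    then show ?case using ring_hom_add[OF f, of p q] ring_hom_add[OF f', of p q] by (simp add: Sym_def)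
  next
    case (mult p q)
    then show ?case using ring_hom_mult[OF f, of p q] ring_hom_mult[OF f', of p q] by (simp add: Sym_def)
  qed (rule e)
qed

lemma omega_map_ring_hom: "omega_map \<in> ring_hom Sym Sym"
proof (rule ring_hom_memI)
  show "omega_map \<one>\<^bsub>Sym\<^esub> = \<one>\<^bsub>Sym\<^esub>"
    using omega_map_elementary[of 0] by (simp add: elementary_0 complete_homogeneous_0 Sym_def)
qed (auto simp: Sym_def symmetric_function_omega_map omega_map_mult symmetric_function_mult omega_map_add)

text \<open>That \<open>omega_map\<close> is an involution is not computed on partitions: its square
  and the identity are homomorphisms agreeing on elementary functions, because it exchanges these
  with the complete homogeneous ones.\<close>

lemma omega_eq: "omega = restrict omega_map (carrier Sym)"
  unfolding omega_def
proof (rule the_equality)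
  have e: "elementary k \<in> carrier Sym" for k
    by (simp add: Sym_def symmetric_function_elementary)
  have c: "omega_map p \<in> carrier Sym" if "p \<in> carrier Sym" for p
    using that by (rule ring_hom_closed[OF omega_map_ring_hom])
  have id: "(\<lambda>p. p) \<in> ring_hom Sym Sym"
    by (simp add: ring_hom_def)
  have "(\<lambda>p. omega_map (omega_map p)) \<in> ring_hom Sym Sym"
    using omega_map_ring_hom by (auto simp: ring_hom_def Pi_iff)
  then have "omega_map (omega_map p) = p" if "p \<in> carrier Sym" for p
    by (rule Sym_hom_eqI[OF _ id _ that]) (simp add: omega_map_elementary omega_map_complete_homogeneous)
  moreover have closed: "x \<otimes>\<^bsub>Sym\<^esub> y \<in> carrier Sym" "x \<oplus>\<^bsub>Sym\<^esub> y \<in> carrier Sym" "\<one>\<^bsub>Sym\<^esub> \<in> carrier Sym"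
    if "x \<in> carrier Sym" "y \<in> carrier Sym" for x y
    using that symmetric_function_elementary[of 0]
    by (auto simp: Sym_def symmetric_function_mult symmetric_function_add elementary_0)
  then have "restrict omega_map (carrier Sym) \<in> ring_hom Sym Sym"
    using omega_map_ring_hom e[of 0] unfolding ring_hom_def by (auto simp: Pi_iff)
  ultimately show "restrict omega_map (carrier Sym) \<in> extensional (carrier Sym) \<and>
      restrict omega_map (carrier Sym) \<in> ring_hom Sym Sym \<and>
      (\<forall>p\<in>carrier Sym. restrict omega_map (carrier Sym) (restrict omega_map (carrier Sym) p) = p) \<and>
      (\<forall>k. restrict omega_map (carrier Sym) (elementary k) = complete_homogeneous k)"
    using c e by (auto simp: omega_map_elementary)
next
  fix f assume f: "f \<in> extensional (carrier Sym) \<and> f \<in> ring_hom Sym Sym \<and>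
      (\<forall>p\<in>carrier Sym. f (f p) = p) \<and> (\<forall>k. f (elementary k) = complete_homogeneous k)"
  show "f = restrict omega_map (carrier Sym)"
  proof (rule extensionalityI[of _ "carrier Sym"])
    fix p assume "p \<in> carrier Sym"
    then show "f p = restrict omega_map (carrier Sym) p"
      using Sym_hom_eqI[of f omega_map p] f omega_map_ring_hom by (simp add: omega_map_elementary)
  qed (use f in auto)
qed

section \<open>Strips\<close>

typedef young = "{\<nu>. is_partition \<nu>}" morphisms rows Young
  by (intro exI[of _ "\<lambda>_. 0"]) (auto simp: is_partition_def antimono_def)

instantiation young :: order
begin
definition "\<nu> \<le> \<kappa> \<longleftrightarrow> rows \<nu> \<le> rows \<kappa>"
definition "\<nu> < \<kappa> \<longleftrightarrow> rows \<nu> < rows \<kappa>"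
instance
  by standard (auto simp: less_eq_young_def less_young_def less_le_not_le simp flip: rows_inject)
end

lemma le_youngD: "\<nu> \<le> \<kappa> \<Longrightarrow> rows \<nu> r \<le> rows \<kappa> r"
  by (simp add: less_eq_young_def le_fun_def)

lemma rows_antimono: "r \<le> r' \<Longrightarrow> rows \<nu> r' \<le> rows \<nu> r"
  using rows[of \<nu>] by (auto simp: is_partition_def antimono_def)

lemma rows_eventually_0: "\<exists>n. \<forall>r\<ge>n. rows \<nu> r = 0"
proof -
  have "finite {r. rows \<nu> r \<noteq> 0}" using rows[of \<nu>] by (simp add: is_partition_def)
  then obtain n where "{r. rows \<nu> r \<noteq> 0} \<subseteq> {..<n}" using finite_nat_iff_bounded by blast
  then show ?thesis by (intro exI[of _ n]) force
qed

abbreviation skew :: "young \<Rightarrow> young \<Rightarrow> (nat \<times> nat) set" where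
  "skew \<kappa> \<nu> \<equiv> skew_diagram (rows \<kappa>) (rows \<nu>)"

lemma finite_skew [simp]: "finite (skew \<kappa> \<nu>)"
proof -
  obtain n where n: "\<forall>r\<ge>n. rows \<kappa> r = 0" using rows_eventually_0 by blast
  have "skew \<kappa> \<nu> \<subseteq> {..<n} \<times> {..<rows \<kappa> 0}"
  proof (clarsimp simp: skew_diagram_def)
    fix r c assume "c < rows \<kappa> r"
    then show "r < n \<and> c < rows \<kappa> 0"
      using n rows_antimono[of 0 r \<kappa>] by (cases "r < n") auto
  qed
  then show ?thesis by (rule finite_subset) auto
qed

lemma skew_empty_iff: "\<nu> \<le> \<kappa> \<Longrightarrow> skew \<kappa> \<nu> = {} \<longleftrightarrow> \<kappa> = \<nu>"
proof
  assume *: "\<nu> \<le> \<kappa>" "skew \<kappa> \<nu> = {}"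
  have "rows \<kappa> r = rows \<nu> r" for r
  proof -
    have "(r, rows \<nu> r) \<notin> skew \<kappa> \<nu>" using *(2) by blast
    then show ?thesis using le_youngD[OF *(1), of r] by (auto simp: skew_diagram_def)
  qed
  then show "\<kappa> = \<nu>" by (metis ext rows_inject)
qed (auto simp: skew_diagram_def)

section \<open>Summation over shapes row by row\<close>

definition fun_box :: "(nat \<Rightarrow> nat set) \<Rightarrow> nat \<Rightarrow> (nat \<Rightarrow> nat) set" where
  "fun_box X n = {\<nu>. (\<forall>r<n. \<nu> r \<in> X r) \<and> (\<forall>r\<ge>n. \<nu> r = 0)}"

lemma fun_box_0: "fun_box X 0 = {\<lambda>_. 0}"
  by (auto simp: fun_box_def)

lemma fun_box_Suc: "bij_betw (\<lambda>(\<nu>, k). \<nu>(n := k)) (fun_box X n \<times> X n) (fun_box X (Suc n))"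
  by (rule bij_betwI[where g = "\<lambda>\<nu>. (\<nu>(n := 0), \<nu> n)"])
    (auto simp: fun_box_def fun_eq_iff less_Suc_eq)

lemma finite_fun_box: "(\<And>r. finite (X r)) \<Longrightarrow> finite (fun_box X n)"
proof (induction n)
  case (Suc n)
  then show ?case using bij_betw_finite[OF fun_box_Suc[of n X]] by auto
qed (simp add: fun_box_0)

text \<open>The row above row 0 is given the length \<open>L\<close>, which is chosen larger than all other rows.\<close>

definition prev_row :: "nat \<Rightarrow> (nat \<Rightarrow> nat) \<Rightarrow> nat \<Rightarrow> nat" where
  "prev_row L \<nu> r = (case r of 0 \<Rightarrow> L | Suc r \<Rightarrow> \<nu> r)"

text \<open>A transfer-matrix sum: each weight couples a row only to the row above it, and
  \<open>F\<close> keeps the dependence on the last row, so that rows can be summed out from the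
  bottom.\<close>

definition transfer_sum ::
    "nat \<Rightarrow> (nat \<Rightarrow> nat set) \<Rightarrow> (nat \<Rightarrow> nat \<Rightarrow> nat \<Rightarrow> int) \<Rightarrow> nat \<Rightarrow> (nat \<Rightarrow> int) \<Rightarrow> int" where
  "transfer_sum L X t n F = (\<Sum>\<nu>\<in>fun_box X n. (\<Prod>r<n. t r (prev_row L \<nu> r) (\<nu> r)) * F (prev_row L \<nu> n))"

lemma transfer_sum_0: "transfer_sum L X t 0 F = F L"
  by (simp add: transfer_sum_def fun_box_0 prev_row_def)

lemma transfer_sum_Suc:
  "transfer_sum L X t (Suc n) F = transfer_sum L X t n (\<lambda>p. \<Sum>k\<in>X n. t n p k * F k)"
proof -
  have "transfer_sum L X t (Suc n) F = (\<Sum>(\<nu>, k)\<in>fun_box X n \<times> X n.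
      (\<Prod>r<n. t r (prev_row L \<nu> r) (\<nu> r)) * (t n (prev_row L \<nu> n) k * F k))"
    unfolding transfer_sum_def
  proof (subst sum.reindex_bij_betw[OF fun_box_Suc, symmetric], intro sum.cong refl, clarify)
    fix \<nu> k
    have "prev_row L (\<nu>(n := k)) r = prev_row L \<nu> r" if "r \<le> n" for r
      using that by (auto simp: prev_row_def split: nat.splits)
    moreover have "prev_row L (\<nu>(n := k)) (Suc n) = k" by (simp add: prev_row_def)
    ultimately show "(\<Prod>r<Suc n. t r (prev_row L (\<nu>(n := k)) r) ((\<nu>(n := k)) r)) * F (prev_row L (\<nu>(n := k)) (Suc n))
        = (\<Prod>r<n. t r (prev_row L \<nu> r) (\<nu> r)) * (t n (prev_row L \<nu> n) k * F k)"
      by simp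
  qed
  also have "\<dots> = transfer_sum L X t n (\<lambda>p. \<Sum>k\<in>X n. t n p k * F k)"
    by (simp add: transfer_sum_def sum_distrib_left sum.cartesian_product)
  finally show ?thesis .
qed

text \<open>The box of functions also contains some that are not weakly decreasing. In these a row
  is longer than the one above it, and its weight vanishes by the last assumption.\<close>

lemma sum_between_eq_transfer_sum:
  assumes n: "\<forall>r\<ge>n. rows \<kappa> r = 0" and L: "rows \<kappa> 0 < L" and "\<mu> \<le> \<kappa>"
    and f: "\<And>\<nu>. \<mu> \<le> \<nu> \<Longrightarrow> \<nu> \<le> \<kappa> \<Longrightarrow> f \<nu> = (\<Prod>r<n. t r (prev_row L (rows \<nu>) r) (rows \<nu> r))"
    and t: "\<And>r p k. k > p \<Longrightarrow> t r p k = 0"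
  shows "(\<Sum>\<nu> | \<mu> \<le> \<nu> \<and> \<nu> \<le> \<kappa>. f \<nu>) = transfer_sum L (\<lambda>r. {rows \<mu> r..rows \<kappa> r}) t n (\<lambda>_. 1)"
proof -
  let ?X = "\<lambda>r. {rows \<mu> r..rows \<kappa> r}"
  have \<mu>0: "rows \<mu> r = 0" if "r \<ge> n" for r using le_youngD[OF \<open>\<mu> \<le> \<kappa>\<close>, of r] n that by simp
  have img: "rows ` {\<nu>. \<mu> \<le> \<nu> \<and> \<nu> \<le> \<kappa>} \<subseteq> fun_box ?X n"
  proof clarify
    fix \<nu> assume *: "\<mu> \<le> \<nu>" "\<nu> \<le> \<kappa>"
    have "rows \<nu> r = 0" if "r \<ge> n" for r using le_youngD[OF *(2), of r] n that by simp
    then show "rows \<nu> \<in> fun_box ?X n" using le_youngD[OF *(1)] le_youngD[OF *(2)] by (auto simp: fun_box_def)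
  qed
  have zero: "(\<Prod>r<n. t r (prev_row L \<nu> r) (\<nu> r)) = 0"
    if "\<nu> \<in> fun_box ?X n - rows ` {\<nu>. \<mu> \<le> \<nu> \<and> \<nu> \<le> \<kappa>}" for \<nu>
  proof (rule ccontr)
    assume "(\<Prod>r<n. t r (prev_row L \<nu> r) (\<nu> r)) \<noteq> 0"
    then have "t r (prev_row L \<nu> r) (\<nu> r) \<noteq> 0" if "r < n" for r
      using that by (simp add: prod_zero_iff)
    then have le: "\<nu> r \<le> prev_row L \<nu> r" if "r < n" for r
      using t[of "prev_row L \<nu> r" "\<nu> r" r] that by (meson not_less)
    have box: "\<And>r. r < n \<Longrightarrow> rows \<mu> r \<le> \<nu> r \<and> \<nu> r \<le> rows \<kappa> r" "\<And>r. r \<ge> n \<Longrightarrow> \<nu> r = 0"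
      using that by (auto simp: fun_box_def)
    have "\<nu> (Suc r) \<le> \<nu> r" for r
      using le[of "Suc r"] box(2)[of "Suc r"] by (cases "Suc r < n") (auto simp: prev_row_def)
    then have "antimono \<nu>" by (simp add: antimono_iff_le_Suc)
    moreover have "r < n" if "\<nu> r \<noteq> 0" for r using box(2)[of r] that by linarith
    then have "finite {r. \<nu> r \<noteq> 0}"
      by (intro finite_subset[OF _ finite_lessThan[of n]]) auto
    ultimately have rows: "rows (Young \<nu>) = \<nu>" by (simp add: Young_inverse is_partition_def)
    have "rows \<mu> r \<le> \<nu> r \<and> \<nu> r \<le> rows \<kappa> r" for r
      using box[of r] \<mu>0[of r] n by (cases "r < n") auto
    then have "\<mu> \<le> Young \<nu>" "Young \<nu> \<le> \<kappa>" by (auto simp: less_eq_young_def rows le_fun_def)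
    then show False using that rows by (metis (mono_tags, lifting) DiffD2 image_eqI mem_Collect_eq)
  qed
  have "(\<Sum>\<nu> | \<mu> \<le> \<nu> \<and> \<nu> \<le> \<kappa>. f \<nu>)
      = (\<Sum>\<nu> | \<mu> \<le> \<nu> \<and> \<nu> \<le> \<kappa>. \<Prod>r<n. t r (prev_row L (rows \<nu>) r) (rows \<nu> r))"
    by (intro sum.cong refl f) auto
  also have "\<dots> = (\<Sum>\<nu>\<in>rows ` {\<nu>. \<mu> \<le> \<nu> \<and> \<nu> \<le> \<kappa>}. \<Prod>r<n. t r (prev_row L \<nu> r) (\<nu> r))"
    by (subst sum.reindex) (auto simp: inj_on_def rows_inject)
  also have "\<dots> = (\<Sum>\<nu>\<in>fun_box ?X n. \<Prod>r<n. t r (prev_row L \<nu> r) (\<nu> r))"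
    by (rule sum.mono_neutral_left) (use img zero finite_fun_box[of ?X] in auto)
  finally show ?thesis by (simp add: transfer_sum_def)
qed

lemma finite_young_le [simp]: "finite {\<nu>. \<nu> \<le> (\<kappa> :: young)}"
proof -
  obtain n where n: "\<forall>r\<ge>n. rows \<kappa> r = 0" using rows_eventually_0 by blast
  have "rows ` {\<nu>. \<nu> \<le> \<kappa>} \<subseteq> fun_box (\<lambda>r. {..rows \<kappa> r}) n"
  proof clarify
    fix \<nu> assume *: "\<nu> \<le> \<kappa>"
    have "rows \<nu> r = 0" if "r \<ge> n" for r using le_youngD[OF *, of r] n that by simp
    then show "rows \<nu> \<in> fun_box (\<lambda>r. {..rows \<kappa> r}) n" using le_youngD[OF *] by (auto simp: fun_box_def)
  qed
  then have "finite (rows ` {\<nu>. \<nu> \<le> \<kappa>})" by (rule finite_subset) (simp add: finite_fun_box)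
  then show ?thesis by (rule finite_imageD) (auto simp: inj_on_def rows_inject)
qed

lemma finite_young_between [simp]: "finite {\<nu>. \<mu> \<le> \<nu> \<and> \<nu> \<le> (\<kappa> :: young)}"
  by (rule finite_subset[OF _ finite_young_le[of \<kappa>]]) auto

section \<open>Counting columns and boxes of skew shapes\<close>

definition column_tops :: "(nat \<times> nat) set \<Rightarrow> (nat \<times> nat) set" where
  "column_tops S = {(r, c) \<in> S. \<forall>r'. r = Suc r' \<longrightarrow> (r', c) \<notin> S}"

definition column_convex :: "(nat \<times> nat) set \<Rightarrow> bool" where
  "column_convex S \<longleftrightarrow> (\<forall>r r' r'' c. (r, c) \<in> S \<longrightarrow> (r'', c) \<in> S \<longrightarrow> r \<le> r' \<longrightarrow> r' \<le> r'' \<longrightarrow> (r', c) \<in> S)"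

lemma column_convexD:
  "column_convex S \<Longrightarrow> (r, c) \<in> S \<Longrightarrow> (r'', c) \<in> S \<Longrightarrow> r \<le> r' \<Longrightarrow> r' \<le> r'' \<Longrightarrow> (r', c) \<in> S"
  unfolding column_convex_def by blast

text \<open>Each nonempty column is an interval and has one top. Unlike columns, tops can be counted
  row by row.\<close>

lemma card_column_tops:
  assumes "column_convex S"
  shows "card (column_tops S) = card (snd ` S)"
proof -
  have "inj_on snd (column_tops S)"
  proof (rule inj_onI, clarsimp)
    have *: "\<not> r < r'" if "(r, c) \<in> column_tops S" "(r', c) \<in> column_tops S" for r r' c
    proof
      assume "r < r'"
      then obtain s where s: "r' = Suc s" "r \<le> s" by (cases r') auto
      have "(r, c) \<in> S" "(r', c) \<in> S" using that by (auto simp: column_tops_def)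
      then have "(s, c) \<in> S" by (rule column_convexD[OF assms]) (simp_all add: s)
      then show False using that s by (auto simp: column_tops_def)
    qed
    fix r r' c assume "(r, c) \<in> column_tops S" "(r', c) \<in> column_tops S"
    then show "r = r'" using *[of r c r'] *[of r' c r] by simp
  qed
  moreover have "snd ` column_tops S = snd ` S"
  proof (intro equalityI subsetI)
    fix c assume "c \<in> snd ` S"
    then obtain r where "(r, c) \<in> S" by auto
    then have ex: "\<exists>r. (r, c) \<in> S" by blast
    define r0 where "r0 = (LEAST r. (r, c) \<in> S)"
    have "(r0, c) \<in> S" unfolding r0_def using ex by (rule LeastI_ex)
    moreover have "(r', c) \<notin> S" if "r0 = Suc r'" for r'
      using not_less_Least[of r' "\<lambda>r. (r, c) \<in> S"] that by (simp add: r0_def)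
    ultimately have "(r0, c) \<in> column_tops S" by (auto simp: column_tops_def)
    then show "c \<in> snd ` column_tops S" by force
  qed (auto simp: column_tops_def)
  ultimately show ?thesis by (metis card_image)
qed

lemma column_convex_skew: "column_convex (skew \<kappa> \<nu>)"
  unfolding column_convex_def
proof (clarsimp simp: skew_diagram_def)
  fix r r' r'' c assume "rows \<nu> r \<le> c" "c < rows \<kappa> r''" "r \<le> r'" "r' \<le> r''"
  then show "rows \<nu> r' \<le> c \<and> c < rows \<kappa> r'"
    using rows_antimono[of r r' \<nu>] rows_antimono[of r' r'' \<kappa>] by linarith
qed

context
  fixes \<kappa> \<nu> :: young and n L :: nat
  assumes le: "\<nu> \<le> \<kappa>" and n: "\<forall>r\<ge>n. rows \<kappa> r = 0" and L: "rows \<kappa> 0 < L"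
begin

text \<open>A box of row \<open>r\<close> is the top of its column iff the box above it belongs to
  \<nu>, that is, iff its column is less than \<open>prev_row L (rows \<nu>) r\<close>. In row 0 the
  bound \<open>L\<close> excludes nothing.\<close>

lemma columns_skew: "card (snd ` skew \<kappa> \<nu>) = (\<Sum>r<n. min (rows \<kappa> r) (prev_row L (rows \<nu>) r) - rows \<nu> r)"
proof -
  have "column_tops (skew \<kappa> \<nu>) = (SIGMA r:{..<n}. {rows \<nu> r..<min (rows \<kappa> r) (prev_row L (rows \<nu>) r)})"
  proof (intro equalityI subsetI)
    fix b assume b: "b \<in> column_tops (skew \<kappa> \<nu>)"
    obtain r c where rc: "b = (r, c)" by (cases b)
    have *: "rows \<nu> r \<le> c" "c < rows \<kappa> r" using b by (auto simp: rc column_tops_def skew_diagram_def)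
    then have "r < n" using n by (cases "r < n") auto
    moreover have "c < prev_row L (rows \<nu>) r"
    proof (cases r)
      case 0
      then show ?thesis using * L by (simp add: prev_row_def)
    next
      case (Suc r')
      then have "(r', c) \<notin> skew \<kappa> \<nu>" using b by (auto simp: rc column_tops_def)
      then show ?thesis using Suc * rows_antimono[of r' r \<kappa>] by (auto simp: prev_row_def skew_diagram_def)
    qed
    ultimately show "b \<in> (SIGMA r:{..<n}. {rows \<nu> r..<min (rows \<kappa> r) (prev_row L (rows \<nu>) r)})"
      using * by (simp add: rc)
  next
    fix b assume b: "b \<in> (SIGMA r:{..<n}. {rows \<nu> r..<min (rows \<kappa> r) (prev_row L (rows \<nu>) r)})"
    obtain r c where rc: "b = (r, c)" by (cases b)
    have *: "rows \<nu> r \<le> c" "c < rows \<kappa> r" "c < prev_row L (rows \<nu>) r" using b by (simp_all add: rc)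
    have "(r', c) \<notin> skew \<kappa> \<nu>" if "r = Suc r'" for r'
      using *(3) that by (simp add: prev_row_def skew_diagram_def)
    then show "b \<in> column_tops (skew \<kappa> \<nu>)"
      using * unfolding rc column_tops_def by (simp add: skew_diagram_def)
  qed
  then have "card (column_tops (skew \<kappa> \<nu>)) = (\<Sum>r<n. min (rows \<kappa> r) (prev_row L (rows \<nu>) r) - rows \<nu> r)"
    by simp
  then show ?thesis
    by (rule trans[OF card_column_tops[OF column_convex_skew, symmetric]])
qed

lemma card_skew: "card (skew \<kappa> \<nu>) = (\<Sum>r<n. rows \<kappa> r - rows \<nu> r)"
proof -
  have "r < n" if "c < rows \<kappa> r" for r c
  proof (rule ccontr)
    assume "\<not> r < n"
    then have "rows \<kappa> r = 0" using n by simp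
    then show False using that by simp
  qed
  then have "skew \<kappa> \<nu> = (SIGMA r:{..<n}. {rows \<nu> r..<rows \<kappa> r})"
    by (auto simp: skew_diagram_def)
  then show ?thesis by simp
qed

lemma inj_on_fst_skew: "inj_on fst (skew \<kappa> \<nu>) \<longleftrightarrow> (\<forall>r<n. rows \<kappa> r \<le> Suc (rows \<nu> r))"
proof
  assume inj: "inj_on fst (skew \<kappa> \<nu>)"
  show "\<forall>r<n. rows \<kappa> r \<le> Suc (rows \<nu> r)"
  proof (intro allI impI, rule ccontr)
    fix r assume "\<not> rows \<kappa> r \<le> Suc (rows \<nu> r)"
    then have "(r, rows \<nu> r) \<in> skew \<kappa> \<nu>" "(r, Suc (rows \<nu> r)) \<in> skew \<kappa> \<nu>"
      by (auto simp: skew_diagram_def)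
    then show False using inj_onD[OF inj, of "(r, rows \<nu> r)" "(r, Suc (rows \<nu> r))"] by simp
  qed
next
  assume *: "\<forall>r<n. rows \<kappa> r \<le> Suc (rows \<nu> r)"
  show "inj_on fst (skew \<kappa> \<nu>)"
  proof (rule inj_onI, clarsimp simp: skew_diagram_def)
    fix r c c' assume "rows \<nu> r \<le> c" "c < rows \<kappa> r" "rows \<nu> r \<le> c'" "c' < rows \<kappa> r"
    moreover have "rows \<kappa> r \<le> Suc (rows \<nu> r)" using * n by (cases "r < n") auto
    ultimately show "c = c'" by linarith
  qed
qed

end

text \<open>Injectivity of \<open>fst\<close> means at most one box per row, a vertical strip. The
  polynomial counts the ways to cut its columns into groups: the top box of a column must start a
  group, giving a factor \<open>x\<close>, and every other box may start one, giving
  \<open>1 + x\<close>.\<close>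

definition strip_poly :: "(nat \<times> nat) set \<Rightarrow> int poly" where
  "strip_poly S = (if inj_on fst S
     then monom 1 (card (snd ` S)) * [:1, 1:] ^ (card S - card (snd ` S)) else 0)"

text \<open>The factor of one row: \<open>m\<close> and \<open>k\<close> are its lengths in the
  inner and outer shape, and \<open>p\<close> is the length of the row above in the inner shape. An
  added box lies below another box of the strip exactly when \<open>p = m\<close>.\<close>

definition strip_row :: "int \<Rightarrow> nat \<Rightarrow> nat \<Rightarrow> nat \<Rightarrow> int" where
  "strip_row x p k m = (if k = m then 1 else if k = Suc m then (if p = m then 1 + x else x) else 0)"

lemma poly_strip_poly_skew:
  assumes le: "\<nu> \<le> \<kappa>" and n: "\<forall>r\<ge>n. rows \<kappa> r = 0" and L: "rows \<kappa> 0 < L"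
  shows "poly (strip_poly (skew \<kappa> \<nu>)) x = (\<Prod>r<n. strip_row x (prev_row L (rows \<nu>) r) (rows \<kappa> r) (rows \<nu> r))"
proof (cases "\<forall>r<n. rows \<kappa> r \<le> Suc (rows \<nu> r)")
  case False
  then obtain r where r: "r < n" "rows \<kappa> r > Suc (rows \<nu> r)" by (auto simp: not_le)
  then have "strip_row x (prev_row L (rows \<nu>) r) (rows \<kappa> r) (rows \<nu> r) = 0" by (simp add: strip_row_def)
  then have "(\<Prod>r<n. strip_row x (prev_row L (rows \<nu>) r) (rows \<kappa> r) (rows \<nu> r)) = 0"
    using r(1) by auto
  moreover have "\<not> inj_on fst (skew \<kappa> \<nu>)" unfolding inj_on_fst_skew[OF assms] by (rule False)
  ultimately show ?thesis unfolding strip_poly_def by (simp only: if_False poly_0)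
next
  case True
  let ?c = "\<lambda>r. min (rows \<kappa> r) (prev_row L (rows \<nu>) r) - rows \<nu> r"
  have diff: "card (skew \<kappa> \<nu>) - card (snd ` skew \<kappa> \<nu>) = (\<Sum>r<n. (rows \<kappa> r - rows \<nu> r) - ?c r)"
    unfolding columns_skew[OF assms] card_skew[OF assms] by (subst sum_subtractf_nat) auto
  have "inj_on fst (skew \<kappa> \<nu>)" unfolding inj_on_fst_skew[OF assms] by (rule True)
  then have "poly (strip_poly (skew \<kappa> \<nu>)) x = x ^ card (snd ` skew \<kappa> \<nu>)
      * (1 + x) ^ (card (skew \<kappa> \<nu>) - card (snd ` skew \<kappa> \<nu>))"
    by (simp add: strip_poly_def poly_monom)
  also have "\<dots> = (\<Prod>r<n. x ^ ?c r * (1 + x) ^ ((rows \<kappa> r - rows \<nu> r) - ?c r))"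
    by (simp only: diff) (simp only: columns_skew[OF assms] power_sum prod.distrib)
  also have "\<dots> = (\<Prod>r<n. strip_row x (prev_row L (rows \<nu>) r) (rows \<kappa> r) (rows \<nu> r))"
  proof (intro prod.cong refl)
    fix r assume "r \<in> {..<n}"
    then have "rows \<kappa> r = rows \<nu> r \<or> rows \<kappa> r = Suc (rows \<nu> r)"
      using True le_youngD[OF le, of r] by (auto simp: le_Suc_eq)
    moreover have "rows \<nu> r \<le> prev_row L (rows \<nu>) r"
      using L le_youngD[OF le, of 0] rows_antimono[of _ r \<nu>] by (auto simp: prev_row_def split: nat.splits)
    ultimately show "x ^ ?c r * (1 + x) ^ ((rows \<kappa> r - rows \<nu> r) - ?c r)
        = strip_row x (prev_row L (rows \<nu>) r) (rows \<kappa> r) (rows \<nu> r)"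
      by (auto simp: strip_row_def min_def le_Suc_eq)
  qed
  finally show ?thesis .
qed

lemma prev_row_rows_ge: "rows \<nu> 0 \<le> L \<Longrightarrow> rows \<nu> r \<le> prev_row L (rows \<nu>) r"
  using rows_antimono[of _ r \<nu>] by (auto simp: prev_row_def split: nat.splits)

lemma prev_row_mono: "\<nu> \<le> \<kappa> \<Longrightarrow> prev_row L (rows \<nu>) r \<le> prev_row L (rows \<kappa>) r"
  by (auto simp: prev_row_def le_youngD split: nat.splits)

lemma sum_two_terms:
  fixes f :: "nat \<Rightarrow> int"
  assumes "m < l" "\<And>k. k > Suc m \<Longrightarrow> f k = 0"
  shows "(\<Sum>k\<in>{m..l}. f k) = f m + f (Suc m)"
proof -
  have "(\<Sum>k\<in>{m..l}. f k) = (\<Sum>k\<in>{m, Suc m}. f k)"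
    by (rule sum.mono_neutral_right) (use assms in \<open>auto simp: le_Suc_eq intro!: assms(2)\<close>)
  then show ?thesis by simp
qed

text \<open>
  Sum out the rows of \<open>\<nu>\<close> from the bottom. A row contributes 0 or 1, independently of the row of \<open>\<nu>\<close>
  above it, and the topmost row where \<open>\<mu>\<close> and \<open>\<kappa>\<close> differ contributes 0.
\<close>

lemma alternating_strips:
  assumes le: "\<mu> \<le> \<kappa>"
  shows "(\<Sum>\<nu> | \<mu> \<le> \<nu> \<and> \<nu> \<le> \<kappa>. (- x) ^ card (snd ` skew \<kappa> \<nu>) * poly (strip_poly (skew \<nu> \<mu>)) x)
    = of_bool (\<mu> = \<kappa>)"
proof -
  obtain n where n: "\<forall>r\<ge>n. rows \<kappa> r = 0" using rows_eventually_0 by blast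
  define L where "L = Suc (rows \<kappa> 0)"
  have L: "rows \<kappa> 0 < L" by (simp add: L_def)
  let ?\<mu> = "prev_row L (rows \<mu>)" and ?\<kappa> = "prev_row L (rows \<kappa>)"
  define t where "t r p k = (if k \<le> p then (- x) ^ (min (rows \<kappa> r) p - k) * strip_row x (?\<mu> r) k (rows \<mu> r) else 0)"
    for r p k
  define d :: "nat \<Rightarrow> int" where "d r = of_bool (rows \<mu> r = rows \<kappa> r \<or> ?\<mu> r = rows \<mu> r)" for r
  let ?X = "\<lambda>r. {rows \<mu> r..rows \<kappa> r}"
  have \<mu>L: "rows \<mu> 0 \<le> L" using L le_youngD[OF le, of 0] by simp
  \<comment> \<open>Constancy of \<open>F\<close> up to \<open>Suc (rows \<mu> r)\<close> suffices:
    longer rows of \<nu> have weight 0, as \<nu> exceeds \<mu> by a vertical strip.\<close>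
  have step: "(\<Sum>k\<in>?X r. t r p k * F k) = d r * K"
    if F: "\<And>p. rows \<mu> r \<le> p \<Longrightarrow> p \<le> rows \<kappa> r \<Longrightarrow> p \<le> Suc (rows \<mu> r) \<Longrightarrow> F p = K"
      and p: "?\<mu> r \<le> p" "p \<le> ?\<kappa> r" "p \<le> Suc (?\<mu> r)" for r p F K
  proof -
    define m l where "m = rows \<mu> r" and "l = rows \<kappa> r"
    have m: "m \<le> ?\<mu> r" using prev_row_rows_ge[OF \<mu>L, of r] by (simp add: m_def)
    have ml: "m \<le> l" using le_youngD[OF le] by (simp add: m_def l_def)
    show ?thesis
    proof (cases "l = m")
      case True
      then have "F m = K" using F[of m] by (simp add: m_def l_def)
      then show ?thesis
        using True p(1) m by (simp add: t_def d_def strip_row_def m_def l_def)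
    next
      case False
      then have "m < l" using ml by simp
      then have "F m = K" "F (Suc m) = K" using F[of m] F[of "Suc m"] by (auto simp: m_def l_def)
      moreover have "(\<Sum>k\<in>{m..l}. t r p k * F k) = t r p m * F m + t r p (Suc m) * F (Suc m)"
        by (rule sum_two_terms) (use \<open>m < l\<close> in \<open>auto simp: t_def strip_row_def m_def\<close>)
      \<comment> \<open>If the row above has length \<open>m\<close> in \<mu>, a box added in column
        \<open>m\<close> carries \<open>1 + x\<close>, and the sum is 1 or
        \<open>- x + (1 + x)\<close>. Otherwise that box carries \<open>x\<close>, and the sum is
        \<open>(- x) ^ Suc e + (- x) ^ e * x\<close>.\<close>
      moreover have "t r p m + t r p (Suc m) = d r"
      proof (cases "?\<mu> r = m")
        case True
        then have "p = m \<or> p = Suc m" "l = Suc m \<or> Suc m < l" using p \<open>m < l\<close> by auto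
        then show ?thesis
          using True by (auto simp: t_def d_def strip_row_def min_def m_def[symmetric] l_def[symmetric])
      next
        case False
        then have "p \<ge> Suc m" using m p by simp
        define e where "e = min l p - Suc m"
        have "min l p - m = Suc e" using \<open>p \<ge> Suc m\<close> \<open>m < l\<close> by (auto simp: e_def min_def)
        then show ?thesis
          using False \<open>m < l\<close> \<open>p \<ge> Suc m\<close> e_def[symmetric]
          by (simp add: t_def d_def strip_row_def m_def[symmetric] l_def[symmetric])
      qed
      ultimately show ?thesis by (simp add: m_def l_def flip: distrib_right)
    qed
  qed
  have main: "transfer_sum L ?X t j F = K * (\<Prod>r<j. d r)"
    if "\<And>p. ?\<mu> j \<le> p \<Longrightarrow> p \<le> ?\<kappa> j \<Longrightarrow> p \<le> Suc (?\<mu> j) \<Longrightarrow> F p = K" for j F K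
    using that
  proof (induction j arbitrary: F K)
    case 0
    then show ?case by (simp add: transfer_sum_0 prev_row_def)
  next
    case (Suc j)
    have "(\<Sum>k\<in>?X j. t j p k * F k) = d j * K" if "?\<mu> j \<le> p" "p \<le> ?\<kappa> j" "p \<le> Suc (?\<mu> j)" for p
      by (rule step) (use that Suc.prems in \<open>auto simp: prev_row_def\<close>)
    then show ?case
      unfolding transfer_sum_Suc by (subst Suc.IH[of _ "d j * K"]) auto
  qed
  have "(\<Sum>\<nu> | \<mu> \<le> \<nu> \<and> \<nu> \<le> \<kappa>. (- x) ^ card (snd ` skew \<kappa> \<nu>) * poly (strip_poly (skew \<nu> \<mu>)) x)
      = transfer_sum L ?X t n (\<lambda>_. 1)"
  proof (rule sum_between_eq_transfer_sum[OF n L le])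
    fix \<nu> assume \<nu>: "\<mu> \<le> \<nu>" "\<nu> \<le> \<kappa>"
    have n': "\<forall>r\<ge>n. rows \<nu> r = 0" using n le_youngD[OF \<nu>(2)] by (metis le_zero_eq)
    have L': "rows \<nu> 0 < L" using L le_youngD[OF \<nu>(2), of 0] by simp
    show "(- x) ^ card (snd ` skew \<kappa> \<nu>) * poly (strip_poly (skew \<nu> \<mu>)) x
        = (\<Prod>r<n. t r (prev_row L (rows \<nu>) r) (rows \<nu> r))"
      unfolding poly_strip_poly_skew[OF \<nu>(1) n' L'] columns_skew[OF \<nu>(2) n L] power_sum prod.distrib[symmetric]
      using prev_row_rows_ge[of \<nu> L] L' by (intro prod.cong refl) (simp add: t_def)
  qed (auto simp: t_def)
  also have "\<dots> = (\<Prod>r<n. d r)"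
    by (subst main[of n _ 1]) auto
  also have "\<dots> = of_bool (\<mu> = \<kappa>)"
  proof (cases "\<mu> = \<kappa>")
    case False
    then have "\<exists>r. rows \<mu> r \<noteq> rows \<kappa> r" by (metis ext rows_inject)
    define r where "r = (LEAST r. rows \<mu> r \<noteq> rows \<kappa> r)"
    have r: "rows \<mu> r \<noteq> rows \<kappa> r" unfolding r_def using \<open>\<exists>r. _\<close> by (rule LeastI_ex)
    have min: "rows \<mu> s = rows \<kappa> s" if "s < r" for s
      using not_less_Least[of s "\<lambda>r. rows \<mu> r \<noteq> rows \<kappa> r"] that by (auto simp: r_def)
    have lt: "rows \<mu> r < rows \<kappa> r" using r le_youngD[OF le, of r] by simp
    then have "r < n" using n by (cases "r < n") auto
    \<comment> \<open>The row above has the same length in \<mu> and \<kappa>, or is the artificial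
      row of length \<open>L\<close>. So it is at least as long as row \<open>r\<close> of \<kappa>,
      hence longer than row \<open>r\<close> of \<mu>.\<close>
    moreover have "?\<mu> r \<noteq> rows \<mu> r"
    proof (cases r)
      case 0
      then show ?thesis using lt L by (simp add: prev_row_def)
    next
      case (Suc s)
      then show ?thesis using min[of s] lt rows_antimono[of s r \<kappa>] by (simp add: prev_row_def)
    qed
    ultimately have "d r = 0" "r \<in> {..<n}" using r by (auto simp: d_def)
    then show ?thesis using False by (auto simp: prod_zero_iff)
  qed (simp add: d_def)
  finally show ?thesis .
qed

text \<open>
  The rows of \<open>\<nu>\<close> are again summed out from the bottom. The relation \<open>good\<close> between the partial sums
  and those with \<open>x\<close> and \<open>y\<close> exchanged, as functions of the length of the last remaining row of \<open>\<nu>\<close>, is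
  preserved; \<open>m\<close> and \<open>l\<close> are the lengths of this row in \<open>\<mu>\<close> and \<open>\<kappa>\<close>.
\<close>

lemma strips_commute:
  assumes le: "\<mu> \<le> \<kappa>"
  shows "(\<Sum>\<nu> | \<mu> \<le> \<nu> \<and> \<nu> \<le> \<kappa>. poly (strip_poly (skew \<kappa> \<nu>)) x * poly (strip_poly (skew \<nu> \<mu>)) y)
    = (\<Sum>\<nu> | \<mu> \<le> \<nu> \<and> \<nu> \<le> \<kappa>. poly (strip_poly (skew \<kappa> \<nu>)) y * poly (strip_poly (skew \<nu> \<mu>)) x)"
proof -
  obtain n where n: "\<forall>r\<ge>n. rows \<kappa> r = 0" using rows_eventually_0 by blast
  define L where "L = Suc (rows \<kappa> 0)"
  have L: "rows \<kappa> 0 < L" by (simp add: L_def)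
  let ?\<mu> = "prev_row L (rows \<mu>)" and ?\<kappa> = "prev_row L (rows \<kappa>)"
  define t where "t x y r p k = (if k \<le> p then strip_row x p (rows \<kappa> r) k * strip_row y (?\<mu> r) k (rows \<mu> r) else 0)"
    for x y r p k
  let ?X = "\<lambda>r. {rows \<mu> r..rows \<kappa> r}"
  have \<mu>L: "rows \<mu> 0 \<le> L" using L le_youngD[OF le, of 0] by simp
  \<comment> \<open>Two vertical strips add at most two boxes to a row; the clauses treat 0, 2 and 1
    added boxes. For one box with both rows above longer than \<open>m\<close>, the row sums are
    \<open>x * F m + y * F (Suc m)\<close> and \<open>y * G m + x * G (Suc m)\<close>. Given the
    equation before it, the last equation is exactly what makes them equal.\<close>
  define good where "good m l F G \<longleftrightarrow> (l = m \<longrightarrow> F m = G m) \<and> (l = Suc (Suc m) \<longrightarrow> F (Suc m) = G (Suc m)) \<and>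
    (l = Suc m \<longrightarrow> F (Suc m) = G (Suc m) \<and> x * (F m - F (Suc m)) = y * (G m - G (Suc m)))"
    for m l :: nat and F G :: "nat \<Rightarrow> int"
  have row: "(\<Sum>k\<in>?X r. t x y r p k * F k) =
      (if rows \<kappa> r = rows \<mu> r then F (rows \<mu> r)
       else if rows \<kappa> r = Suc (rows \<mu> r) then (if p = rows \<mu> r then 1 + x else x) * F (rows \<mu> r)
         + (if rows \<mu> r < p then (if ?\<mu> r = rows \<mu> r then 1 + y else y) * F (Suc (rows \<mu> r)) else 0)
       else if rows \<kappa> r = Suc (Suc (rows \<mu> r)) then
         (if rows \<mu> r < p then (if p = Suc (rows \<mu> r) then 1 + x else x)
           * (if ?\<mu> r = rows \<mu> r then 1 + y else y) * F (Suc (rows \<mu> r)) else 0)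
       else 0)" if "?\<mu> r \<le> p" for x y r p F
  proof -
    define m l where "m = rows \<mu> r" and "l = rows \<kappa> r"
    have m: "m \<le> p" using prev_row_rows_ge[OF \<mu>L, of r] that by (simp add: m_def)
    have "m \<le> l" using le_youngD[OF le] by (simp add: m_def l_def)
    have "(\<Sum>k\<in>{m..l}. t x y r p k * F k) = t x y r p m * F m + t x y r p (Suc m) * F (Suc m)" if "m < l"
      by (rule sum_two_terms) (use that in \<open>auto simp: t_def strip_row_def m_def\<close>)
    note two = this
    consider "l = m" | "l = Suc m" | "l = Suc (Suc m)" | "l > Suc (Suc m)" using \<open>m \<le> l\<close> by linarith
    then show ?thesis
      unfolding m_def[symmetric] l_def[symmetric]
      by cases (use m in \<open>simp_all add: two, simp_all add: t_def strip_row_def m_def[symmetric] l_def[symmetric]\<close>)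
  qed
  have step: "good (?\<mu> r) (?\<kappa> r) (\<lambda>p. \<Sum>k\<in>?X r. t x y r p k * F k) (\<lambda>p. \<Sum>k\<in>?X r. t y x r p k * G k)"
    if FG: "good (rows \<mu> r) (rows \<kappa> r) F G" for r F G
  proof -
    define m l M K where "m = rows \<mu> r" and "l = rows \<kappa> r" and "M = ?\<mu> r" and "K = ?\<kappa> r"
    have le': "m \<le> l" "m \<le> M" "M \<le> K" "l \<le> K"
      using le_youngD[OF le] prev_row_rows_ge[OF \<mu>L, of r] prev_row_mono[OF le, of L r] prev_row_rows_ge[of \<kappa> L r] L
      by (auto simp: m_def l_def M_def K_def)
    note row' = row[of r, folded m_def l_def M_def]
    consider "l = m" | "l = Suc m" | "l = Suc (Suc m)" | "l > Suc (Suc m)" using le' by linarith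
    then show ?thesis
    proof cases
      case 1
      then have "F m = G m" using FG by (auto simp: good_def m_def l_def)
      then show ?thesis
        unfolding good_def m_def[symmetric] l_def[symmetric] M_def[symmetric] K_def[symmetric]
          row'[OF order_refl] row'[OF le_SucI[OF order_refl]]
        using 1 by simp
    next
      case 2
      then have F1: "F (Suc m) = G (Suc m)" and "x * (F m - F (Suc m)) = y * (G m - G (Suc m))"
        using FG by (auto simp: good_def m_def l_def)
      then have F2: "x * F m = x * G (Suc m) + y * G m - y * G (Suc m)"
        by (simp add: algebra_simps)
      consider "M = m" | "m < M" using le' by linarith
      then show ?thesis
      proof cases
        case 1
        then show ?thesis
          using 2 le' F1 unfolding good_def m_def[symmetric] l_def[symmetric] M_def[symmetric] K_def[symmetric]
          row'[OF order_refl] row'[OF le_SucI[OF order_refl]]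
          by (simp add: F2 algebra_simps)
      next
        case 2
        then show ?thesis
          using \<open>l = Suc m\<close> le' F1 unfolding good_def m_def[symmetric] l_def[symmetric] M_def[symmetric] K_def[symmetric]
          row'[OF order_refl] row'[OF le_SucI[OF order_refl]]
          by (simp add: F2 algebra_simps)
      qed
    next
      case 3
      then have F1: "F (Suc m) = G (Suc m)" using FG by (auto simp: good_def m_def l_def)
      consider "M = m" | "M = Suc m" | "Suc m < M" using le' by linarith
      then show ?thesis
        unfolding good_def m_def[symmetric] l_def[symmetric] M_def[symmetric] K_def[symmetric]
          row'[OF order_refl] row'[OF le_SucI[OF order_refl]]
        by cases (use 3 le' F1 in \<open>simp_all add: algebra_simps\<close>)
    next
      case 4
      then show ?thesis unfolding good_def m_def[symmetric] l_def[symmetric] M_def[symmetric] K_def[symmetric]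
          row'[OF order_refl] row'[OF le_SucI[OF order_refl]]
        by simp
    qed
  qed
  have main: "transfer_sum L ?X (t x y) j F = transfer_sum L ?X (t y x) j G" if "good (?\<mu> j) (?\<kappa> j) F G" for j F G
    using that
  proof (induction j arbitrary: F G)
    case 0
    then show ?case by (simp add: transfer_sum_0 prev_row_def good_def)
  next
    case (Suc j)
    then show ?case
      unfolding transfer_sum_Suc by (intro Suc.IH step) (simp add: prev_row_def)
  qed
  have sum: "(\<Sum>\<nu> | \<mu> \<le> \<nu> \<and> \<nu> \<le> \<kappa>. poly (strip_poly (skew \<kappa> \<nu>)) x * poly (strip_poly (skew \<nu> \<mu>)) y)
      = transfer_sum L ?X (t x y) n (\<lambda>_. 1)" for x y
  proof (rule sum_between_eq_transfer_sum[OF n L le])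
    fix \<nu> assume \<nu>: "\<mu> \<le> \<nu>" "\<nu> \<le> \<kappa>"
    have n': "\<forall>r\<ge>n. rows \<nu> r = 0" using n le_youngD[OF \<nu>(2)] by (metis le_zero_eq)
    have L': "rows \<nu> 0 < L" using L le_youngD[OF \<nu>(2), of 0] by simp
    show "poly (strip_poly (skew \<kappa> \<nu>)) x * poly (strip_poly (skew \<nu> \<mu>)) y
        = (\<Prod>r<n. t x y r (prev_row L (rows \<nu>) r) (rows \<nu> r))"
      unfolding poly_strip_poly_skew[OF \<nu>(1) n' L'] poly_strip_poly_skew[OF \<nu>(2) n L] prod.distrib[symmetric]
      using prev_row_rows_ge[of \<nu> L] L' by (intro prod.cong refl) (simp add: t_def)
  qed (auto simp: t_def)
  show ?thesis
    unfolding sum by (rule main) (simp add: good_def)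
qed

section \<open>Reverse plane partitions as chains of shapes\<close>

text \<open>Allowing any weight on skew shapes lets one slicing argument serve both kinds of
  tableaux.\<close>

definition set_op :: "((nat \<times> nat) set \<Rightarrow> int) \<Rightarrow> (young \<Rightarrow> int) \<Rightarrow> young \<Rightarrow> int" where
  "set_op u v \<kappa> = (\<Sum>\<nu> | \<nu> \<le> \<kappa>. u (skew \<kappa> \<nu>) * v \<nu>)"

definition column_weight :: "nat \<Rightarrow> (nat \<times> nat) set \<Rightarrow> int" where
  "column_weight k S = of_bool (card (snd ` S) = k)"

definition strip_weight :: "nat \<Rightarrow> (nat \<times> nat) set \<Rightarrow> int" where
  "strip_weight k S = coeff (strip_poly S) k"

lemma op_family_set_op:
  assumes "\<And>S. finite S \<Longrightarrow> w 0 S = of_bool (S = {})"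
  shows "op_family (\<lambda>k. set_op (w k))"
proof
  show "set_op (w 0) v = v" for v
  proof
    fix \<kappa>
    have "set_op (w 0) v \<kappa> = (\<Sum>\<nu> | \<nu> \<le> \<kappa>. if \<nu> = \<kappa> then v \<nu> else 0)"
      unfolding set_op_def using assms by (intro sum.cong refl) (auto simp: skew_empty_iff)
    then show "set_op (w 0) v \<kappa> = v \<kappa>" by simp
  qed
qed (auto simp: set_op_def fun_eq_iff sum.distrib sum_distrib_left algebra_simps)

lemma column_weight_0: "finite S \<Longrightarrow> column_weight 0 S = of_bool (S = {})"
  by (simp add: column_weight_def)

lemma strip_weight_0: "finite S \<Longrightarrow> strip_weight 0 S = of_bool (S = {})"
  by (auto simp: strip_weight_def strip_poly_def coeff_mult card_gt_0_iff)

interpretation columns: op_family "\<lambda>k. set_op (column_weight k)"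
  by (rule op_family_set_op) (rule column_weight_0)

interpretation strips: op_family "\<lambda>k. set_op (strip_weight k)"
  by (rule op_family_set_op) (rule strip_weight_0)

lemma set_op_set_op:
  "set_op u (set_op w v) \<kappa>
    = (\<Sum>\<mu> | \<mu> \<le> \<kappa>. (\<Sum>\<nu> | \<mu> \<le> \<nu> \<and> \<nu> \<le> \<kappa>. u (skew \<kappa> \<nu>) * w (skew \<nu> \<mu>)) * v \<mu>)"
proof -
  have "set_op u (set_op w v) \<kappa>
      = (\<Sum>(\<nu>, \<mu>)\<in>Sigma {\<nu>. \<nu> \<le> \<kappa>} (\<lambda>\<nu>. {\<mu>. \<mu> \<le> \<nu>}). u (skew \<kappa> \<nu>) * (w (skew \<nu> \<mu>) * v \<mu>))"
    by (simp add: set_op_def sum_distrib_left sum.Sigma)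
  also have "\<dots> = (\<Sum>(\<mu>, \<nu>)\<in>Sigma {\<mu>. \<mu> \<le> \<kappa>} (\<lambda>\<mu>. {\<nu>. \<mu> \<le> \<nu> \<and> \<nu> \<le> \<kappa>}). u (skew \<kappa> \<nu>) * w (skew \<nu> \<mu>) * v \<mu>)"
    by (rule sum.reindex_bij_witness[where i = "\<lambda>(\<mu>, \<nu>). (\<nu>, \<mu>)" and j = "\<lambda>(\<nu>, \<mu>). (\<mu>, \<nu>)"]) auto
  also have "\<dots> = (\<Sum>\<mu> | \<mu> \<le> \<kappa>. (\<Sum>\<nu> | \<mu> \<le> \<nu> \<and> \<nu> \<le> \<kappa>. u (skew \<kappa> \<nu>) * w (skew \<nu> \<mu>)) * v \<mu>)"
    by (simp add: sum_distrib_right sum.Sigma)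
  finally show ?thesis .
qed

text \<open>A polynomial identity in two variables is recovered from its integer values: for fixed
  \<open>y\<close> both sides agree as polynomials in \<open>x\<close>, so their coefficients of
  degree \<open>i\<close> agree, and these are polynomial in \<open>y\<close>.\<close>

lemma strip_weight_commute:
  assumes "\<mu> \<le> \<kappa>"
  shows "(\<Sum>\<nu> | \<mu> \<le> \<nu> \<and> \<nu> \<le> \<kappa>. strip_weight i (skew \<kappa> \<nu>) * strip_weight j (skew \<nu> \<mu>))
    = (\<Sum>\<nu> | \<mu> \<le> \<nu> \<and> \<nu> \<le> \<kappa>. strip_weight j (skew \<kappa> \<nu>) * strip_weight i (skew \<nu> \<mu>))"
proof -
  let ?S = "{\<nu>. \<mu> \<le> \<nu> \<and> \<nu> \<le> \<kappa>}" and ?u = "\<lambda>\<nu>. strip_poly (skew \<kappa> \<nu>)" and ?d = "\<lambda>\<nu>. strip_poly (skew \<nu> \<mu>)"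
  have "(\<Sum>\<nu>\<in>?S. smult (poly (?d \<nu>) y) (?u \<nu>)) = (\<Sum>\<nu>\<in>?S. smult (poly (?u \<nu>) y) (?d \<nu>))" for y
    by (subst poly_eq_poly_eq_iff[symmetric], rule ext)
      (use strips_commute[OF assms, of _ y] in \<open>simp add: poly_sum mult.commute\<close>)
  then have "coeff (\<Sum>\<nu>\<in>?S. smult (poly (?d \<nu>) y) (?u \<nu>)) i = coeff (\<Sum>\<nu>\<in>?S. smult (poly (?u \<nu>) y) (?d \<nu>)) i" for y
    by simp
  then have "(\<Sum>\<nu>\<in>?S. smult (coeff (?u \<nu>) i) (?d \<nu>)) = (\<Sum>\<nu>\<in>?S. smult (coeff (?d \<nu>) i) (?u \<nu>))"
    by (subst poly_eq_poly_eq_iff[symmetric], intro ext) (simp add: poly_sum coeff_sum mult.commute)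
  then have "coeff (\<Sum>\<nu>\<in>?S. smult (coeff (?u \<nu>) i) (?d \<nu>)) j = coeff (\<Sum>\<nu>\<in>?S. smult (coeff (?d \<nu>) i) (?u \<nu>)) j"
    by simp
  then show ?thesis
    by (simp add: coeff_sum strip_weight_def mult.commute)
qed

lemma strips_op_commute:
  "set_op (strip_weight i) (set_op (strip_weight j) v) = set_op (strip_weight j) (set_op (strip_weight i) v)"
  unfolding fun_eq_iff set_op_set_op by (intro allI sum.cong refl arg_cong2[of _ _ _ _ "(*)"] strip_weight_commute) auto

text \<open>Between fixed \<mu> and \<kappa>, the relation characterising \<open>eop\<close> is the
  coefficient of degree \<open>n\<close> in \<open>alternating_strips\<close>, whose right-hand side
  is a constant polynomial.\<close>

lemma strips_eq_eop_columns:
  "set_op (strip_weight n) v = eop (\<lambda>k. set_op (column_weight k)) n v"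
proof (rule columns.eop_unique)
  fix n \<kappa> v assume "n > (0 :: nat)"
  have "(\<Sum>k\<le>n. (- 1) ^ k * (\<Sum>\<nu> | \<mu> \<le> \<nu> \<and> \<nu> \<le> \<kappa>. column_weight k (skew \<kappa> \<nu>) * strip_weight (n - k) (skew \<nu> \<mu>))) = 0"
    if "\<mu> \<le> \<kappa>" for \<mu>
  proof -
    define A :: "young \<Rightarrow> int poly"
      where "A \<nu> = monom ((- 1) ^ card (snd ` skew \<kappa> \<nu>)) (card (snd ` skew \<kappa> \<nu>))" for \<nu>
    have A: "coeff (A \<nu>) k = (- 1) ^ k * column_weight k (skew \<kappa> \<nu>)" for \<nu> k
      by (auto simp: A_def column_weight_def)
    have "(\<Sum>\<nu> | \<mu> \<le> \<nu> \<and> \<nu> \<le> \<kappa>. A \<nu> * strip_poly (skew \<nu> \<mu>)) = [:of_bool (\<mu> = \<kappa>):]"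
      by (subst poly_eq_poly_eq_iff[symmetric], rule ext)
        (use alternating_strips[OF that] in \<open>simp add: A_def poly_sum poly_monom flip: power_mult_distrib\<close>)
    then have "coeff (\<Sum>\<nu> | \<mu> \<le> \<nu> \<and> \<nu> \<le> \<kappa>. A \<nu> * strip_poly (skew \<nu> \<mu>)) n = 0"
      using \<open>n > 0\<close> by (simp add: coeff_pCons split: nat.splits)
    then have "(\<Sum>\<nu> | \<mu> \<le> \<nu> \<and> \<nu> \<le> \<kappa>. \<Sum>k\<le>n.
        (- 1) ^ k * (column_weight k (skew \<kappa> \<nu>) * strip_weight (n - k) (skew \<nu> \<mu>))) = 0"
      by (simp add: coeff_sum coeff_mult A strip_weight_def mult.assoc)
    then show ?thesis
      by (subst (asm) sum.swap) (simp add: sum_distrib_left)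
  qed
  then have "(\<Sum>\<mu> | \<mu> \<le> \<kappa>. (\<Sum>k\<le>n. (- 1) ^ k * (\<Sum>\<nu> | \<mu> \<le> \<nu> \<and> \<nu> \<le> \<kappa>.
      column_weight k (skew \<kappa> \<nu>) * strip_weight (n - k) (skew \<nu> \<mu>))) * v \<mu>) = 0"
    by simp
  then show "(\<Sum>k\<le>n. (- 1) ^ k * set_op (column_weight k) (set_op (strip_weight (n - k)) v) \<kappa>) = 0"
    unfolding set_op_set_op sum_distrib_left sum_distrib_right mult.assoc
    by (subst sum.swap) (simp add: sum_distrib_left sum_distrib_right mult.assoc)
qed simp

lemma columns_op_commute:
  "set_op (column_weight i) (set_op (column_weight j) v) = set_op (column_weight j) (set_op (column_weight i) v)"
  by (rule op_commute_if_eop_commute[OF columns.op_family_axioms])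
    (simp only: strips_eq_eop_columns[symmetric] strips_op_commute)

section \<open>Slicing fillings by their entries\<close>

definition bounded_rpps :: "nat \<Rightarrow> (nat \<times> nat) set \<Rightarrow> (nat \<times> nat \<Rightarrow> nat) set" where
  "bounded_rpps n D = {T. reverse_plane_partition D T \<and> (\<forall>b\<in>D. T b \<le> n)}"

definition level :: "(nat \<times> nat) set \<Rightarrow> (nat \<times> nat \<Rightarrow> nat) \<Rightarrow> nat \<Rightarrow> (nat \<times> nat) set" where
  "level D T i = {b \<in> D. T b = i}"

text \<open>The comparison passes through the box \<open>(r, c')\<close>, which lies in the skew
  shape.\<close>

lemma rpp_mono:
  assumes T: "reverse_plane_partition (skew \<kappa> \<mu>) T"
    and b: "(r, c) \<in> skew \<kappa> \<mu>" "(r', c') \<in> skew \<kappa> \<mu>" "r \<le> r'" "c \<le> c'"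
  shows "T (r, c) \<le> T (r', c')"
proof -
  have "(r, c') \<in> skew \<kappa> \<mu>"
    using b rows_antimono[of r r' \<kappa>] by (auto simp: skew_diagram_def)
  then have "T (r, c) \<le> T (r, c')" "T (r, c') \<le> T (r', c')"
    using T b unfolding reverse_plane_partition_def by (metis le_neq_implies_less order_refl)+
  then show ?thesis by simp
qed

lemma rppI:
  assumes "filling D T"
    and "\<And>r c r' c'. (r, c) \<in> D \<Longrightarrow> (r', c') \<in> D \<Longrightarrow> r \<le> r' \<Longrightarrow> c \<le> c' \<Longrightarrow> T (r, c) \<le> T (r', c')"
  shows "reverse_plane_partition D T"
  using assms by (auto simp: reverse_plane_partition_def)

lemma finite_bounded_rpps:
  assumes "finite D"
  shows "finite (bounded_rpps n D)"
proof (rule finite_subset)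
  show "bounded_rpps n D \<subseteq> D \<rightarrow>\<^sub>E {..n}"
    by (auto simp: bounded_rpps_def reverse_plane_partition_def filling_def PiE_def Pi_iff)
  show "finite (D \<rightarrow>\<^sub>E {..n})" using assms by (intro finite_PiE) auto
qed

text \<open>Each row of an ideal is an initial interval, so the ideal is described by row lengths
  \<open>f\<close>. If row \<open>Suc r\<close> were longer than row \<open>r\<close>, the box above
  its last box would lie in the skew shape and hence in the ideal. Uniqueness needs \<mu> below
  \<nu>, which fixes the length of rows without boxes.\<close>

lemma order_ideal_skew:
  assumes le: "\<mu> \<le> \<kappa>" and E: "E \<subseteq> skew \<kappa> \<mu>"
    and ideal: "\<And>r c r' c'. (r', c') \<in> E \<Longrightarrow> (r, c) \<in> skew \<kappa> \<mu> \<Longrightarrow> r \<le> r' \<Longrightarrow> c \<le> c' \<Longrightarrow> (r, c) \<in> E"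
  shows "\<exists>!\<nu>. \<mu> \<le> \<nu> \<and> \<nu> \<le> \<kappa> \<and> skew \<nu> \<mu> = E"
proof -
  have "finite E" using E finite_skew finite_subset by blast
  define f where "f r = rows \<mu> r + card {c. (r, c) \<in> E}" for r
  have row: "{c. (r, c) \<in> E} = {rows \<mu> r..<f r}" for r
  proof -
    let ?R = "{c. (r, c) \<in> E}"
    have fin: "finite ?R"
      using finite_imageI[OF \<open>finite E\<close>, of snd] by (rule rev_finite_subset) force
    have down: "{rows \<mu> r..c} \<subseteq> ?R" if "c \<in> ?R" for c
      using that E ideal[of r c r] by (auto simp: skew_diagram_def)
    show ?thesis
    proof (cases "?R = {}")
      case False
      have "?R \<subseteq> {rows \<mu> r..Max ?R}"
      proof
        fix c assume c: "c \<in> ?R"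
        then have "(r, c) \<in> skew \<kappa> \<mu>" using E by blast
        then show "c \<in> {rows \<mu> r..Max ?R}" using Max_ge[OF fin c] by (simp add: skew_diagram_def)
      qed
      then have "?R = {rows \<mu> r..Max ?R}"
        using down[OF Max_in[OF fin False]] by (rule equalityI)
      moreover have "rows \<mu> r \<le> Max ?R"
        using Max_in[OF fin False] E by (auto simp: skew_diagram_def)
      ultimately have R: "?R = {rows \<mu> r..<Suc (Max ?R)}" "rows \<mu> r \<le> Suc (Max ?R)"
        by (simp_all add: atLeastLessThanSuc_atLeastAtMost)
      have "card ?R = Suc (Max ?R) - rows \<mu> r"
        by (subst R(1)) simp
      then have "f r = Suc (Max ?R)" using R(2) by (simp add: f_def)
      then show ?thesis using R(1) by simp
    qed (simp add: f_def)
  qed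
  have mem: "(r, c) \<in> E \<longleftrightarrow> rows \<mu> r \<le> c \<and> c < f r" for r c
    using row[of r] by auto
  have f\<mu>: "rows \<mu> r \<le> f r" for r by (simp add: f_def)
  have f\<kappa>: "f r \<le> rows \<kappa> r" for r
  proof (cases "f r = rows \<mu> r")
    case True
    then show ?thesis using le_youngD[OF le, of r] by simp
  next
    case False
    then have "(r, f r - 1) \<in> E" using f\<mu>[of r] by (auto simp: mem)
    then show ?thesis using E by (auto simp: skew_diagram_def)
  qed
  have "antimono f"
    unfolding antimono_iff_le_Suc
  proof
    fix r
    show "f (Suc r) \<le> f r"
    proof (rule ccontr)
      assume less: "\<not> f (Suc r) \<le> f r"
      let ?c = "f (Suc r) - 1"
      have "rows \<mu> (Suc r) \<le> rows \<mu> r" "rows \<mu> r \<le> f r" using rows_antimono[of r "Suc r" \<mu>] f\<mu> by auto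
      then have c: "(Suc r, ?c) \<in> E" "rows \<mu> r \<le> ?c" "f r \<le> ?c" using less by (auto simp: mem)
      moreover have "?c < rows \<kappa> r" using less f\<kappa>[of "Suc r"] rows_antimono[of r "Suc r" \<kappa>] by linarith
      ultimately have "(r, ?c) \<in> E" by (intro ideal[OF c(1)]) (auto simp: skew_diagram_def)
      then show False using c(3) by (simp add: mem)
    qed
  qed
  moreover have "{r. f r \<noteq> 0} \<subseteq> {r. rows \<kappa> r \<noteq> 0}"
    using f\<kappa> by (metis (mono_tags, lifting) Collect_mono le_zero_eq)
  then have "finite {r. f r \<noteq> 0}"
    using rows[of \<kappa>] finite_subset by (auto simp: is_partition_def)
  ultimately have rows: "rows (Young f) = f" by (simp add: Young_inverse is_partition_def)
  show ?thesis
  proof (rule ex1I[of _ "Young f"])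
    show "\<mu> \<le> Young f \<and> Young f \<le> \<kappa> \<and> skew (Young f) \<mu> = E"
      using f\<mu> f\<kappa> mem by (auto simp: less_eq_young_def rows le_fun_def skew_diagram_def)
    fix \<nu> assume \<nu>: "\<mu> \<le> \<nu> \<and> \<nu> \<le> \<kappa> \<and> skew \<nu> \<mu> = E"
    have "rows \<nu> r = f r" for r
    proof -
      have "{rows \<mu> r..<rows \<nu> r} = {c. (r, c) \<in> skew \<nu> \<mu>}"
        by (auto simp: skew_diagram_def)
      also have "\<dots> = {rows \<mu> r..<f r}" using \<nu> row[of r] by simp
      finally have "card {rows \<mu> r..<rows \<nu> r} = card {rows \<mu> r..<f r}" by simp
      then show ?thesis using le_youngD[of \<mu> \<nu> r] f\<mu>[of r] \<nu> by simp
    qed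
    then have "rows \<nu> = rows (Young f)" unfolding rows by (rule ext)
    then show "\<nu> = Young f" by (simp only: rows_inject)
  qed
qed

lemma skew_diff:
  assumes "\<mu> \<le> \<nu>" "\<nu> \<le> \<kappa>"
  shows "skew \<kappa> \<nu> = skew \<kappa> \<mu> - skew \<nu> \<mu>"
proof (rule Set.set_eqI)
  fix b :: "nat \<times> nat"
  obtain r c where b: "b = (r, c)" by (cases b)
  show "b \<in> skew \<kappa> \<nu> \<longleftrightarrow> b \<in> skew \<kappa> \<mu> - skew \<nu> \<mu>"
    using le_youngD[OF assms(1), of r] le_youngD[OF assms(2), of r] by (auto simp: b skew_diagram_def)
qed

lemma skew_mono:
  assumes "\<nu> \<le> \<kappa>"
  shows "skew \<nu> \<mu> \<subseteq> skew \<kappa> \<mu>"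
proof
  fix b assume "b \<in> skew \<nu> \<mu>"
  then show "b \<in> skew \<kappa> \<mu>"
    using le_youngD[OF assms, of "fst b"] by (cases b) (simp add: skew_diagram_def)
qed

text \<open>The last operator in the list acts on the outermost strip, which carries the largest
  entry; removing that strip leaves the order ideal of smaller entries. As the weights are
  arbitrary, further conditions such as strict rows can be imposed by weights that vanish.\<close>

lemma sum_rpps_eq_fold:
  "fold set_op us (\<lambda>\<nu>. of_bool (\<nu> = \<mu>)) \<kappa> = (if \<mu> \<le> \<kappa> then
     \<Sum>T\<in>bounded_rpps (length us) (skew \<kappa> \<mu>). \<Prod>i<length us. (us ! i) (level (skew \<kappa> \<mu>) T (Suc i)) else 0)"
proof (induction us arbitrary: \<kappa> rule: rev_induct)
  case Nil
  show ?case
  proof (cases "\<kappa> = \<mu>")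
    case True
    then have "skew \<kappa> \<mu> = {}" by (auto simp: skew_diagram_def)
    then have "bounded_rpps 0 (skew \<kappa> \<mu>) = {\<lambda>_. undefined}"
      by (auto simp: bounded_rpps_def reverse_plane_partition_def filling_def)
    then show ?thesis using True by simp
  next
    case False
    have "bounded_rpps 0 (skew \<kappa> \<mu>) = {}" if "\<mu> \<le> \<kappa>"
      using skew_empty_iff[OF that] False
      by (fastforce simp: bounded_rpps_def reverse_plane_partition_def filling_def PiE_def Pi_iff)
    then show ?thesis using False by simp
  qed
next
  case (snoc u us)
  define n where "n = length us"
  have nth: "(us @ [u]) ! n = u" "\<And>i. i < n \<Longrightarrow> (us @ [u]) ! i = us ! i"
    by (simp_all add: n_def nth_append)
  have "fold set_op (us @ [u]) (\<lambda>\<nu>. of_bool (\<nu> = \<mu>)) \<kappa>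
      = (\<Sum>\<nu> | \<nu> \<le> \<kappa>. u (skew \<kappa> \<nu>) * (if \<mu> \<le> \<nu> then
         \<Sum>T\<in>bounded_rpps n (skew \<nu> \<mu>). \<Prod>i<n. (us ! i) (level (skew \<nu> \<mu>) T (Suc i)) else 0))"
    unfolding n_def by (simp add: set_op_def snoc)
  also have "\<dots> = (\<Sum>\<nu> | \<mu> \<le> \<nu> \<and> \<nu> \<le> \<kappa>. u (skew \<kappa> \<nu>) *
         (\<Sum>T\<in>bounded_rpps n (skew \<nu> \<mu>). \<Prod>i<n. (us ! i) (level (skew \<nu> \<mu>) T (Suc i))))"
    by (intro sum.mono_neutral_cong_right) auto
  also have "\<dots> = (\<Sum>(\<nu>, T)\<in>Sigma {\<nu>. \<mu> \<le> \<nu> \<and> \<nu> \<le> \<kappa>} (\<lambda>\<nu>. bounded_rpps n (skew \<nu> \<mu>)).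
      u (skew \<kappa> \<nu>) * (\<Prod>i<n. (us ! i) (level (skew \<nu> \<mu>) T (Suc i))))"
    by (simp add: sum_distrib_left sum.Sigma finite_bounded_rpps)
  finally have lhs: "fold set_op (us @ [u]) (\<lambda>\<nu>. of_bool (\<nu> = \<mu>)) \<kappa> = \<dots>" .
  show ?case
  proof (cases "\<mu> \<le> \<kappa>")
    case False
    then have "{\<nu>. \<mu> \<le> \<nu> \<and> \<nu> \<le> \<kappa>} = {}" by (auto intro: order_trans)
    then show ?thesis using False by (simp only: lhs Sigma_empty1 sum.empty if_False)
  next
    case True
    let ?D = "skew \<kappa> \<mu>"
    define ideal where "ideal T = (THE \<nu>. \<mu> \<le> \<nu> \<and> \<nu> \<le> \<kappa> \<and> skew \<nu> \<mu> = {b \<in> ?D. T b \<le> n})" for T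
    define ext where "ext = (\<lambda>(\<nu>, T). \<lambda>b\<in>?D. if b \<in> skew \<nu> \<mu> then T b else Suc n)"
    have ideal: "\<mu> \<le> ideal T" "ideal T \<le> \<kappa>" "skew (ideal T) \<mu> = {b \<in> ?D. T b \<le> n}"
      if "T \<in> bounded_rpps (Suc n) ?D" for T
    proof -
      have "\<exists>!\<nu>. \<mu> \<le> \<nu> \<and> \<nu> \<le> \<kappa> \<and> skew \<nu> \<mu> = {b \<in> ?D. T b \<le> n}"
      proof (rule order_ideal_skew[OF True])
        fix r c r' c' assume "(r', c') \<in> {b \<in> ?D. T b \<le> n}" "(r, c) \<in> ?D" "r \<le> r'" "c \<le> c'"
        then show "(r, c) \<in> {b \<in> ?D. T b \<le> n}"
          using rpp_mono[of \<kappa> \<mu> T r c r' c'] that by (auto simp: bounded_rpps_def)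
      qed auto
      from theI'[OF this] show "\<mu> \<le> ideal T" "ideal T \<le> \<kappa>" "skew (ideal T) \<mu> = {b \<in> ?D. T b \<le> n}"
        by (auto simp: ideal_def)
    qed
    have ideal_eq: "ideal T = \<nu>" if "\<mu> \<le> \<nu>" "\<nu> \<le> \<kappa>" "skew \<nu> \<mu> = {b \<in> ?D. T b \<le> n}" for T \<nu>
    proof -
      have "\<exists>!\<nu>'. \<mu> \<le> \<nu>' \<and> \<nu>' \<le> \<kappa> \<and> skew \<nu>' \<mu> = skew \<nu> \<mu>"
      proof (rule order_ideal_skew[OF True skew_mono[OF that(2)]])
        fix r c r' c' assume *: "(r', c') \<in> skew \<nu> \<mu>" "(r, c) \<in> ?D" "r \<le> r'" "c \<le> c'"
        then show "(r, c) \<in> skew \<nu> \<mu>" using rows_antimono[of r r' \<nu>] by (auto simp: skew_diagram_def)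
      qed
      then show ?thesis unfolding ideal_def that(3)[symmetric] by (rule the1_equality) (use that in simp)
    qed
    have "(\<Sum>T\<in>bounded_rpps (Suc n) ?D. \<Prod>i<Suc n. ((us @ [u]) ! i) (level ?D T (Suc i)))
        = (\<Sum>(\<nu>, T)\<in>Sigma {\<nu>. \<mu> \<le> \<nu> \<and> \<nu> \<le> \<kappa>} (\<lambda>\<nu>. bounded_rpps n (skew \<nu> \<mu>)).
      u (skew \<kappa> \<nu>) * (\<Prod>i<n. (us ! i) (level (skew \<nu> \<mu>) T (Suc i))))"
    proof (rule sum.reindex_bij_witness[where j = "\<lambda>T. (ideal T, restrict T (skew (ideal T) \<mu>))" and i = ext])
      fix T assume T: "T \<in> bounded_rpps (Suc n) ?D"
      note id = ideal[OF T]
      have rpp: "reverse_plane_partition ?D T" and bd: "\<And>b. b \<in> ?D \<Longrightarrow> T b \<le> Suc n"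
        using T by (auto simp: bounded_rpps_def)
      have fil: "T \<in> ?D \<rightarrow>\<^sub>E {1..}" using rpp by (simp add: reverse_plane_partition_def filling_def)
      have mem: "b \<in> skew (ideal T) \<mu> \<longleftrightarrow> b \<in> ?D \<and> T b \<le> n" for b
        by (simp only: id(3) mem_Collect_eq)
      show "ext (ideal T, restrict T (skew (ideal T) \<mu>)) = T"
      proof
        fix b
        show "ext (ideal T, restrict T (skew (ideal T) \<mu>)) b = T b"
        proof (cases "b \<in> ?D")
          case True
          then show ?thesis using bd[OF True] by (simp add: ext_def mem)
        next
          case False
          then show ?thesis using PiE_arb[OF fil False] by (simp add: ext_def)
        qed
      qed
      have "reverse_plane_partition (skew (ideal T) \<mu>) (restrict T (skew (ideal T) \<mu>))"
      proof (rule rppI)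
        show "filling (skew (ideal T) \<mu>) (restrict T (skew (ideal T) \<mu>))"
          using PiE_mem[OF fil] by (simp add: filling_def mem)
        fix r c r' c' assume *: "(r, c) \<in> skew (ideal T) \<mu>" "(r', c') \<in> skew (ideal T) \<mu>" "r \<le> r'" "c \<le> c'"
        then have "T (r, c) \<le> T (r', c')" by (intro rpp_mono[OF rpp]) (simp_all only: mem)
        then show "restrict T (skew (ideal T) \<mu>) (r, c) \<le> restrict T (skew (ideal T) \<mu>) (r', c')"
          using * by (simp only: restrict_apply' )
      qed
      then have "restrict T (skew (ideal T) \<mu>) \<in> bounded_rpps n (skew (ideal T) \<mu>)"
        by (simp add: bounded_rpps_def mem)
      then show "(ideal T, restrict T (skew (ideal T) \<mu>))
          \<in> Sigma {\<nu>. \<mu> \<le> \<nu> \<and> \<nu> \<le> \<kappa>} (\<lambda>\<nu>. bounded_rpps n (skew \<nu> \<mu>))"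
        using id by simp
      have "level (skew (ideal T) \<mu>) (restrict T (skew (ideal T) \<mu>)) (Suc i) = level ?D T (Suc i)" if "i < n" for i
        unfolding level_def by (rule Collect_cong) (use that in \<open>auto simp: mem\<close>)
      then have "(\<Prod>i<n. (us ! i) (level (skew (ideal T) \<mu>) (restrict T (skew (ideal T) \<mu>)) (Suc i)))
          = (\<Prod>i<n. ((us @ [u]) ! i) (level ?D T (Suc i)))"
        by (intro prod.cong refl) (simp add: nth)
      moreover have "skew \<kappa> (ideal T) = level ?D T (Suc n)"
        proof -
        have "b \<in> ?D \<and> \<not> (b \<in> ?D \<and> T b \<le> n) \<longleftrightarrow> b \<in> ?D \<and> T b = Suc n" for b
          using bd[of b] by auto
        then show ?thesis unfolding skew_diff[OF id(1,2)] level_def id(3) by blast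
      qed
      ultimately show "(case (ideal T, restrict T (skew (ideal T) \<mu>)) of (\<nu>, T) \<Rightarrow>
          u (skew \<kappa> \<nu>) * (\<Prod>i<n. (us ! i) (level (skew \<nu> \<mu>) T (Suc i))))
          = (\<Prod>i<Suc n. ((us @ [u]) ! i) (level ?D T (Suc i)))"
        by (simp only: prod.case prod.lessThan_Suc nth mult.commute)
    next
      fix p assume "p \<in> Sigma {\<nu>. \<mu> \<le> \<nu> \<and> \<nu> \<le> \<kappa>} (\<lambda>\<nu>. bounded_rpps n (skew \<nu> \<mu>))"
      then obtain \<nu> T where p: "p = (\<nu>, T)" and \<nu>: "\<mu> \<le> \<nu>" "\<nu> \<le> \<kappa>" and T: "T \<in> bounded_rpps n (skew \<nu> \<mu>)"
        by auto
      have rpp: "reverse_plane_partition (skew \<nu> \<mu>) T" and bd: "\<And>b. b \<in> skew \<nu> \<mu> \<Longrightarrow> T b \<le> n"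
        using T by (auto simp: bounded_rpps_def)
      have fil: "T \<in> skew \<nu> \<mu> \<rightarrow>\<^sub>E {1..}" using rpp by (simp add: reverse_plane_partition_def filling_def)
      have sub: "skew \<nu> \<mu> \<subseteq> ?D" by (rule skew_mono[OF \<nu>(2)])
      have down: "(r, c) \<in> skew \<nu> \<mu>" if "(r', c') \<in> skew \<nu> \<mu>" "(r, c) \<in> ?D" "r \<le> r'" "c \<le> c'" for r c r' c'
        using that rows_antimono[of r r' \<nu>] by (auto simp: skew_diagram_def)
      have "reverse_plane_partition ?D (ext p)"
      proof (rule rppI)
        show "filling ?D (ext p)"
          using fil by (auto simp: filling_def ext_def p Pi_iff PiE_def)
        fix r c r' c' assume *: "(r, c) \<in> ?D" "(r', c') \<in> ?D" "r \<le> r'" "c \<le> c'"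
        show "ext p (r, c) \<le> ext p (r', c')"
        proof (cases "(r', c') \<in> skew \<nu> \<mu>")
          case True
          then show ?thesis using down[OF True *(1,3,4)] * rpp_mono[OF rpp _ True *(3,4)] by (simp add: ext_def p)
        next
          case False
          then show ?thesis using * bd[of "(r, c)"] by (auto simp: ext_def p intro: le_SucI)
        qed
      qed
      then show "ext p \<in> bounded_rpps (Suc n) ?D"
        using bd by (auto simp: bounded_rpps_def ext_def p intro: le_SucI)
      have eq: "skew \<nu> \<mu> = {b \<in> ?D. ext p b \<le> n}"
        using sub bd by (auto simp: ext_def p)
      have "ideal (ext p) = \<nu>" by (rule ideal_eq[OF \<nu> eq])
      moreover have "restrict (ext p) (skew \<nu> \<mu>) = T"
      proof
        fix b show "restrict (ext p) (skew \<nu> \<mu>) b = T b"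
          using sub PiE_arb[OF fil, of b] by (cases "b \<in> skew \<nu> \<mu>") (auto simp: ext_def p)
      qed
      ultimately show "(ideal (ext p), restrict (ext p) (skew (ideal (ext p)) \<mu>)) = p"
        by (simp only: p)
    qed
    then show ?thesis using lhs True by (simp add: n_def del: fold_append prod.lessThan_Suc)
  qed
qed

lemma g_series_eq_fold:
  assumes "\<mu> \<le> \<kappa>" "set_mset M \<subseteq> {1..n}"
  shows "g_series (rows \<kappa>) (rows \<mu>) M
    = fold (\<lambda>k. set_op (column_weight k)) (count_list_upto n M) (\<lambda>\<nu>. of_bool (\<nu> = \<mu>)) \<kappa>"
proof -
  let ?D = "skew \<kappa> \<mu>"
  have cols: "{c. \<exists>r. (r, c) \<in> ?D \<and> T (r, c) = i} = snd ` level ?D T i" for T i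
    by (force simp: level_def)
  have cnt: "count M i = 0" if "i \<notin> {1..n}" for i using assms(2) that by (meson not_in_iff subsetD)
  have "{T. reverse_plane_partition ?D T \<and> (\<forall>i. count M i = card {c. \<exists>r. (r, c) \<in> ?D \<and> T (r, c) = i})}
      = {T \<in> bounded_rpps n ?D. \<forall>i<n. card (snd ` level ?D T (Suc i)) = count M (Suc i)}" (is "?L = ?R")
  proof (intro equalityI subsetI)
    fix T assume T: "T \<in> ?L"
    have "T b \<le> n" if "b \<in> ?D" for b
    proof (rule ccontr)
      assume "\<not> T b \<le> n"
      then have "card (snd ` level ?D T (T b)) = 0" using T cnt[of "T b"] by (simp add: cols)
      then have "level ?D T (T b) = {}" by (simp add: level_def)
      then have "b \<notin> level ?D T (T b)" by simp
      then show False using that by (simp add: level_def)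
    qed
    then show "T \<in> ?R" using T by (simp add: cols bounded_rpps_def)
  next
    fix T assume T: "T \<in> ?R"
    have "count M i = card (snd ` level ?D T i)" for i
    proof (cases "i \<in> {1..n}")
      case True
      then show ?thesis using T by (cases i) auto
    next
      case False
      then have "level ?D T i = {}"
        using T by (fastforce simp: level_def bounded_rpps_def reverse_plane_partition_def filling_def PiE_def Pi_iff)
      then show ?thesis using cnt[OF False] by simp
    qed
    then show "T \<in> ?L" using T by (simp add: cols bounded_rpps_def)
  qed
  then have "g_series (rows \<kappa>) (rows \<mu>) M
      = (\<Sum>T\<in>bounded_rpps n ?D. of_bool (\<forall>i<n. card (snd ` level ?D T (Suc i)) = count M (Suc i)))"
    by (simp add: g_series_def sum.If_cases of_bool_def finite_bounded_rpps Int_def)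
  also have "\<dots> = (\<Sum>T\<in>bounded_rpps n ?D. \<Prod>i<n. column_weight (count M (Suc i)) (level ?D T (Suc i)))"
  proof (intro sum.cong refl)
    fix T
    show "of_bool (\<forall>i<n. card (snd ` level ?D T (Suc i)) = count M (Suc i))
        = (\<Prod>i<n. column_weight (count M (Suc i)) (level ?D T (Suc i)))"
      by (induction n) (auto simp: column_weight_def less_Suc_eq)
  qed
  also have "\<dots> = fold set_op (map column_weight (count_list_upto n M)) (\<lambda>\<nu>. of_bool (\<nu> = \<mu>)) \<kappa>"
    unfolding sum_rpps_eq_fold using assms(1) by (simp add: count_list_upto_def del: upt_Suc)
  finally show ?thesis by (simp add: fold_map comp_def)
qed

section \<open>Valued-set tableaux as chains of shapes\<close>

text \<open>A decomposition into groups is encoded by the set \<open>Q\<close> of the topmost boxes of the groups.\<close>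

definition segment :: "(nat \<times> nat) set \<Rightarrow> nat \<times> nat \<Rightarrow> nat \<times> nat \<Rightarrow> bool" where
  "segment Q q b \<longleftrightarrow> snd q = snd b \<and> fst q \<le> fst b \<and> (\<forall>s. fst q < s \<longrightarrow> s \<le> fst b \<longrightarrow> (s, snd b) \<notin> Q)"

definition block :: "(nat \<times> nat) set \<Rightarrow> (nat \<times> nat) set \<Rightarrow> nat \<times> nat \<Rightarrow> (nat \<times> nat) set" where
  "block D Q q = {b \<in> D. segment Q q b}"

definition block_partition ::
    "(nat \<times> nat) set \<Rightarrow> (nat \<times> nat \<Rightarrow> nat) \<Rightarrow> (nat \<times> nat) set set \<Rightarrow> bool" where
  "block_partition D T P \<longleftrightarrow> partition_on D P \<and>
     (\<forall>A \<in> P. connected_boxes A \<and> (\<exists>c. \<forall>b \<in> A. snd b = c) \<and> (\<exists>i. \<forall>b \<in> A. T b = i))"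

text \<open>A group can reach a box from above only if the box above lies in \<open>D\<close> and
  has the same entry; otherwise a group has to start here.\<close>

definition forced_heads :: "(nat \<times> nat) set \<Rightarrow> (nat \<times> nat \<Rightarrow> nat) \<Rightarrow> (nat \<times> nat) set" where
  "forced_heads D T = {b \<in> D. b \<in> column_tops (level D T (T b))}"

definition heads :: "(nat \<times> nat) set set \<Rightarrow> (nat \<times> nat) set" where
  "heads P = (\<Union>A\<in>P. column_tops A)"

lemma column_tops_subset: "column_tops S \<subseteq> S"
  by (auto simp: column_tops_def)

lemma segment_unique:
  assumes "segment Q q b" "segment Q q' b" "q \<in> Q" "q' \<in> Q"
  shows "q = q'"
proof -
  have "\<not> fst p < fst p'" if "segment Q p b" "segment Q p' b" "p' \<in> Q" for p p'
  proof
    assume "fst p < fst p'"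
    then have "(fst p', snd b) \<notin> Q" using that by (auto simp: segment_def)
    moreover have "p' = (fst p', snd b)" using that(2) by (cases p') (simp add: segment_def)
    ultimately show False using that(3) by metis
  qed
  then have "fst q = fst q'" using assms by (meson linorder_neqE_nat)
  then show ?thesis using assms by (simp add: segment_def prod_eq_iff)
qed

text \<open>A path within one column moves one row at a time and cannot jump over a missing row
  \<open>r'\<close>; the induction keeps it above that row.\<close>

lemma column_convex_connected:
  assumes conn: "connected_boxes A" and col: "\<forall>b\<in>A. snd b = c"
  shows "column_convex A"
  unfolding column_convex_def
proof (intro allI impI, rule ccontr)
  fix r r' r'' d
  assume *: "(r, d) \<in> A" "(r'', d) \<in> A" "r \<le> r'" "r' \<le> r''" "(r', d) \<notin> A"
  then have d: "d = c" using col by force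
  have "((r, d), (r'', d)) \<in> (adjacent \<inter> A \<times> A)\<^sup>*"
    using conn * unfolding connected_boxes_def by blast
  then have "fst (r'', d) < r'"
  proof (induction rule: rtrancl_induct)
    case base
    show ?case using * by (cases "r = r'") auto
  next
    case (step y z)
    then have yz: "y \<in> A" "z \<in> A" "(y, z) \<in> adjacent" by auto
    obtain s where y: "y = (s, c)" using col yz(1) by (cases y) auto
    obtain s' where z: "z = (s', c)" using col yz(2) by (cases z) auto
    have "s' = Suc s \<or> s = Suc s'" using yz(3) by (auto simp: adjacent_def y z)
    moreover have "s' \<noteq> r'" using *(5) yz(2) by (auto simp: z d)
    moreover have "s < r'" using step.IH by (simp add: y)
    ultimately show ?case by (auto simp: z)
  qed
  then show False using *(4) by simp
qed

lemma connected_column_interval: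
  assumes "\<And>s. r1 \<le> s \<Longrightarrow> s \<le> r2 \<Longrightarrow> (s, c) \<in> A" "r1 \<le> r2"
  shows "((r1, c), (r2, c)) \<in> (adjacent \<inter> A \<times> A)\<^sup>* \<and> ((r2, c), (r1, c)) \<in> (adjacent \<inter> A \<times> A)\<^sup>*"
  using assms(2,1)
proof (induction r2 rule: dec_induct)
  case (step n)
  have "((n, c), (Suc n, c)) \<in> adjacent \<inter> A \<times> A" "((Suc n, c), (n, c)) \<in> adjacent \<inter> A \<times> A"
    using step.hyps step.prems by (auto simp: adjacent_def)
  then show ?case
    using step.IH step.prems by (meson converse_rtrancl_into_rtrancl le_SucI rtrancl.rtrancl_into_rtrancl)
qed simp

context
  fixes D :: "(nat \<times> nat) set" and T :: "nat \<times> nat \<Rightarrow> nat" and Q :: "(nat \<times> nat) set"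
  assumes forced: "forced_heads D T \<subseteq> Q" and QD: "Q \<subseteq> D"
begin

lemma not_head_above:
  assumes "(r, c) \<in> D" "(r, c) \<notin> Q"
  obtains r' where "r = Suc r'" "(r', c) \<in> D" "T (r', c) = T (r, c)"
proof -
  have "(r, c) \<notin> forced_heads D T" using assms(2) forced by blast
  then show ?thesis
    using assms(1) that by (auto simp: forced_heads_def column_tops_def level_def)
qed

text \<open>Below its head a segment contains no further heads, so the box above each of these boxes
  lies in \<open>D\<close> with the same entry. The induction walks upwards from the lowest
  box.\<close>

lemma segment_interval:
  assumes "(r, c) \<in> D" "segment Q (r0, c) (r, c)" "r0 \<le> s" "s \<le> r"
  shows "(s, c) \<in> D \<and> T (s, c) = T (r, c) \<and> segment Q (r0, c) (s, c)"
  using assms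
proof (induction r)
  case (Suc r)
  show ?case
  proof (cases "s = Suc r")
    case False
    then have "(Suc r, c) \<notin> Q" using Suc.prems by (auto simp: segment_def)
    then have "(r, c) \<in> D" "T (r, c) = T (Suc r, c)"
      using not_head_above[OF Suc.prems(1)] by (metis nat.inject)+
    moreover have "segment Q (r0, c) (r, c)" using Suc.prems False by (auto simp: segment_def)
    ultimately show ?thesis using Suc.IH Suc.prems False by auto
  qed (use Suc.prems in auto)
qed auto

lemma ex_segment: "(r, c) \<in> D \<Longrightarrow> \<exists>r0. (r0, c) \<in> Q \<and> segment Q (r0, c) (r, c)"
proof (induction r)
  case 0
  then have "(0, c) \<in> Q" using not_head_above[of 0 c] by blast
  then show ?case by (intro exI[of _ 0]) (auto simp: segment_def)
next
  case (Suc r)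
  show ?case
  proof (cases "(Suc r, c) \<in> Q")
    case True
    then show ?thesis by (intro exI[of _ "Suc r"]) (auto simp: segment_def)
  next
    case False
    then have "(r, c) \<in> D" using not_head_above[OF Suc.prems] by (metis nat.inject)
    then obtain r0 where "(r0, c) \<in> Q" "segment Q (r0, c) (r, c)" using Suc.IH by blast
    then show ?thesis using False by (intro exI[of _ r0]) (auto simp: segment_def le_Suc_eq)
  qed
qed

lemma self_in_block: "q \<in> Q \<Longrightarrow> q \<in> block D Q q"
  using QD by (auto simp: block_def segment_def)

lemma inj_on_block: "inj_on (block D Q) Q"
proof (rule inj_onI)
  fix q q' assume *: "q \<in> Q" "q' \<in> Q" "block D Q q = block D Q q'"
  then have "segment Q q' q" "segment Q q q" using self_in_block[of q] by (auto simp: block_def)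
  then show "q = q'" using *(1,2) by (intro segment_unique[of Q q q q'])
qed

lemma block_T:
  assumes "b \<in> block D Q q"
  shows "T b = T q"
proof -
  obtain r c where b: "b = (r, c)" by (cases b)
  obtain r0 where q: "q = (r0, c)" using assms by (cases q) (simp add: b block_def segment_def)
  have "r0 \<le> r" "(r, c) \<in> D" "segment Q (r0, c) (r, c)"
    using assms by (auto simp: b q block_def segment_def)
  then have "T (r0, c) = T (r, c)"
    using segment_interval[of r c r0 r0] by blast
  then show ?thesis by (simp add: q b)
qed

lemma column_tops_block:
  assumes "q \<in> Q"
  shows "column_tops (block D Q q) = {q}"
proof (intro equalityI subsetI)
  fix b assume b: "b \<in> column_tops (block D Q q)"
  obtain r c where bc: "b = (r, c)" by (cases b)
  obtain r0 where q: "q = (r0, c)"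
    using b by (cases q) (simp add: bc column_tops_def block_def segment_def)
  have seg: "(r, c) \<in> D" "segment Q (r0, c) (r, c)"
    using b by (auto simp: bc q column_tops_def block_def)
  have "\<not> r0 < r"
  proof
    assume "r0 < r"
    then obtain r' where r': "r = Suc r'" "r0 \<le> r'" by (cases r) auto
    then have "(r', c) \<in> block D Q q"
      using segment_interval[OF seg, of r'] by (auto simp: block_def q)
    then show False using b r' by (auto simp: column_tops_def bc)
  qed
  then show "b \<in> {q}" using seg by (auto simp: segment_def bc q)
next
  fix b assume "b \<in> {q}"
  then show "b \<in> column_tops (block D Q q)"
    using self_in_block[OF assms] by (cases q) (auto simp: column_tops_def block_def segment_def)
qed

lemma heads_blocks: "heads (block D Q ` Q) = Q"
  using column_tops_block by (auto simp: heads_def)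

lemma block_partition_blocks: "block_partition D T (block D Q ` Q)"
  unfolding block_partition_def
proof (intro conjI ballI)
  show "partition_on D (block D Q ` Q)"
  proof (rule partition_onI)
    show "\<Union> (block D Q ` Q) = D"
    proof (intro equalityI subsetI)
      fix b assume b: "b \<in> D"
      obtain r c where rc: "b = (r, c)" by (cases b)
      then obtain r0 where "(r0, c) \<in> Q" "segment Q (r0, c) b" using ex_segment[of r c] b by blast
      then show "b \<in> \<Union> (block D Q ` Q)" using b unfolding block_def by blast
    qed (auto simp: block_def)
    show "{} \<notin> block D Q ` Q" using self_in_block by blast
    fix A B assume "A \<in> block D Q ` Q" "B \<in> block D Q ` Q" "A \<noteq> B"
    then obtain q q' where q: "q \<in> Q" "A = block D Q q" and q': "q' \<in> Q" "B = block D Q q'" by blast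
    then have "q \<noteq> q'" using \<open>A \<noteq> B\<close> by blast
    then have "\<not> (segment Q q b \<and> segment Q q' b)" for b using segment_unique[OF _ _ q(1) q'(1)] by blast
    then show "disjnt A B" unfolding q(2) q'(2) disjnt_def block_def by blast
  qed
  fix A assume "A \<in> block D Q ` Q"
  then obtain q where q: "q \<in> Q" "A = block D Q q" by blast
  show "\<exists>c. \<forall>b\<in>A. snd b = c" by (auto simp: q block_def segment_def)
  show "\<exists>i. \<forall>b\<in>A. T b = i" by (rule exI[of _ "T q"]) (simp add: q block_T)
  show "connected_boxes A"
    unfolding connected_boxes_def
  proof (intro ballI)
    have *: "((r1, c), (r2, c)) \<in> (adjacent \<inter> A \<times> A)\<^sup>* \<and> ((r2, c), (r1, c)) \<in> (adjacent \<inter> A \<times> A)\<^sup>*"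
      if r12: "(r1, c) \<in> A" "(r2, c) \<in> A" "r1 \<le> r2" for r1 r2 c
    proof (rule connected_column_interval[OF _ r12(3)])
      fix s assume s: "r1 \<le> s" "s \<le> r2"
      obtain r0 where r0: "q = (r0, c)" using r12(1) by (cases q) (simp add: q block_def segment_def)
      have "r0 \<le> r1" "(r2, c) \<in> D" "segment Q (r0, c) (r2, c)"
        using r12 by (auto simp: q r0 block_def segment_def)
      then show "(s, c) \<in> A" using segment_interval[of r2 c r0 s] s by (auto simp: q r0 block_def)
    qed
    fix a b assume ab: "a \<in> A" "b \<in> A"
    obtain r1 c where a: "a = (r1, c)" by (cases a)
    obtain r2 where b: "b = (r2, c)" using ab by (cases b) (auto simp: a q block_def segment_def)
    show "(a, b) \<in> (adjacent \<inter> A \<times> A)\<^sup>*"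
    proof (cases "r1 \<le> r2")
      case True
      then show ?thesis using *[OF ab[unfolded a b]] unfolding a b by blast
    next
      case False
      then show ?thesis using *[OF ab(2,1)[unfolded a b]] unfolding a b by simp
    qed
  qed
qed

lemma card_blocks: "card {A \<in> block D Q ` Q. \<exists>b\<in>A. T b = i} = card {q \<in> Q. T q = i}"
proof -
  have "{A \<in> block D Q ` Q. \<exists>b\<in>A. T b = i} = block D Q ` {q \<in> Q. T q = i}"
  proof (intro equalityI subsetI)
    fix A assume "A \<in> {A \<in> block D Q ` Q. \<exists>b\<in>A. T b = i}"
    then obtain q b where q: "q \<in> Q" "A = block D Q q" and b: "b \<in> A" "T b = i" by auto
    then have "T q = i" using block_T[of b q] by simp
    then show "A \<in> block D Q ` {q \<in> Q. T q = i}" using q by simp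
  next
    fix A assume "A \<in> block D Q ` {q \<in> Q. T q = i}"
    then obtain q where q: "q \<in> Q" "T q = i" "A = block D Q q" by auto
    then show "A \<in> {A \<in> block D Q ` Q. \<exists>b\<in>A. T b = i}"
      using self_in_block[OF q(1)] by (auto intro!: bexI[of _ q])
  qed
  then show ?thesis
    using inj_on_block by (simp add: card_image inj_on_subset)
qed

end

text \<open>A group is connected within one column, hence an interval with a single top. No other
  group has its top inside this interval, so the group is contained in the block of its top.
  Equality follows because a box lies in the block of only one head.\<close>

lemma block_partition_heads:
  assumes P: "block_partition D T P"
  shows "forced_heads D T \<subseteq> heads P" "heads P \<subseteq> D" "block D (heads P) ` heads P = P"
proof -
  have part: "partition_on D P" using P by (simp add: block_partition_def)
  have sub: "A \<subseteq> D" if "A \<in> P" for A using partition_onD1[OF part] that by blast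
  have disj: "A = B" if "A \<in> P" "B \<in> P" "b \<in> A" "b \<in> B" for A B b
    using disjointD[OF partition_onD2[OF part] that(1,2)] that(3,4) by blast
  have blk: "connected_boxes A" "\<exists>c. \<forall>b \<in> A. snd b = c" "\<exists>i. \<forall>b \<in> A. T b = i" if "A \<in> P" for A
    using P that by (simp_all add: block_partition_def)
  show "heads P \<subseteq> D" using sub by (auto simp: heads_def column_tops_def)
  show "forced_heads D T \<subseteq> heads P"
  proof
    fix b assume b: "b \<in> forced_heads D T"
    then obtain A where A: "A \<in> P" "b \<in> A" using partition_onD1[OF part] by (auto simp: forced_heads_def)
    obtain i where "\<forall>a\<in>A. T a = i" using blk(3)[OF A(1)] by blast
    then have "A \<subseteq> level D T (T b)" using sub[OF A(1)] A(2) by (auto simp: level_def)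
    then have "b \<in> column_tops A" using b A(2) by (auto simp: forced_heads_def column_tops_def)
    then show "b \<in> heads P" using A(1) by (auto simp: heads_def)
  qed
  have top: "\<exists>q. column_tops A = {q} \<and> A \<subseteq> block D (heads P) q" if A: "A \<in> P" for A
  proof -
    obtain c where c: "\<forall>b\<in>A. snd b = c" using blk(2)[OF A] by blast
    have conv: "column_convex A" using blk(1)[OF A] c by (rule column_convex_connected)
    have "A \<noteq> {}" using partition_onD3[OF part] A by blast
    then have "snd ` A = {c}" using c by force
    then have "card (column_tops A) = 1" by (simp add: card_column_tops[OF conv])
    then obtain q where q: "column_tops A = {q}" by (auto simp: card_1_singleton_iff)
    have "q \<in> A" using q column_tops_subset by blast
    obtain r0 where r0: "q = (r0, c)" using c \<open>q \<in> A\<close> by (cases q) auto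
    have "segment (heads P) q b" if b: "b \<in> A" for b
    proof -
      obtain r where r: "b = (r, c)" using c b by (cases b) auto
      have qb: "(r0, c) \<in> A" "(r, c) \<in> A" using \<open>q \<in> A\<close> b by (simp_all add: r0 r)
      have "\<not> r < r0"
      proof
        assume less: "r < r0"
        then obtain s where s: "r0 = Suc s" "r \<le> s" by (cases r0) auto
        have "(s, c) \<in> A"
          by (rule column_convexD[OF conv qb(2,1)]) (simp_all add: s)
        moreover have "q \<in> column_tops A" using q by simp
        ultimately show False by (simp add: r0 s column_tops_def)
      qed
      moreover have "(s, c) \<notin> heads P" if s: "r0 < s" "s \<le> r" for s
      proof
        assume "(s, c) \<in> heads P"
        then obtain B where B: "B \<in> P" "(s, c) \<in> column_tops B" by (auto simp: heads_def)
        have "(s, c) \<in> A"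
          by (rule column_convexD[OF conv qb]) (use s in simp_all)
        then have "A = B" using disj[OF A B(1)] B(2) column_tops_subset by blast
        then show False using q B(2) s by (simp add: r0)
      qed
      ultimately show ?thesis by (simp add: segment_def r0 r)
    qed
    then show ?thesis using q sub[OF A] by (auto simp: block_def)
  qed
  have eq: "A = block D (heads P) q" if A: "A \<in> P" and q: "column_tops A = {q}" for A q
  proof
    show "A \<subseteq> block D (heads P) q" using top[OF A] q by auto
    show "block D (heads P) q \<subseteq> A"
    proof
      fix b assume b: "b \<in> block D (heads P) q"
      then obtain B where B: "B \<in> P" "b \<in> B" using partition_onD1[OF part] by (auto simp: block_def)
      obtain q' where q': "column_tops B = {q'}" "B \<subseteq> block D (heads P) q'" using top[OF B(1)] by blast
      have "q \<in> heads P" "q' \<in> heads P" unfolding heads_def using A B(1) q q'(1) by blast+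
      moreover have "segment (heads P) q b" "segment (heads P) q' b"
        using b q'(2) B(2) unfolding block_def by blast+
      ultimately have "q = q'" by (intro segment_unique)
      moreover have "q \<in> A" "q' \<in> B" using q q'(1) column_tops_subset by blast+
      ultimately have "A = B" using disj[OF A B(1)] by blast
      then show "b \<in> A" using B(2) by simp
    qed
  qed
  show "block D (heads P) ` heads P = P"
  proof (intro equalityI subsetI)
    fix A assume A: "A \<in> P"
    then obtain q where q: "column_tops A = {q}" using top by blast
    then have "q \<in> heads P" using A by (auto simp: heads_def)
    then show "A \<in> block D (heads P) ` heads P" using eq[OF A q] by blast
  next
    fix B assume "B \<in> block D (heads P) ` heads P"
    then obtain q where q: "q \<in> heads P" "B = block D (heads P) q" by blast
    then obtain A where A: "A \<in> P" "q \<in> column_tops A" unfolding heads_def by blast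
    then have "column_tops A = {q}" using top[OF A(1)] by auto
    then show "B \<in> P" using eq[OF A(1)] A(1) q(2) by simp
  qed
qed

lemma card_block_partitions:
  "card {P. block_partition D T P \<and> (\<forall>i. f i = card {A \<in> P. \<exists>b\<in>A. T b = i})}
    = card {Q. forced_heads D T \<subseteq> Q \<and> Q \<subseteq> D \<and> (\<forall>i. f i = card {q \<in> Q. T q = i})}"
proof -
  let ?Q = "{Q. forced_heads D T \<subseteq> Q \<and> Q \<subseteq> D \<and> (\<forall>i. f i = card {q \<in> Q. T q = i})}"
  have "{P. block_partition D T P \<and> (\<forall>i. f i = card {A \<in> P. \<exists>b\<in>A. T b = i})} = (\<lambda>Q. block D Q ` Q) ` ?Q"
  proof (intro equalityI subsetI)
    fix P assume P: "P \<in> {P. block_partition D T P \<and> (\<forall>i. f i = card {A \<in> P. \<exists>b\<in>A. T b = i})}"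
    then have bp: "block_partition D T P" by simp
    note h = block_partition_heads[OF bp]
    have "heads P \<in> ?Q" using P h card_blocks[OF h(1,2)] by simp
    then show "P \<in> (\<lambda>Q. block D Q ` Q) ` ?Q" using h(3) by (metis (no_types, lifting) image_eqI)
  next
    fix P assume "P \<in> (\<lambda>Q. block D Q ` Q) ` ?Q"
    then obtain Q where "Q \<in> ?Q" "P = block D Q ` Q" by blast
    then show "P \<in> {P. block_partition D T P \<and> (\<forall>i. f i = card {A \<in> P. \<exists>b\<in>A. T b = i})}"
      by (simp add: block_partition_blocks card_blocks)
  qed
  moreover have "inj_on (\<lambda>Q. block D Q ` Q) ?Q"
    by (rule inj_on_inverseI[of _ heads]) (use heads_blocks in blast)
  ultimately show ?thesis by (simp add: card_image)
qed

section \<open>Counting decompositions level by level\<close>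

lemma card_between:
  assumes "finite S" "F \<subseteq> S"
  shows "card {R. F \<subseteq> R \<and> R \<subseteq> S \<and> card R = k} = (if card F \<le> k then (card S - card F) choose (k - card F) else 0)"
proof (cases "card F \<le> k")
  case True
  have finF: "finite F" using assms finite_subset by blast
  have "bij_betw (\<lambda>B. B \<union> F) {B. B \<subseteq> S - F \<and> card B = k - card F} {R. F \<subseteq> R \<and> R \<subseteq> S \<and> card R = k}"
  proof (rule bij_betwI[where g = "\<lambda>R. R - F"])
    show "(\<lambda>B. B \<union> F) \<in> {B. B \<subseteq> S - F \<and> card B = k - card F} \<rightarrow> {R. F \<subseteq> R \<and> R \<subseteq> S \<and> card R = k}"
    proof
      fix B assume B: "B \<in> {B. B \<subseteq> S - F \<and> card B = k - card F}"
      then have "finite B" "B \<inter> F = {}" using assms finite_subset by auto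
      then show "B \<union> F \<in> {R. F \<subseteq> R \<and> R \<subseteq> S \<and> card R = k}"
        using B assms True finF by (auto simp: card_Un_disjoint)
    qed
  qed (use finF in \<open>auto simp: card_Diff_subset\<close>)
  then have "card {R. F \<subseteq> R \<and> R \<subseteq> S \<and> card R = k} = card {B. B \<subseteq> S - F \<and> card B = k - card F}"
    by (rule bij_betw_same_card[symmetric])
  also have "\<dots> = (card S - card F) choose (k - card F)"
    using assms finF by (subst n_subsets) (auto simp: card_Diff_subset)
  finally show ?thesis using True by simp
next
  case False
  have "\<not> (F \<subseteq> R \<and> R \<subseteq> S \<and> card R = k)" for R
    using False assms(1) card_mono[of R F] finite_subset by blast
  then have "{R. F \<subseteq> R \<and> R \<subseteq> S \<and> card R = k} = {}" by blast
  then show ?thesis using False by (simp only: card.empty if_False)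
qed

lemma strip_weight_eq_card:
  assumes "finite S" "column_convex S" "inj_on fst S"
  shows "strip_weight k S = int (card {R. column_tops S \<subseteq> R \<and> R \<subseteq> S \<and> card R = k})"
proof -
  let ?m = "card S - card (snd ` S)"
  have coeff: "coeff ([:1, 1 :: int:] ^ m) j = int (m choose j)" for m j
  proof (cases "j \<le> m")
    case False
    have "degree ([:1, 1 :: int:] ^ m) \<le> m"
      using degree_power_le[of "[:1, 1 :: int:]" m] by simp
    then show ?thesis using False by (simp add: coeff_eq_0 binomial_eq_0)
  qed (simp add: coeff_linear_poly_power)
  have "strip_weight k S = (if card (snd ` S) \<le> k then int (?m choose (k - card (snd ` S))) else 0)"
    using assms(3) by (simp add: strip_weight_def strip_poly_def coeff_monom_mult coeff)
  then show ?thesis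
    by (subst card_between[OF assms(1) column_tops_subset]) (simp add: card_column_tops[OF assms(2)])
qed

text \<open>Whether a head is forced depends only on the level set of the box, so the heads are
  chosen independently in the level sets.\<close>

lemma card_heads_by_level:
  assumes D: "finite D" and T: "\<And>b. b \<in> D \<Longrightarrow> T b \<in> {1..n}"
    and f: "\<And>i. i \<notin> {1..n} \<Longrightarrow> f i = 0"
  shows "card {Q. forced_heads D T \<subseteq> Q \<and> Q \<subseteq> D \<and> (\<forall>i. f i = card {q \<in> Q. T q = i})}
    = (\<Prod>i<n. card {R. column_tops (level D T (Suc i)) \<subseteq> R \<and> R \<subseteq> level D T (Suc i) \<and> card R = f (Suc i)})"
proof -
  let ?L = "{Q. forced_heads D T \<subseteq> Q \<and> Q \<subseteq> D \<and> (\<forall>i. f i = card {q \<in> Q. T q = i})}"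
  let ?C = "\<lambda>i. {R. column_tops (level D T (Suc i)) \<subseteq> R \<and> R \<subseteq> level D T (Suc i) \<and> card R = f (Suc i)}"
  have "bij_betw (\<lambda>Q. \<lambda>i\<in>{..<n}. {q \<in> Q. T q = Suc i}) ?L (PiE {..<n} ?C)"
  proof (rule bij_betwI[where g = "\<lambda>R. \<Union>i<n. R i"])
    show "(\<lambda>Q. \<lambda>i\<in>{..<n}. {q \<in> Q. T q = Suc i}) \<in> ?L \<rightarrow> PiE {..<n} ?C"
      by (fastforce simp: forced_heads_def column_tops_def level_def)
  next
    show "(\<lambda>R. \<Union>i<n. R i) \<in> PiE {..<n} ?C \<rightarrow> ?L"
    proof
      fix R assume R: "R \<in> PiE {..<n} ?C"
      have Ri: "column_tops (level D T (Suc i)) \<subseteq> R i" "R i \<subseteq> level D T (Suc i)" "card (R i) = f (Suc i)"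
        if "i < n" for i using PiE_mem[OF R, of i] that by auto
      have "forced_heads D T \<subseteq> (\<Union>i<n. R i)"
      proof
        fix b assume b: "b \<in> forced_heads D T"
        then have "T b \<in> {1..n}" using T by (auto simp: forced_heads_def)
        then obtain i where "T b = Suc i" "i < n" by (cases "T b") auto
        then show "b \<in> (\<Union>i<n. R i)" using b Ri(1)[of i] by (auto simp: forced_heads_def)
      qed
      moreover have "(\<Union>i<n. R i) \<subseteq> D" using Ri(2) by (force simp: level_def)
      moreover have "f i = card {q \<in> \<Union>i<n. R i. T q = i}" for i
      proof (cases "i \<in> {1..n}")
        case True
        then obtain j where j: "i = Suc j" "j < n" by (cases i) auto
        have "{q \<in> \<Union>i<n. R i. T q = i} = R j"
          using Ri(2) j by (auto simp: level_def) (force simp: level_def)+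
        then show ?thesis using Ri(3)[OF j(2)] j by simp
      next
        case False
        have "{q \<in> \<Union>i<n. R i. T q = i} = {}"
          using Ri(2) False T by (force simp: level_def)
        then show ?thesis using f[OF False] by (simp only: card.empty)
      qed
      ultimately show "(\<Union>i<n. R i) \<in> ?L" by blast
    qed
  next
    fix Q assume Q: "Q \<in> ?L"
    have "\<exists>i<n. T q = Suc i" if "q \<in> Q" for q
    proof -
      have "T q \<in> {1..n}" using Q T that by blast
      then show ?thesis by (cases "T q") auto
    qed
    then show "(\<Union>i<n. (\<lambda>i\<in>{..<n}. {q \<in> Q. T q = Suc i}) i) = Q" by auto
  next
    fix R assume R: "R \<in> PiE {..<n} ?C"
    show "(\<lambda>i\<in>{..<n}. {q \<in> \<Union>i<n. R i. T q = Suc i}) = R"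
    proof
      fix i
      show "(\<lambda>i\<in>{..<n}. {q \<in> \<Union>i<n. R i. T q = Suc i}) i = R i"
      proof (cases "i < n")
        case True
        have sub: "R j \<subseteq> level D T (Suc j)" if "j < n" for j using PiE_mem[OF R, of j] that by auto
        have "{q \<in> \<Union>i<n. R i. T q = Suc i} = R i"
          using sub True by (auto simp: level_def) (force simp: level_def)+
        then show ?thesis using True by simp
      qed (use PiE_arb[OF R, of i] in simp)
    qed
  qed
  then show ?thesis by (simp add: bij_betw_same_card card_PiE)
qed

lemma column_convex_level:
  assumes "reverse_plane_partition (skew \<kappa> \<mu>) T"
  shows "column_convex (level (skew \<kappa> \<mu>) T i)"
  unfolding column_convex_def
proof (intro allI impI)
  fix r r' r'' c
  assume *: "(r, c) \<in> level (skew \<kappa> \<mu>) T i" "(r'', c) \<in> level (skew \<kappa> \<mu>) T i" "r \<le> r'" "r' \<le> r''"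
  then have mem: "(r, c) \<in> skew \<kappa> \<mu>" "(r'', c) \<in> skew \<kappa> \<mu>" and T: "T (r, c) = i" "T (r'', c) = i"
    by (simp_all only: level_def mem_Collect_eq)
  have mem': "(r', c) \<in> skew \<kappa> \<mu>"
    by (rule column_convexD[OF column_convex_skew mem *(3,4)])
  have "T (r, c) \<le> T (r', c)" "T (r', c) \<le> T (r'', c)"
    using rpp_mono[OF assms mem(1) mem' *(3)] rpp_mono[OF assms mem' mem(2) *(4)] by simp_all
  then show "(r', c) \<in> level (skew \<kappa> \<mu>) T i"
    using mem' T unfolding level_def by simp
qed

text \<open>Strictness along rows is hidden in the weights: if it fails, two boxes of one row lie in
  the same level set, which is then not a vertical strip and contributes the factor 0.\<close>

lemma card_valued_set_tableaux:
  fixes \<kappa> \<mu> :: young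
  defines "D \<equiv> skew \<kappa> \<mu>"
  assumes T: "T \<in> bounded_rpps n D" and f: "\<And>i. i \<notin> {1..n} \<Longrightarrow> f i = 0"
  shows "int (card {P. valued_set_tableau D T P \<and> (\<forall>i. f i = card {A \<in> P. \<exists>b\<in>A. T b = i})})
    = (\<Prod>i<n. strip_weight (f (Suc i)) (level D T (Suc i)))"
proof -
  have rpp: "reverse_plane_partition D T" and bd: "\<forall>b\<in>D. T b \<le> n" using T by (simp_all add: bounded_rpps_def)
  have fil: "filling D T"
    and col: "\<forall>r r' c. (r, c) \<in> D \<and> (r', c) \<in> D \<and> r < r' \<longrightarrow> T (r, c) \<le> T (r', c)"
    using rpp[unfolded reverse_plane_partition_def]
    by - (elim conjE, assumption)+
  have T1: "T b \<in> {1..n}" if "b \<in> D" for b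
    using PiE_mem[OF fil[unfolded filling_def] that] bd that by simp
  show ?thesis
  proof (cases "\<forall>r c c'. (r, c) \<in> D \<and> (r, c') \<in> D \<and> c < c' \<longrightarrow> T (r, c) < T (r, c')")
    case True
    then have "valued_set_tableau D T P \<longleftrightarrow> block_partition D T P" for P
      by (simp only: valued_set_tableau_def block_partition_def fil[THEN eqTrueI] col[THEN eqTrueI]
          True[THEN eqTrueI] simp_thms)
    then have "card {P. valued_set_tableau D T P \<and> (\<forall>i. f i = card {A \<in> P. \<exists>b\<in>A. T b = i})}
        = (\<Prod>i<n. card {R. column_tops (level D T (Suc i)) \<subseteq> R \<and> R \<subseteq> level D T (Suc i) \<and> card R = f (Suc i)})"
      by (simp only: card_block_partitions) (rule card_heads_by_level, use T1 f in \<open>simp_all add: D_def\<close>)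
    moreover have "strip_weight k (level D T i)
        = int (card {R. column_tops (level D T i) \<subseteq> R \<and> R \<subseteq> level D T i \<and> card R = k})" for k i
    proof (rule strip_weight_eq_card)
      show "finite (level D T i)" by (simp add: level_def D_def)
      show "column_convex (level D T i)" using column_convex_level rpp by (simp add: D_def)
      show "inj_on fst (level D T i)"
      proof (rule inj_onI)
        fix a b assume *: "a \<in> level D T i" "b \<in> level D T i" "fst a = fst b"
        obtain r c where a: "a = (r, c)" by (cases a)
        obtain c' where b: "b = (r, c')" using *(3) by (cases b) (simp add: a)
        have "\<not> c < c'" "\<not> c' < c"
          using True[rule_format, of r c c'] True[rule_format, of r c' c] *(1,2) by (auto simp: level_def a b)
        then show "a = b" by (simp add: a b)
      qed
    qed
    ultimately show ?thesis by simp
  next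
    case False
    then obtain r c c' where *: "(r, c) \<in> D" "(r, c') \<in> D" "c < c'" "\<not> T (r, c) < T (r, c')" by blast
    have novst: "\<not> valued_set_tableau D T P" for P
    proof
      assume "valued_set_tableau D T P"
      then have "\<forall>r c c'. (r, c) \<in> D \<and> (r, c') \<in> D \<and> c < c' \<longrightarrow> T (r, c) < T (r, c')"
        by (simp add: valued_set_tableau_def)
      then show False using False by simp
    qed
    have eq: "T (r, c) = T (r, c')"
      using rpp_mono[OF rpp[unfolded D_def] *(1,2)[unfolded D_def]] *(3,4) by simp
    obtain i where i: "T (r, c) = Suc i" "i < n" using T1[OF *(1)] by (cases "T (r, c)") auto
    have mem: "(r, c) \<in> level D T (Suc i)" "(r, c') \<in> level D T (Suc i)"
      using *(1,2) eq i(1) by (simp_all add: level_def)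
    have "\<not> inj_on fst (level D T (Suc i))"
    proof
      assume "inj_on fst (level D T (Suc i))"
      from inj_onD[OF this _ mem] show False using *(3) by simp
    qed
    then have "strip_weight (f (Suc i)) (level D T (Suc i)) = 0"
      by (simp add: strip_weight_def strip_poly_def)
    then have "(\<Prod>i<n. strip_weight (f (Suc i)) (level D T (Suc i))) = 0"
      by (intro prod_zero bexI[of _ i]) (use i(2) in auto)
    then show ?thesis by (simp add: novst)
  qed
qed

lemma j_series_eq_fold:
  assumes "\<mu> \<le> \<kappa>" "set_mset M \<subseteq> {1..n}"
  shows "j_series (rows \<kappa>) (rows \<mu>) M
    = fold (\<lambda>k. set_op (strip_weight k)) (count_list_upto n M) (\<lambda>\<nu>. of_bool (\<nu> = \<mu>)) \<kappa>"
proof -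
  let ?D = "skew \<kappa> \<mu>"
  let ?P = "\<lambda>T. {P. valued_set_tableau ?D T P \<and> (\<forall>i. count M i = card {A \<in> P. \<exists>b\<in>A. T b = i})}"
  have cnt: "count M i = 0" if "i \<notin> {1..n}" for i using assms(2) that by (meson not_in_iff subsetD)
  have finP: "finite (?P T)" for T
  proof (rule finite_subset)
    show "?P T \<subseteq> Pow (Pow ?D)" by (auto simp: valued_set_tableau_def dest!: partition_onD1)
  qed simp
  have "{(T, P). valued_set_tableau ?D T P \<and> (\<forall>i. count M i = card {A \<in> P. \<exists>b\<in>A. T b = i})}
      = Sigma (bounded_rpps n ?D) ?P"
  proof -
    have "T \<in> bounded_rpps n ?D" if P: "P \<in> ?P T" for T P
    proof -
      have vst: "valued_set_tableau ?D T P" using P by simp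
      have part: "partition_on ?D P" using vst by (simp add: valued_set_tableau_def)
      have "finite P" by (rule finite_elements[OF _ part]) simp
      have "T b \<le> n" if b: "b \<in> ?D" for b
      proof (rule ccontr)
        assume "\<not> T b \<le> n"
        then have "card {A \<in> P. \<exists>a\<in>A. T a = T b} = 0" using P cnt[of "T b"] by auto
        then have "{A \<in> P. \<exists>a\<in>A. T a = T b} = {}" using \<open>finite P\<close> by simp
        then show False using partition_onD1[OF part] b by blast
      qed
      moreover have "reverse_plane_partition ?D T"
        using vst by (auto simp: valued_set_tableau_def reverse_plane_partition_def intro: less_imp_le)
      ultimately show ?thesis by (simp add: bounded_rpps_def)
    qed
    then show ?thesis by blast
  qed
  then have "j_series (rows \<kappa>) (rows \<mu>) M = int (card (Sigma (bounded_rpps n ?D) ?P))"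
    by (simp add: j_series_def)
  also have "\<dots> = (\<Sum>T\<in>bounded_rpps n ?D. int (card (?P T)))"
    using finP by (simp add: finite_bounded_rpps)
  also have "\<dots> = (\<Sum>T\<in>bounded_rpps n ?D. \<Prod>i<n. strip_weight (count M (Suc i)) (level ?D T (Suc i)))"
    by (intro sum.cong refl card_valued_set_tableaux cnt)
  also have "\<dots> = fold set_op (map strip_weight (count_list_upto n M)) (\<lambda>\<nu>. of_bool (\<nu> = \<mu>)) \<kappa>"
    unfolding sum_rpps_eq_fold using assms(1) by (simp add: count_list_upto_def del: upt_Suc)
  finally show ?thesis by (simp add: fold_map comp_def)
qed

section \<open>The theorem\<close>

definition chain_sum ::
    "(nat \<Rightarrow> (nat \<times> nat) set \<Rightarrow> int) \<Rightarrow> young \<Rightarrow> young \<Rightarrow> nat list \<Rightarrow> int" where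
  "chain_sum w \<mu> \<kappa> ks = fold (\<lambda>k. set_op (w k)) ks (\<lambda>\<nu>. of_bool (\<nu> = \<mu>)) \<kappa>"

definition chain_part ::
    "(nat \<Rightarrow> (nat \<times> nat) set \<Rightarrow> int) \<Rightarrow> young \<Rightarrow> young \<Rightarrow> nat multiset \<Rightarrow> int" where
  "chain_part w \<mu> \<kappa> \<nu> = chain_sum w \<mu> \<kappa> (sorted_list_of_multiset \<nu>)"

text \<open>Commutation makes the order of the exponents irrelevant, and zero exponents act as the
  identity; this is the symmetry of \<open>g_series\<close>.\<close>

lemma chain_part_columns:
  "chain_part column_weight \<mu> \<kappa> (mset (filter (\<lambda>k. k \<noteq> 0) ks)) = chain_sum column_weight \<mu> \<kappa> ks"
  unfolding chain_part_def chain_sum_def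
  by (subst columns.fold_nonzero[of _ ks]) (auto simp: columns_op_commute simp flip: mset_filter)

lemma strips_op_eq: "(\<lambda>n. set_op (strip_weight n)) = eop (\<lambda>k. set_op (column_weight k))"
  by (intro ext) (simp only: strips_eq_eop_columns)

text \<open>Words in \<open>part_op\<close> at the empty multiset have the values of words in the
  column operators at \<kappa>. By transfer the derived words agree too, and on shapes the derived
  operators are those of strips.\<close>

lemma omega_part_chain_part:
  assumes "set_mset M \<subseteq> {1..n}"
  shows "omega_part (chain_part column_weight \<mu> \<kappa>) (shape M)
    = chain_sum strip_weight \<mu> \<kappa> (count_list_upto n M)"
  unfolding omega_part_shape[OF assms] chain_sum_def strips_op_eq
proof (rule part.fold_eop_transfer[OF columns.op_family_axioms])
  fix ks
  show "fold part_op ks (chain_part column_weight \<mu> \<kappa>) {#}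
      = fold (\<lambda>k. set_op (column_weight k)) ks (\<lambda>\<nu>. of_bool (\<nu> = \<mu>)) \<kappa>"
    unfolding fold_part_op add_0_right chain_part_columns by (simp only: chain_sum_def)
qed

lemma filling_pos: "filling D T \<Longrightarrow> b \<in> D \<Longrightarrow> T b \<noteq> 0"
  unfolding filling_def by (drule PiE_mem) auto

lemma g_series_0:
  assumes "0 \<in># M"
  shows "g_series lam mu M = 0"
proof -
  let ?D = "skew_diagram lam mu"
  have "\<not> (reverse_plane_partition ?D T \<and> (\<forall>i. count M i = card {c. \<exists>r. (r, c) \<in> ?D \<and> T (r, c) = i}))" for T
  proof
    assume T: "reverse_plane_partition ?D T \<and> (\<forall>i. count M i = card {c. \<exists>r. (r, c) \<in> ?D \<and> T (r, c) = i})"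
    then have fil: "filling ?D T" by (simp add: reverse_plane_partition_def)
    have "{c. \<exists>r. (r, c) \<in> ?D \<and> T (r, c) = 0} = {}" using filling_pos[OF fil] by blast
    moreover have "count M 0 = card {c. \<exists>r. (r, c) \<in> ?D \<and> T (r, c) = 0}" using T by blast
    ultimately have "count M 0 = 0" by (simp only: card.empty)
    then show False using assms by (simp add: count_eq_zero_iff)
  qed
  then have "{T. reverse_plane_partition ?D T \<and> (\<forall>i. count M i = card {c. \<exists>r. (r, c) \<in> ?D \<and> T (r, c) = i})} = {}"
    by blast
  then show ?thesis unfolding g_series_def by (simp only: card.empty of_nat_0)
qed

lemma j_series_0:
  assumes "0 \<in># M"
  shows "j_series lam mu M = 0"
proof -
  let ?D = "skew_diagram lam mu"
  have "\<not> (valued_set_tableau ?D T P \<and> (\<forall>i. count M i = card {A \<in> P. \<exists>b\<in>A. T b = i}))" for T P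
  proof
    assume T: "valued_set_tableau ?D T P \<and> (\<forall>i. count M i = card {A \<in> P. \<exists>b\<in>A. T b = i})"
    then have fil: "filling ?D T" and part: "partition_on ?D P" by (simp_all add: valued_set_tableau_def)
    have "{A \<in> P. \<exists>b\<in>A. T b = 0} = {}" using filling_pos[OF fil] partition_onD1[OF part] by blast
    moreover have "count M 0 = card {A \<in> P. \<exists>b\<in>A. T b = 0}" using T by blast
    ultimately have "count M 0 = 0" by (simp only: card.empty)
    then show False using assms by (simp add: count_eq_zero_iff)
  qed
  then have "{(T, P). valued_set_tableau ?D T P \<and> (\<forall>i. count M i = card {A \<in> P. \<exists>b\<in>A. T b = i})} = {}"
    by blast
  then show ?thesis unfolding j_series_def by (simp only: card.empty of_nat_0)
qed

lemma support_bound: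
  assumes "0 \<notin># M"
  obtains n where "set_mset M \<subseteq> {1..n :: nat}"
proof
  show "set_mset M \<subseteq> {1..Max (insert 0 (set_mset M))}"
    using assms by (auto simp: Suc_le_eq intro!: gr0I)
qed

lemma g_series_eq_sym_of:
  assumes "\<mu> \<le> \<kappa>"
  shows "g_series (rows \<kappa>) (rows \<mu>) = sym_of (chain_part column_weight \<mu> \<kappa>)"
proof
  fix M
  show "g_series (rows \<kappa>) (rows \<mu>) M = sym_of (chain_part column_weight \<mu> \<kappa>) M"
  proof (cases "0 \<in># M")
    case True
    then show ?thesis by (simp add: g_series_0 sym_of_def)
  next
    case False
    then obtain n where n: "set_mset M \<subseteq> {1..n}" by (rule support_bound)
    have "g_series (rows \<kappa>) (rows \<mu>) M = chain_sum column_weight \<mu> \<kappa> (count_list_upto n M)"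
      unfolding chain_sum_def by (rule g_series_eq_fold[OF assms n])
    also have "\<dots> = chain_part column_weight \<mu> \<kappa> (shape M)"
      by (simp only: chain_part_columns flip: mset_filter_count_list_upto[OF n])
    finally show ?thesis using False by (simp add: sym_of_def)
  qed
qed

lemma j_series_eq_sym_of:
  assumes "\<mu> \<le> \<kappa>"
  shows "j_series (rows \<kappa>) (rows \<mu>) = sym_of (omega_part (chain_part column_weight \<mu> \<kappa>))"
proof
  fix M
  show "j_series (rows \<kappa>) (rows \<mu>) M = sym_of (omega_part (chain_part column_weight \<mu> \<kappa>)) M"
  proof (cases "0 \<in># M")
    case True
    then show ?thesis by (simp add: j_series_0 sym_of_def)
  next
    case False
    then obtain n where n: "set_mset M \<subseteq> {1..n}" by (rule support_bound)
    have "j_series (rows \<kappa>) (rows \<mu>) M = chain_sum strip_weight \<mu> \<kappa> (count_list_upto n M)"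
      unfolding chain_sum_def by (rule j_series_eq_fold[OF assms n])
    then show ?thesis using False by (simp add: sym_of_def omega_part_chain_part[OF n])
  qed
qed

text \<open>Each column counted for an entry contains a box with that entry, and the level sets are
  disjoint.\<close>

lemma g_series_bounded:
  assumes "g_series (rows \<kappa>) (rows \<mu>) M \<noteq> 0"
  shows "size M \<le> card (skew \<kappa> \<mu>)"
proof -
  let ?D = "skew \<kappa> \<mu>"
  obtain T where "\<forall>i. count M i = card {c. \<exists>r. (r, c) \<in> ?D \<and> T (r, c) = i}"
  proof -
    have "{T. reverse_plane_partition ?D T \<and> (\<forall>i. count M i = card {c. \<exists>r. (r, c) \<in> ?D \<and> T (r, c) = i})} \<noteq> {}"
      using assms unfolding g_series_def by (intro notI) (simp only: card.empty of_nat_0)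
    then show ?thesis using that by blast
  qed
  moreover have "{c. \<exists>r. (r, c) \<in> ?D \<and> T (r, c) = i} = snd ` level ?D T i" for i
    by (force simp: level_def)
  ultimately have cnt: "count M i = card (snd ` level ?D T i)" for i by simp
  have "size M = (\<Sum>i\<in>set_mset M. card (snd ` level ?D T i))"
    by (simp add: size_multiset_overloaded_eq cnt)
  also have "\<dots> \<le> (\<Sum>i\<in>set_mset M. card (level ?D T i))"
    by (intro sum_mono card_image_le) (simp add: level_def)
  also have "\<dots> = card (\<Union>i\<in>set_mset M. level ?D T i)"
    by (rule card_UN_disjoint[symmetric]) (auto simp: level_def)
  also have "\<dots> \<le> card ?D"
    by (intro card_mono) (auto simp: level_def)
  finally show ?thesis .
qed

lemma symmetric_function_g_series:
  assumes "\<mu> \<le> \<kappa>"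
  shows "symmetric_function (g_series (rows \<kappa>) (rows \<mu>))"
  unfolding g_series_eq_sym_of[OF assms]
proof (rule symmetric_function_sym_of)
  fix \<nu> assume nz: "chain_part column_weight \<mu> \<kappa> \<nu> \<noteq> 0"
  \<comment> \<open>The value at \<nu> is realised as a coefficient of \<open>g_series\<close>, zero
    parts becoming zero exponents, so that \<open>g_series_bounded\<close> applies.\<close>
  define ks where "ks = sorted_list_of_multiset \<nu>"
  have cl: "count_list_upto (length ks) (of_count_list ks) = ks"
    by (rule count_list_upto_of_count_list) simp
  have "g_series (rows \<kappa>) (rows \<mu>) (of_count_list ks) = chain_part column_weight \<mu> \<kappa> \<nu>"
    by (simp only: g_series_eq_fold[OF assms set_of_count_list] cl chain_part_def chain_sum_def ks_def[symmetric])
  then have "size (of_count_list ks) \<le> card (skew \<kappa> \<mu>)" using nz by (intro g_series_bounded) simp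
  moreover have "size (of_count_list ks) = sum_list ks"
  proof -
    have "size (of_count_list ks) = sum_list (filter (\<lambda>k. k \<noteq> 0) ks)"
      by (simp only: sum_mset_shape[symmetric] shape_of_count_list sum_mset_sum_list)
    also have "\<dots> = sum_list ks" by (induction ks) auto
    finally show ?thesis .
  qed
  moreover have "sum_list ks = sum_mset \<nu>" unfolding ks_def by (metis mset_sorted_list_of_multiset sum_mset_sum_list)
  ultimately show "sum_mset \<nu> \<le> card (skew \<kappa> \<mu>)" by simp
qed

theorem proposition9p25:
  fixes lam mu :: "nat \<Rightarrow> nat"
  assumes "is_partition lam" and "is_partition mu" and "\<forall>r. mu r \<le> lam r"
  shows "omega (g_series lam mu) = j_series lam mu"
proof -
  define \<kappa> \<mu> where "\<kappa> = Young lam" and "\<mu> = Young mu"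
  have rows: "rows \<kappa> = lam" "rows \<mu> = mu"
    using assms(1,2) by (simp_all add: \<kappa>_def \<mu>_def Young_inverse)
  have le: "\<mu> \<le> \<kappa>" using assms(3) by (simp add: less_eq_young_def rows le_fun_def)
  have "omega (g_series (rows \<kappa>) (rows \<mu>)) = omega_map (g_series (rows \<kappa>) (rows \<mu>))"
    using symmetric_function_g_series[OF le] by (simp add: omega_eq Sym_def)
  also have "\<dots> = j_series (rows \<kappa>) (rows \<mu>)"
    by (simp only: g_series_eq_sym_of[OF le] omega_map_sym_of j_series_eq_sym_of[OF le])
  finally show ?thesis by (simp only: rows)
qed

end
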